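(* Let $P\in\mathbb{Z}[T,X]$ be an irreducible polynomial, monic of degree $3$ in $X$, such that $P(t,X)$ has only one real zero $\xi_t$ for all sufficiently large positive integers $t$. Let $\xi\in\overline{\mathbb{Q}(T)}$ be a root of $P(T,X)$, and suppose that there exists a non-constant unit $\gamma\in\mathbb{Z}[T,\xi]^*$. Then for any $\varepsilon>0$ there are $C(\varepsilon),t_0(\varepsilon)$, effectively depending on $\varepsilon$ and $\xi$, such that for any positive integer $t\ge t_0(\varepsilon)$ and any integer $q\ne 0$, the solutions $(x,y)\in\mathbb{Z}^2$ of $$\mathrm{Norm}(x-\xi_t y)=q$$ satisfy $$\max\{|x|,|y|\}\le t^{C(\varepsilon)}|q|^{1+\varepsilon}.$$
   Context: $\mathbb{Z}[T,\xi]^*$ is the group of units of the ring $\mathbb{Z}[T,\xi]$; a unit is non-constant if it is not an algebraic number (not in $\overline{\mathbb{Q}}$). $\mathrm{Norm}(x-\xi_t y)$ denotes the product $\prod_{j=1}^3(x-\xi_t^{(j)}y)$ over the three complex zeros $\xi_t^{(1)}=\xi_t,\xi_t^{(2)},\xi_t^{(3)}$ of $P(t,X)$, i.e. the norm from $\mathbb{Q}(\xi_t)$ to $\mathbb{Q}$ for $t$ large. *)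

theory Defs
  imports
    "HOL-Algebra.Algebraic_Closure_Type"
    "HOL-Computational_Algebra.Computational_Algebra"
    "HOL-Library.Nat_Bijection"
    Complex_Main
begin

text \<open>
  Elements of \<open>\<int>[T,X]\<close> have type \<^typ>\<open>int poly poly\<close>: the outer indeterminate is \<open>X\<close>, the inner one
  is \<open>T\<close>. The type \<^typ>\<open>int poly fract alg_closure\<close> is an algebraic closure of \<open>\<rat>(T) = Frac \<int>[T]\<close>.
\<close>

type_synonym qt_closure = "int poly fract alg_closure"

definition const_qt :: "int poly \<Rightarrow> qt_closure" where
  "const_qt c = to_ac (to_fract c)"

definition eval_at :: "int poly poly \<Rightarrow> qt_closure \<Rightarrow> qt_closure" where
  "eval_at Q z = poly (map_poly const_qt Q) z"

definition Z_adjoin :: "qt_closure \<Rightarrow> qt_closure set" where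
  "Z_adjoin z = range (\<lambda>Q. eval_at Q z)"

definition unit_in :: "'a :: field set \<Rightarrow> 'a \<Rightarrow> bool" where
  "unit_in R u \<longleftrightarrow> u \<in> R \<and> (\<exists>v\<in>R. u * v = 1)"

definition specialize :: "int poly poly \<Rightarrow> int \<Rightarrow> int poly" where
  "specialize P t = map_poly (\<lambda>c. poly c t) P"

text \<open>
  \<^const>\<open>proots\<close> counts zeros with multiplicity, so for \<open>P\<close> monic of degree 3 in \<open>X\<close> the product has
  three factors for every \<open>t\<close>.
\<close>

definition norm_form :: "int poly poly \<Rightarrow> int \<Rightarrow> int \<Rightarrow> int \<Rightarrow> complex" where
  "norm_form P t x y =
     (\<Prod>z\<in>#proots (map_poly of_int (specialize P t) :: complex poly). of_int x - z * of_int y)"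

text \<open>
  Effectivity is expressed through the partial recursive functions: \<open>rec_eval f xs y\<close> says that
  the computation of \<open>f\<close> on the arguments \<open>xs\<close> halts with value \<open>y\<close>.
\<close>

datatype recf =
    Zero
  | Succ
  | Proj nat
  | Comp recf "recf list"
  | PrimRec recf recf
  | Mu recf

inductive rec_eval :: "recf \<Rightarrow> nat list \<Rightarrow> nat \<Rightarrow> bool" where
  zero: "rec_eval Zero xs 0"
| succ: "rec_eval Succ [x] (Suc x)"
| proj: "i < length xs \<Longrightarrow> rec_eval (Proj i) xs (xs ! i)"
| comp: "list_all2 (\<lambda>g y. rec_eval g xs y) gs ys \<Longrightarrow> rec_eval f ys z \<Longrightarrow> rec_eval (Comp f gs) xs z"
| prim_0: "rec_eval f xs z \<Longrightarrow> rec_eval (PrimRec f g) (0 # xs) z"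
| prim_Suc: "rec_eval (PrimRec f g) (n # xs) y \<Longrightarrow> rec_eval g (n # y # xs) z \<Longrightarrow>
     rec_eval (PrimRec f g) (Suc n # xs) z"
| mu: "rec_eval f (n # xs) 0 \<Longrightarrow> (\<forall>m<n. \<exists>y. rec_eval f (m # xs) (Suc y)) \<Longrightarrow> rec_eval (Mu f) xs n"

inductive_cases rec_evalE:
  "rec_eval Zero xs z" "rec_eval Succ xs z" "rec_eval (Proj i) xs z" "rec_eval (Comp f gs) xs z"
  "rec_eval (PrimRec f g) (0 # xs) z" "rec_eval (PrimRec f g) (Suc n # xs) z"
  "rec_eval (Mu f) xs z"

lemma rec_eval_deterministic: "rec_eval f xs y \<Longrightarrow> rec_eval f xs z \<Longrightarrow> y = z"
proof (induction arbitrary: z rule: rec_eval.induct)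
  case (comp xs gs ys f w)
  from comp.prems obtain ys' where
    ys': "list_all2 (\<lambda>g y. rec_eval g xs y) gs ys'" "rec_eval f ys' z"
    by (rule rec_evalE(4))
  have "ys = ys'"
    using comp.IH(1) ys'(1) unfolding list_all2_conv_all_nth
    by (intro nth_equalityI) auto
  with comp.IH(2) ys'(2) show ?case by blast
next
  case (prim_0 f xs w g)
  from prim_0.prems have "rec_eval f xs z" by (rule rec_evalE(5))
  with prim_0.IH show ?case by blast
next
  case (prim_Suc f g n xs y w)
  from prim_Suc.prems obtain y' where
    "rec_eval (PrimRec f g) (n # xs) y'" "rec_eval g (n # y' # xs) z"
    by (rule rec_evalE(6))
  with prim_Suc.IH show ?case by blast
next
  case (mu f n xs)
  from mu.prems have z: "rec_eval f (z # xs) 0" "\<forall>m<z. \<exists>y. rec_eval f (m # xs) (Suc y)"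
    by (rule rec_evalE(7), blast)+
  have "\<not> n < z"
  proof
    assume "n < z"
    with z(2) obtain y where "rec_eval f (n # xs) (Suc y)" by blast
    with mu.IH(1) have "0 = Suc y" by blast
    then show False by simp
  qed
  moreover have "\<not> z < n"
  proof
    assume "z < n"
    with mu.IH(2) obtain y where "\<forall>w. rec_eval f (z # xs) w \<longrightarrow> Suc y = w" by blast
    with z(1) have "Suc y = 0" by blast
    then show False by simp
  qed
  ultimately show ?case by linarith
qed (blast elim: rec_evalE(1) rec_evalE(2) rec_evalE(3))+

text \<open>
  An element \<open>\<xi>\<close> with minimal polynomial \<open>P\<close> is presented to an algorithm by the coefficients of \<open>P\<close>.
  A real \<open>\<epsilon> > 0\<close> is presented by naturals \<open>a, b > 0\<close> with \<open>a / b \<le> \<epsilon>\<close>; the bounds only get weaker as \<open>\<epsilon>\<close>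
  grows, because \<open>\<bar>q\<bar> \<ge> 1\<close>.
\<close>

definition poly_code :: "int poly poly \<Rightarrow> nat" where
  "poly_code P =
     list_encode (map (\<lambda>c. list_encode (map int_encode (coeffs c))) (coeffs P))"

lemma poly_code_inj: "inj poly_code"
proof (rule injI)
  fix P Q assume eq: "poly_code P = poly_code Q"
  have "inj (map int_encode)"
    by (rule inj_mapI) (rule inj_int_encode)
  then have "inj (\<lambda>c :: int poly. list_encode (map int_encode (coeffs c)))"
    by (intro injI) (simp add: list_encode_eq inj_eq coeffs_eq_iff)
  then have "inj (map (\<lambda>c :: int poly. list_encode (map int_encode (coeffs c))))"
    by (rule inj_mapI)
  with eq show "P = Q"
    by (simp add: poly_code_def list_encode_eq inj_eq coeffs_eq_iff)
qed

end

theory Submission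
  imports Defs "HOL-Complex_Analysis.Complex_Analysis"
begin

text \<open>
  The substitution \<open>Y = 3 X + P\<^sub>2\<close>, with \<open>P\<^sub>2\<close> the coefficient of \<open>X\<^sup>2\<close>, turns \<open>P\<close> into a cubic \<open>Y\<^sup>3 + p Y + q\<close> over
  \<open>\<int>[T]\<close>. Put \<open>u = 1 / T\<close>. The norm of the unit is constant, so one of the other two coefficients of its
  characteristic polynomial is not; hence the Newton polygon at \<open>T = \<infinity>\<close> has a side of length one, and the
  cubic has a root in \<open>\<rat>((u))\<close>. After division by \<open>T\<^sup>d\<close> this is a power series \<open>\<eta>\<close> over \<open>\<rat>\<close> that satisfies
  \<open>\<eta>\<^sup>3 + f\<^sub>2 \<eta> + f\<^sub>3 = 0\<close> with \<open>f\<^sub>2\<close> and \<open>f\<^sub>3\<close> in \<open>\<int>[u]\<close> (\<open>power_series_root\<close>). For large \<open>t\<close> the number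
  \<open>\<xi> = t\<^sup>d \<eta>(1/t)\<close> is a zero of the cubic specialized at \<open>t\<close>, and the task is to bound \<open>x - \<xi> y\<close> from below.

  The bound comes from rational approximations to the function \<open>\<eta>\<close>. By Eisenstein's theorem (\<open>eisenstein\<close>)
  the denominators and sizes of the coefficients of \<open>\<eta>\<close> grow only geometrically, and Siegel's lemma yields
  polynomials \<open>A\<close>, \<open>B\<close> of degree at most \<open>k = s l\<close> with heights exponential in \<open>k\<close> such that \<open>A - B \<eta>\<close> vanishes to
  order greater than \<open>k + R\<close>, where \<open>R = (s - 1) l\<close> (\<open>pade_approximation\<close>). At \<open>u = 1 / t\<close> this gives, up to powers
  of \<open>t\<close> with exponent \<open>O(l)\<close>, approximations of quality \<open>t\<^sup>-\<^sup>2\<^sup>k\<close> with denominators of size \<open>t\<^sup>k\<close>, for every \<open>l\<close>, and for large \<open>s\<close> the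
  loss is negligible.

  An approximation is of use only if it is not proportional to \<open>x - \<xi> y\<close>. This is where the degree three
  enters: the roots of a cubic satisfy a Riccati equation, so the functions \<open>(A - B y) / (3 y\<^sup>2 + f\<^sub>2)\<close> for the
  roots \<open>y\<close> have trace zero and span a space of dimension two, and their Wronskian is, up to known factors,
  a polynomial in \<open>u\<close>. This polynomial is not zero (\<open>wronskian_nonzero\<close>), has degree \<open>2 k + O(1)\<close> and vanishes to
  order \<open>k + R\<close> at \<open>0\<close>; therefore its order at \<open>1 / t\<close> is at most \<open>l + O(1)\<close>. So one of the first \<open>l + O(1)\<close> Taylor
  coefficients at \<open>1 / t\<close> gives a linear form in \<open>1\<close> and \<open>\<xi>\<close> independent of \<open>x - \<xi> y\<close>. After rescaling by the square
  of the discriminant these forms have integer coefficients, again because of the vanishing trace. This is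
  \<open>basic_inequality\<close>, and \<open>linear_form_inequality\<close> is its form with all constants absorbed into powers of \<open>t\<close>.

  Since \<open>P(t, X)\<close> has a single real zero, the discriminant is positive for large \<open>t\<close> and the norm form is the product of
  \<open>x - \<xi> y\<close> and a definite quadratic form (\<open>linear_factor_upper\<close>). With a suitable choice of \<open>l\<close> the two estimates for
  \<open>x - \<xi> y\<close> bound \<open>y\<close> (\<open>gap_argument\<close>), and then \<open>x\<close>. All constants are explicit functions of a bound for the degrees and
  coefficients of \<open>P\<close>, built from sums, products and powers (\<open>explicit_bound\<close>); such functions are recursive, and the code of
  \<open>P\<close> is itself a bound of this kind.
\<close>

unbundle no vec_syntax

section \<open>Formal power series: change of coefficients and a cubic fixed-point equation\<close>

text \<open>
  The identities for cubics are proved once over an arbitrary domain and moved between polynomials,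
  power series, Laurent series and numbers along ring homomorphisms.
\<close>

locale ring_map =
  fixes h :: "'a :: comm_ring_1 \<Rightarrow> 'b :: comm_ring_1"
  assumes add: "h (x + y) = h x + h y"
    and mult: "h (x * y) = h x * h y"
    and one: "h 1 = 1"
begin

lemma zero: "h 0 = 0"
  using add[of 0 0] by simp

lemma uminus: "h (- x) = - h x"
  using add[of x "- x"] zero by (simp add: add_eq_0_iff)

lemma diff: "h (x - y) = h x - h y"
  using add[of x "- y"] uminus[of y] by simp

lemma sum: "h (sum f A) = (\<Sum>x\<in>A. h (f x))"
  by (induction A rule: infinite_finite_induct) (simp_all add: zero add)

lemma power: "h (x ^ n) = h x ^ n"
  by (induction n) (simp_all add: one mult)

lemma of_nat: "h (of_nat n) = of_nat n"
  by (induction n) (simp_all add: zero one add)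

lemma numeral: "h (numeral n) = numeral n"
  using of_nat[of "numeral n"] by simp

lemma of_int: "h (of_int n) = of_int n"
  by (cases n) (simp_all add: of_nat uminus diff one)

lemmas hom = zero one add mult uminus diff power of_nat numeral of_int

end

definition map_fps :: "('a :: comm_ring_1 \<Rightarrow> 'b :: comm_ring_1) \<Rightarrow> 'a fps \<Rightarrow> 'b fps" where
  "map_fps h F = Abs_fps (\<lambda>n. h (F $ n))"

lemma map_fps_nth [simp]: "map_fps h F $ n = h (F $ n)"
  by (simp add: map_fps_def)

lemma ring_map_map_fps:
  assumes "ring_map h"
  shows "ring_map (map_fps h)"
proof -
  interpret ring_map h by fact
  show ?thesis
    by unfold_locales
      (auto intro!: fps_ext simp: add mult one zero sum fps_mult_nth)
qed

lemma map_fps_X: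
  assumes "ring_map h"
  shows "map_fps h fps_X = fps_X"
proof -
  interpret ring_map h by fact
  show ?thesis by (auto intro!: fps_ext simp: zero one fps_X_def)
qed

lemma map_fps_const:
  assumes "ring_map h"
  shows "map_fps h (fps_const c) = fps_const (h c)"
proof -
  interpret ring_map h by fact
  show ?thesis by (auto intro!: fps_ext simp: zero one)
qed

lemma map_fps_of_poly:
  assumes "ring_map h"
  shows "map_fps h (fps_of_poly p) = fps_of_poly (map_poly h p)"
proof -
  interpret ring_map h by fact
  show ?thesis by (auto intro!: fps_ext simp: zero coeff_map_poly)
qed

lemma ring_map_of_int: "ring_map (of_int :: int \<Rightarrow> 'a :: comm_ring_1)"
  by unfold_locales auto

lemma ring_map_of_rat: "ring_map (of_rat :: rat \<Rightarrow> 'a :: field_char_0)"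
  by unfold_locales (auto simp: of_rat_add of_rat_mult)

lemma ring_map_of_real: "ring_map (of_real :: real \<Rightarrow> 'a :: {comm_ring_1, real_algebra_1})"
  by unfold_locales auto

lemma ring_map_map_poly:
  assumes "ring_map h"
  shows "ring_map (map_poly h)"
proof -
  interpret ring_map h by fact
  show ?thesis
    by unfold_locales
      (auto intro!: poly_eqI simp: add mult one zero sum coeff_map_poly coeff_mult)
qed

lemma ring_map_poly: "ring_map (\<lambda>p. poly p (x :: 'a :: comm_ring_1))"
  by unfold_locales auto

lemma ring_map_fps_of_poly: "ring_map (fps_of_poly :: 'a :: comm_ring_1 poly \<Rightarrow> 'a fps)"
  by unfold_locales (auto simp: fps_of_poly_add fps_of_poly_mult)

lemma ring_map_compose: "ring_map g \<Longrightarrow> ring_map h \<Longrightarrow> ring_map (\<lambda>x. g (h x))"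
  unfolding ring_map_def by auto

lemma ring_map_eval: "ring_map (\<lambda>p. poly (map_poly of_int p) (x :: 'a :: comm_ring_1))"
  using ring_map_compose[OF ring_map_poly ring_map_map_poly[OF ring_map_of_int]] .

definition agree :: "nat \<Rightarrow> 'a :: comm_ring_1 fps \<Rightarrow> 'a fps \<Rightarrow> bool" where
  "agree n f g \<longleftrightarrow> (\<forall>i<n. f $ i = g $ i)"

lemma agree_add: "agree n f g \<Longrightarrow> agree n f' g' \<Longrightarrow> agree n (f + f') (g + g')"
  by (simp add: agree_def)

lemma agree_mult: "agree n f g \<Longrightarrow> agree n f' g' \<Longrightarrow> agree n (f * f') (g * g')"
  unfolding agree_def fps_mult_nth by (auto intro!: sum.cong)

lemma agree_refl: "agree n f f"
  by (simp add: agree_def)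

lemma agree_mult_Suc:
  assumes "agree n f g" "f $ 0 = 0" "g $ 0 = 0" "agree (Suc n) f' g'" "f' $ 0 = 0"
  shows "agree (Suc n) (f * f') (g * g')"
  unfolding agree_def
proof (intro allI impI)
  fix i assume i: "i < Suc n"
  have "f $ j * f' $ (i - j) = g $ j * g' $ (i - j)" if j: "j \<le> i" for j
  proof (cases "j < n")
    case True
    then show ?thesis using assms i j by (auto simp: agree_def)
  next
    case False
    then have "i - j = 0" using i j by simp
    moreover have "g' $ 0 = 0"
      using assms(4,5) by (simp add: agree_def)
    ultimately show ?thesis using assms by (simp add: agree_def)
  qed
  then show "(f * f') $ i = (g * g') $ i"
    unfolding fps_mult_nth by (intro sum.cong) auto
qed

lemma agree_mult_const:
  assumes "agree n f g" "b $ 0 = 0"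
  shows "agree (Suc n) (b * f) (b * g)"
  unfolding agree_def
proof (intro allI impI)
  fix i assume i: "i < Suc n"
  have "b $ j * f $ (i - j) = b $ j * g $ (i - j)" if j: "j \<le> i" for j
    using assms i j by (cases "j = 0") (auto simp: agree_def)
  then show "(b * f) $ i = (b * g) $ i"
    unfolding fps_mult_nth by (intro sum.cong) auto
qed

lemma agree_square:
  assumes "agree n f g" "f $ 0 = 0" "g $ 0 = 0"
  shows "agree (Suc n) (f * f) (g * g)"
  unfolding agree_def
proof (intro allI impI)
  fix i assume i: "i < Suc n"
  have "f $ j * f $ (i - j) = g $ j * g $ (i - j)" if j: "j \<le> i" for j
    using assms i j by (cases "j = 0"; cases "j = i") (auto simp: agree_def)
  then show "(f * f) $ i = (g * g) $ i"
    unfolding fps_mult_nth by (intro sum.cong) auto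
qed

text \<open>
  Only the coefficients of the argument below index \<open>n\<close> enter the \<open>n\<close>-th coefficient of the value,
  because \<open>b\<close> and the argument have no constant term. So the equation \<open>z = a + b z + c z\<^sup>2 + e z\<^sup>3\<close> is a
  recursion for the coefficients of \<open>z\<close>, and it can be solved over every commutative ring.
\<close>

lemma agree_cubic:
  assumes "agree n f g" "f $ 0 = 0" "g $ 0 = 0" "b $ 0 = 0"
  shows "agree (Suc n) (a + b * f + c * f ^ 2 + e * f ^ 3) (a + b * g + c * g ^ 2 + e * g ^ 3)"
proof -
  have 2: "agree (Suc n) (f * f) (g * g)"
    by (rule agree_square) fact+
  have 3: "agree (Suc n) (f * (f * f)) (g * (g * g))"
    by (rule agree_mult_Suc) (use assms 2 in auto)
  show ?thesis
    unfolding power2_eq_square power3_eq_cube mult.assoc[of f] mult.assoc[of g]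
    by (intro agree_add agree_refl agree_mult_const assms agree_mult 2 3)
qed

lemma cubic_fps_unique:
  assumes "b $ 0 = 0" "f $ 0 = 0" "g $ 0 = 0"
    and "f = a + b * f + c * f ^ 2 + e * f ^ 3"
    and "g = a + b * g + c * g ^ 2 + e * g ^ 3"
  shows "f = (g :: 'a :: comm_ring_1 fps)"
proof -
  have "agree n f g" for n
  proof (induction n)
    case (Suc n)
    from agree_cubic[OF this assms(2,3,1), of a c e] assms(4,5) show ?case by metis
  qed (simp add: agree_def)
  then show ?thesis
    by (intro fps_ext) (auto simp: agree_def)
qed

lemma cubic_fps_exists:
  fixes a b c e :: "'a :: comm_ring_1 fps"
  assumes "a $ 0 = 0" "b $ 0 = 0"
  shows "\<exists>z. z $ 0 = 0 \<and> z = a + b * z + c * z ^ 2 + e * z ^ 3"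
proof -
  define \<Phi> where "\<Phi> z = a + b * z + c * z ^ 2 + e * z ^ 3" for z
  define Z where "Z n = (\<Phi> ^^ n) 0" for n
  have ZS: "Z (Suc n) = \<Phi> (Z n)" for n by (simp add: Z_def)
  have Z0: "Z n $ 0 = 0" for n
  proof (induction n)
    case (Suc n)
    then show ?case using assms
      by (simp add: ZS) (simp add: \<Phi>_def power2_eq_square power3_eq_cube fps_mult_nth)
  qed (simp add: Z_def)
  have step: "agree (Suc n) (\<Phi> f) (\<Phi> g)" if "agree n f g" "f $ 0 = 0" "g $ 0 = 0" for n f g
    unfolding \<Phi>_def by (rule agree_cubic) (use that assms in auto)
  have *: "agree n (Z n) (Z (Suc n))" for n
  proof (induction n)
    case (Suc n)
    then show ?case using step[OF Suc Z0 Z0] by (simp add: ZS)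
  qed (simp add: agree_def)
  have **: "agree n (Z n) (Z (n + m))" for n m
  proof (induction m)
    case (Suc m)
    with *[of "n + m"] show ?case by (auto simp: agree_def)
  qed (simp add: agree_def)
  define z where "z = Abs_fps (\<lambda>n. Z (Suc n) $ n)"
  have z: "agree n z (Z n)" for n
    unfolding agree_def
  proof (intro allI impI)
    fix i assume "i < n"
    with **[of "Suc i" "n - Suc i"] show "z $ i = Z n $ i"
      by (auto simp: z_def agree_def)
  qed
  have z0: "z $ 0 = 0" by (simp add: z_def Z0)
  have "agree n z (\<Phi> z)" for n
    using z[of "Suc n"] step[OF z[of n] z0 Z0] by (auto simp: agree_def ZS)
  then have "z = \<Phi> z"
    by (intro fps_ext) (auto simp: agree_def)
  with z0 show ?thesis unfolding \<Phi>_def by blast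
qed

section \<open>Weighted sums of coefficients\<close>

text \<open>
  The weighted \<open>l\<^sup>1\<close>-norm of a power series is submultiplicative. Its partial sums have the same property
  and are finite for every series, so no convergence has to be known in advance.
\<close>

definition wsum :: "nat \<Rightarrow> real \<Rightarrow> 'a :: real_normed_field fps \<Rightarrow> real" where
  "wsum N r F = (\<Sum>i\<le>N. norm (F $ i) * r ^ i)"

lemma wsum_nonneg: "r \<ge> 0 \<Longrightarrow> wsum N r F \<ge> 0"
  by (auto simp: wsum_def intro!: sum_nonneg)

lemma wsum_add: "r \<ge> 0 \<Longrightarrow> wsum N r (F + G) \<le> wsum N r F + wsum N r G"
  unfolding wsum_def sum.distrib[symmetric]
  by (intro sum_mono) (simp add: distrib_right[symmetric] mult_right_mono norm_triangle_ineq)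

lemma wsum_uminus [simp]: "wsum N r (- F) = wsum N r F"
  by (simp add: wsum_def)

lemma wsum_diff: "r \<ge> 0 \<Longrightarrow> wsum N r (F - G) \<le> wsum N r F + wsum N r G"
  using wsum_add[of r N F "- G"] by simp

lemma wsum_mono_r: "0 \<le> r \<Longrightarrow> r \<le> r' \<Longrightarrow> wsum N r F \<le> wsum N r' F"
  unfolding wsum_def by (intro sum_mono mult_left_mono power_mono) auto

lemma wsum_coeff: "r > 0 \<Longrightarrow> norm (F $ n) \<le> wsum n r F / r ^ n"
proof -
  assume r: "r > 0"
  have "norm (F $ n) * r ^ n \<le> wsum n r F"
    unfolding wsum_def by (rule member_le_sum) (use r in auto)
  then show ?thesis using r by (simp add: field_simps)
qed

lemma wsum_mult:
  assumes r: "r \<ge> 0"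
  shows "wsum N r (F * G) \<le> wsum N r F * wsum N r G"
proof -
  have "wsum N r (F * G) \<le> (\<Sum>n\<le>N. \<Sum>i\<le>n. norm (F $ i) * r ^ i * (norm (G $ (n - i)) * r ^ (n - i)))"
    unfolding wsum_def
  proof (rule sum_mono)
    fix n assume "n \<in> {..N}"
    have "norm ((F * G) $ n) * r ^ n \<le> (\<Sum>i=0..n. norm (F $ i * G $ (n - i))) * r ^ n"
      unfolding fps_mult_nth by (intro mult_right_mono norm_sum) (use r in auto)
    also have "\<dots> = (\<Sum>i\<le>n. norm (F $ i) * r ^ i * (norm (G $ (n - i)) * r ^ (n - i)))"
      unfolding sum_distrib_right atLeast0AtMost
    proof (rule sum.cong)
      fix i assume "i \<in> {..n}"
      then have "r ^ n = r ^ i * r ^ (n - i)" by (simp add: power_add[symmetric])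
      then show "norm (F $ i * G $ (n - i)) * r ^ n
          = norm (F $ i) * r ^ i * (norm (G $ (n - i)) * r ^ (n - i))"
        by (simp add: norm_mult)
    qed simp
    finally show "norm ((F * G) $ n) * r ^ n \<le> \<dots>" .
  qed
  also have "\<dots> = (\<Sum>(i, j)\<in>{(i, j). i + j \<le> N}. norm (F $ i) * r ^ i * (norm (G $ j) * r ^ j))"
    by (rule sum.triangle_reindex_eq[symmetric])
  also have "\<dots> \<le> (\<Sum>(i, j)\<in>{..N} \<times> {..N}. norm (F $ i) * r ^ i * (norm (G $ j) * r ^ j))"
    by (rule sum_mono2) (use r in auto)
  also have "\<dots> = wsum N r F * wsum N r G"
    unfolding wsum_def sum_product by (simp add: sum.cartesian_product)
  finally show ?thesis .
qed

lemma wsum_power: "r \<ge> 0 \<Longrightarrow> wsum N r (F ^ n) \<le> wsum N r F ^ n"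
proof (induction n)
  case 0
  have "wsum N r (1 :: 'a fps) = (\<Sum>i\<le>N. if i = 0 then 1 else 0)"
    unfolding wsum_def by (intro sum.cong) auto
  then show ?case by simp
next
  case (Suc n)
  then show ?case
    using wsum_mult[of r N F "F ^ n"] mult_left_mono[OF Suc.IH wsum_nonneg[of r N F]] by simp
qed

lemma wsum_const: "wsum N r (fps_const c) = norm c"
proof -
  have "wsum N r (fps_const c) = (\<Sum>i\<le>N. if i = 0 then norm c else 0)"
    unfolding wsum_def by (intro sum.cong) auto
  then show ?thesis by simp
qed

lemma wsum_X:
  assumes "r \<ge> 0"
  shows "wsum N r (fps_X :: 'a :: real_normed_field fps) \<le> r"
proof -
  have "wsum N r (fps_X :: 'a fps) = (\<Sum>i\<le>N. if i = 1 then r else 0)"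
    unfolding wsum_def by (intro sum.cong) (auto simp: fps_X_def)
  then show ?thesis using assms by simp
qed

lemma wsum_agree: "agree (Suc N) F G \<Longrightarrow> wsum N r F = wsum N r G"
  unfolding wsum_def agree_def by (intro sum.cong) auto

text \<open>
  The recursion for the coefficients of \<open>z\<close> turns a self-map of the interval \<open>[0, s]\<close> into a
  bound for all weighted partial sums, hence into a geometric bound for the coefficients.
\<close>

lemma wsum_cubic:
  fixes a b c e z :: "'a :: real_normed_field fps"
  assumes "z $ 0 = 0" "b $ 0 = 0" and z: "z = a + b * z + c * z ^ 2 + e * z ^ 3"
    and r: "r \<ge> 0" and s: "s \<ge> 0"
    and A: "\<And>N. wsum N r a \<le> A" and B: "\<And>N. wsum N r b \<le> B"
    and C: "\<And>N. wsum N r c \<le> C" and E: "\<And>N. wsum N r e \<le> E"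
    and le: "A + B * s + C * s ^ 2 + E * s ^ 3 \<le> s"
  shows "wsum N r z \<le> s"
proof (induction N)
  case 0
  then show ?case using assms by (simp add: wsum_def)
next
  case (Suc N)
  define y where "y = fps_cutoff (Suc N) z"
  have y0: "y $ 0 = 0" using assms by (simp add: y_def)
  have zy: "agree (Suc N) z y" by (simp add: agree_def y_def)
  have "wsum (Suc N) r y = wsum N r y"
    by (simp add: wsum_def y_def)
  also have "\<dots> = wsum N r z"
    using wsum_agree[OF zy] by simp
  finally have ys: "wsum (Suc N) r y \<le> s" using Suc by simp
  have nn: "wsum (Suc N) r F \<ge> 0" for F :: "'a fps" by (rule wsum_nonneg) fact
  have "wsum (Suc N) r z = wsum (Suc N) r (a + b * y + c * y ^ 2 + e * y ^ 3)"
    using agree_cubic[OF zy assms(1) y0 assms(2), of a c e] z by (metis wsum_agree)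
  also have "\<dots> \<le> wsum (Suc N) r a + wsum (Suc N) r (b * y) + wsum (Suc N) r (c * y ^ 2)
       + wsum (Suc N) r (e * y ^ 3)"
    by (smt (verit) wsum_add r)
  also have "wsum (Suc N) r (b * y) \<le> B * s"
    by (rule order_trans[OF wsum_mult[OF r]]) (intro mult_mono B ys nn order_trans[OF nn B])
  also have "wsum (Suc N) r (c * y ^ 2) \<le> C * s ^ 2"
    by (rule order_trans[OF wsum_mult[OF r]])
       (intro mult_mono C order_trans[OF wsum_power[OF r]] power_mono ys nn order_trans[OF nn C])
  also have "wsum (Suc N) r (e * y ^ 3) \<le> E * s ^ 3"
    by (rule order_trans[OF wsum_mult[OF r]])
       (intro mult_mono E order_trans[OF wsum_power[OF r]] power_mono ys nn order_trans[OF nn E])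
  also have "wsum (Suc N) r a \<le> A" by (rule A)
  finally show ?case using le by simp
qed

section \<open>Denominators and size of an algebraic power series\<close>

definition int_fps :: "real fps \<Rightarrow> bool" where
  "int_fps F \<longleftrightarrow> (\<forall>n. F $ n \<in> \<int>)"

lemma int_fps_add: "int_fps F \<Longrightarrow> int_fps G \<Longrightarrow> int_fps (F + G)"
  and int_fps_diff: "int_fps F \<Longrightarrow> int_fps G \<Longrightarrow> int_fps (F - G)"
  and int_fps_uminus: "int_fps F \<Longrightarrow> int_fps (- F)"
  and int_fps_mult: "int_fps F \<Longrightarrow> int_fps G \<Longrightarrow> int_fps (F * G)"
  and int_fps_const: "c \<in> \<int> \<Longrightarrow> int_fps (fps_const c)"
  and int_fps_X_power: "int_fps (fps_X ^ n)"
  and int_fps_shift: "int_fps F \<Longrightarrow> int_fps (fps_shift n F)"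
  by (auto simp: int_fps_def fps_mult_nth fps_X_power_nth intro!: Ints_sum Ints_mult)

lemma int_fps_power: "int_fps F \<Longrightarrow> int_fps (F ^ n)"
  by (induction n) (auto intro: int_fps_mult simp: int_fps_const[of 1, simplified])

text \<open>
  The solution over \<open>\<int>\<close>, which exists as well, becomes the solution over \<open>\<real>\<close> by uniqueness.
\<close>

lemma cubic_fps_int:
  assumes "z $ 0 = 0" "b $ 0 = 0" "z = a + b * z + c * z ^ 2 + e * z ^ 3"
    and "int_fps a" "int_fps b" "int_fps c" "int_fps e"
  shows "int_fps z"
proof -
  have lift: "\<exists>F0 :: int fps. map_fps of_int F0 = F" if "int_fps F" for F
    using that by (intro exI[of _ "Abs_fps (\<lambda>n. \<lfloor>F $ n\<rfloor>)"])
      (auto intro!: fps_ext simp: int_fps_def elim!: Ints_cases)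
  from assms lift obtain a0 b0 c0 e0 :: "int fps" where *:
    "a = map_fps of_int a0" "b = map_fps of_int b0" "c = map_fps of_int c0" "e = map_fps of_int e0"
    by metis
  interpret ring_map "map_fps of_int :: int fps \<Rightarrow> real fps"
    by (rule ring_map_map_fps[OF ring_map_of_int])
  have a0: "a $ 0 = 0"
    using arg_cong[OF assms(3), of "\<lambda>f. f $ 0"] assms(1,2)
    by (simp add: fps_mult_nth power2_eq_square power3_eq_cube)
  obtain y :: "int fps" where y: "y $ 0 = 0" "y = a0 + b0 * y + c0 * y ^ 2 + e0 * y ^ 3"
    using cubic_fps_exists[of a0 b0 c0 e0] a0 assms(2) by (auto simp: *)
  have "map_fps of_int y = a + b * map_fps of_int y + c * map_fps of_int y ^ 2 + e * map_fps of_int y ^ 3"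
    by (subst y(2)) (simp only: * hom)
  then have "z = map_fps of_int y"
    by (intro cubic_fps_unique[OF assms(2,1) _ assms(3)]) (simp_all add: y(1))
  then show ?thesis by (simp add: int_fps_def)
qed

lemma monic_cubic_rat_root_int:
  fixes y :: real
  assumes "y ^ 3 + a * y ^ 2 + b * y + c = 0" "a \<in> \<int>" "b \<in> \<int>" "c \<in> \<int>" "y \<in> \<rat>"
  shows "y \<in> \<int>"
proof -
  have "algebraic_int y"
  proof (rule algebraic_int.intros)
    show "lead_coeff [:c, b, a, 1:] = 1" by simp
    show "\<forall>i. coeff [:c, b, a, 1:] i \<in> \<int>"
      using assms by (auto simp: coeff_pCons split: nat.splits)
    show "poly [:c, b, a, 1:] y = 0"
      using assms(1) by (simp add: algebra_simps power2_eq_square power3_eq_cube)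
  qed
  with assms(5) show ?thesis by (simp add: rational_algebraic_int_is_int)
qed

text \<open>
  The highest nonzero coefficient clears the denominator of a rational root, because its product with the
  root is integral over \<open>\<int>\<close>.
\<close>

lemma cubic_rat_root_denominator:
  fixes x :: real
  assumes eq: "c0 + c1 * x + c2 * x ^ 2 + c3 * x ^ 3 = 0" and x: "x \<in> \<rat>"
    and ints: "c0 \<in> \<int>" "c1 \<in> \<int>" "c2 \<in> \<int>" "c3 \<in> \<int>"
    and nz: "\<not> (c0 = 0 \<and> c1 = 0 \<and> c2 = 0 \<and> c3 = 0)"
    and M: "\<bar>c0\<bar> \<le> M" "\<bar>c1\<bar> \<le> M" "\<bar>c2\<bar> \<le> M" "\<bar>c3\<bar> \<le> M"
  shows "\<exists>c\<in>\<int>. c \<noteq> 0 \<and> \<bar>c\<bar> \<le> M \<and> c * x \<in> \<int>"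
proof -
  have rat: "c * x \<in> \<rat>" if "c \<in> \<int>" for c
    using that x by (auto elim!: Ints_cases)
  consider "c3 \<noteq> 0" | "c3 = 0" "c2 \<noteq> 0" | "c3 = 0" "c2 = 0" "c1 \<noteq> 0"
    | "c3 = 0" "c2 = 0" "c1 = 0"
    by blast
  then show ?thesis
  proof cases
    case 1
    have "(c3 * x) ^ 3 + c2 * (c3 * x) ^ 2 + (c1 * c3) * (c3 * x) + c0 * c3 ^ 2
        = c3 ^ 2 * (c0 + c1 * x + c2 * x ^ 2 + c3 * x ^ 3)"
      by (simp add: algebra_simps power2_eq_square power3_eq_cube)
    also have "\<dots> = 0" using eq by simp
    finally have "c3 * x \<in> \<int>"
      by (rule monic_cubic_rat_root_int) (intro ints rat Ints_mult Ints_power)+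
    with 1 M(4) ints(4) show ?thesis by blast
  next
    case 2
    have "(c2 * x) ^ 3 + c1 * (c2 * x) ^ 2 + (c0 * c2) * (c2 * x) + 0
        = c2 ^ 2 * x * (c0 + c1 * x + c2 * x ^ 2)"
      by (simp add: algebra_simps power2_eq_square power3_eq_cube)
    also have "\<dots> = 0" using eq 2 by simp
    finally have "c2 * x \<in> \<int>"
      by (rule monic_cubic_rat_root_int) (intro ints rat Ints_mult Ints_power Ints_0)+
    with 2 M(3) ints(3) show ?thesis by blast
  next
    case 3
    then have "c1 * x = - c0" using eq by simp
    then have "c1 * x \<in> \<int>" using ints by simp
    with 3 M(2) ints(2) show ?thesis by blast
  next
    case 4
    then show ?thesis using eq nz by simp
  qed
qed

text \<open>
  The inverse of a root satisfies the reversed equation. Its denominator is therefore cleared by some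
  \<open>c\<close> with \<open>|c| \<le> M\<close>, and \<open>c / x\<close> is a nonzero integer.
\<close>

lemma cubic_rat_root_bound:
  fixes x :: real
  assumes eq: "c0 + c1 * x + c2 * x ^ 2 + c3 * x ^ 3 = 0" and x: "x \<in> \<rat>"
    and ints: "c0 \<in> \<int>" "c1 \<in> \<int>" "c2 \<in> \<int>" "c3 \<in> \<int>"
    and nz: "\<not> (c0 = 0 \<and> c1 = 0 \<and> c2 = 0 \<and> c3 = 0)"
    and M: "\<bar>c0\<bar> \<le> M" "\<bar>c1\<bar> \<le> M" "\<bar>c2\<bar> \<le> M" "\<bar>c3\<bar> \<le> M"
  shows "\<bar>x\<bar> \<le> M"
proof (cases "x = 0")
  case True
  then show ?thesis using M by auto
next
  case False
  define w where "w = 1 / x"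
  have xw: "x * w = 1" using False by (simp add: w_def)
  have "c3 + c2 * w + c1 * w ^ 2 + c0 * w ^ 3
      = c3 * (x * w) ^ 3 + c2 * (x * w) ^ 2 * w + c1 * (x * w) * w ^ 2 + c0 * w ^ 3"
    by (simp add: xw)
  also have "\<dots> = w ^ 3 * (c0 + c1 * x + c2 * x ^ 2 + c3 * x ^ 3)"
    by (simp add: algebra_simps power2_eq_square power3_eq_cube)
  finally have "c3 + c2 * w + c1 * w ^ 2 + c0 * w ^ 3 = 0" using eq by simp
  moreover have "w \<in> \<rat>" using x by (simp add: w_def)
  ultimately obtain c where c: "c \<in> \<int>" "c \<noteq> 0" "\<bar>c\<bar> \<le> M" "c * w \<in> \<int>"
    using cubic_rat_root_denominator[of c3 c2 w c1 c0 M] ints nz M by blast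
  have "\<bar>c * w\<bar> \<ge> 1"
    using c False by (intro Ints_nonzero_abs_ge1) (auto simp: w_def)
  then have "\<bar>x\<bar> \<le> \<bar>c\<bar>" using False by (simp add: w_def abs_mult pos_le_divide_eq)
  with c show ?thesis by simp
qed

lemma coeff_le_wsum: "\<bar>F $ n\<bar> \<le> wsum n 1 (F :: real fps)"
  using wsum_coeff[of 1 F n] by simp

lemma wsum_shift: "wsum N 1 (fps_shift f F) \<le> wsum (N + f) 1 F"
proof -
  have "wsum N 1 (fps_shift f F) = (\<Sum>i\<in>{f..N + f}. norm (F $ i))"
    unfolding wsum_def
    by (rule sum.reindex_bij_witness[of _ "\<lambda>i. i - f" "\<lambda>i. i + f"]) auto
  also have "\<dots> \<le> wsum (N + f) 1 F"
    unfolding wsum_def by (simp, rule sum_mono2) auto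
  finally show ?thesis .
qed

lemma wsum_cutoff_le:
  assumes "\<And>i. i < j \<Longrightarrow> norm (F $ i) \<le> Q" "Q \<ge> 0"
  shows "wsum N 1 (fps_cutoff j F) \<le> real j * Q"
proof -
  have "wsum N 1 (fps_cutoff j F) = (\<Sum>i\<in>{..N} \<inter> {..<j}. norm (F $ i))"
    unfolding wsum_def by (intro sum.mono_neutral_cong_right) auto
  also have "\<dots> \<le> (\<Sum>i\<in>{..N} \<inter> {..<j}. Q)"
    using assms by (intro sum_mono) auto
  also have "\<dots> = real (card ({..N} \<inter> {..<j})) * Q" by simp
  also have "\<dots> \<le> real j * Q"
    using card_mono[of "{..<j}" "{..N} \<inter> {..<j}"] assms(2)
    by (intro mult_right_mono) auto
  finally show ?thesis .
qed

lemma wsum_X_power: "wsum N 1 (fps_X ^ n :: 'a :: real_normed_field fps) \<le> 1"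
  using order_trans[OF wsum_power[of 1 N "fps_X :: 'a fps" n]
      power_le_one[OF wsum_nonneg[of 1 N "fps_X :: 'a fps"] wsum_X[of 1 N]]] by simp

lemma wsum_zero_const:
  assumes "F $ 0 = 0" "0 \<le> r" "r \<le> 1"
  shows "wsum N r F \<le> r * wsum N 1 F"
  unfolding wsum_def sum_distrib_left
proof (rule sum_mono)
  fix i
  have "r ^ i \<le> r" if "i \<noteq> 0"
    using that assms power_decreasing[of 1 i r] by simp
  then have "norm (F $ i) * r ^ i \<le> norm (F $ i) * r"
    using assms(1) by (cases "i = 0") (auto intro: mult_left_mono)
  then show "norm (F $ i) * r ^ i \<le> r * (norm (F $ i) * 1 ^ i)"
    by (simp add: mult.commute)
qed

lemma wsum_const_mult: "wsum N r (fps_const c * F) = norm c * wsum N r F"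
  by (simp add: wsum_def sum_distrib_left norm_mult mult.assoc)

lemma shifted_mult_nth:
  assumes "\<And>i. i < r \<Longrightarrow> (b :: real fps) $ i = 0"
  shows "(b * z) $ r = b $ r * z $ 0"
proof -
  have "(b * z) $ r = (\<Sum>i\<in>{r}. b $ i * z $ (r - i))"
    unfolding fps_mult_nth using assms by (intro sum.mono_neutral_right) auto
  then show ?thesis by simp
qed

locale depressed_root =
  fixes f2 f3 \<eta> :: "real fps" and X0 :: nat
  assumes root: "\<eta> ^ 3 + f2 * \<eta> + f3 = 0"
    and rat: "\<And>n. \<eta> $ n \<in> \<rat>"
    and int: "int_fps f2" "int_fps f3"
    and size: "\<And>N. wsum N 1 f2 \<le> X0" "\<And>N. wsum N 1 f3 \<le> X0"
    and X0: "X0 \<ge> 4"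
begin

text \<open>
  Exponents of \<open>Q\<close> are generous throughout: a factor \<open>4\<close>, the number \<open>j\<close> of terms and the size \<open>X0\<close> of the
  coefficients each cost one factor \<open>Q\<close>.
\<close>

lemma cutoff_size:
  assumes "\<And>i. i < j \<Longrightarrow> \<bar>\<eta> $ i\<bar> \<le> Q" and j: "real j \<le> Q" and Q: "real X0 \<le> Q"
  defines "Y \<equiv> fps_cutoff j \<eta>"
  shows "wsum N 1 Y \<le> Q ^ 2" "wsum N 1 (Y ^ 3 + f2 * Y + f3) \<le> Q ^ 7"
    "wsum N 1 (3 * Y ^ 2 + f2) \<le> Q ^ 5" "wsum N 1 (3 * Y) \<le> Q ^ 3"
proof -
  have X4: "Q \<ge> 4" using Q X0 by linarith
  have n1: "wsum N 1 F \<ge> 0" for F :: "real fps" by (rule wsum_nonneg) simp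
  have "wsum N 1 Y \<le> real j * Q"
    unfolding Y_def by (rule wsum_cutoff_le) (use assms X4 in auto)
  also have "\<dots> \<le> Q * Q" using j X4 by (intro mult_right_mono) auto
  finally show Y: "wsum N 1 Y \<le> Q ^ 2" by (simp add: power2_eq_square)
  have f: "wsum N 1 f2 \<le> Q" "wsum N 1 f3 \<le> Q" using size Q by (meson order_trans)+
  have p: "Q ^ a \<le> Q ^ b" if "a \<le> b" for a b :: nat
    using that X4 by (intro power_increasing) auto
  have Y3: "wsum N 1 (Y ^ 3) \<le> Q ^ 6"
    using order_trans[OF wsum_power[of 1 N Y 3] power_mono[OF Y n1, of 3]]
    by (simp add: power_mult[symmetric])
  have Y2: "wsum N 1 (Y ^ 2) \<le> Q ^ 4"
    using order_trans[OF wsum_power[of 1 N Y 2] power_mono[OF Y n1, of 2]]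
    by (simp add: power_mult[symmetric])
  have fY: "wsum N 1 (f2 * Y) \<le> Q * Q ^ 2"
    by (rule order_trans[OF wsum_mult mult_mono[OF f(1) Y]]) (use X4 n1 in auto)
  have "wsum N 1 (Y ^ 3 + f2 * Y + f3) \<le> wsum N 1 (Y ^ 3) + wsum N 1 (f2 * Y) + wsum N 1 f3"
    by (smt (verit) wsum_add)
  also have "\<dots> \<le> Q ^ 6 + Q * Q ^ 2 + Q" using Y3 fY f by linarith
  also have "Q * Q ^ 2 = Q ^ 3" by (simp add: power_numeral_reduce)
  also have "Q ^ 6 + Q ^ 3 + Q \<le> 4 * Q ^ 6"
    using p[of 3 6, simplified] p[of 1 6, simplified] X4 by linarith
  also have "\<dots> \<le> Q * Q ^ 6" using X4 by (intro mult_right_mono) auto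
  finally show "wsum N 1 (Y ^ 3 + f2 * Y + f3) \<le> Q ^ 7" by (simp add: power_numeral_reduce)
  have 3: "wsum N 1 (3 * F) = 3 * wsum N 1 F" for F :: "real fps"
    using wsum_const_mult[of N 1 3 F] by (simp add: numeral_fps_const)
  have "wsum N 1 (3 * Y ^ 2 + f2) \<le> 3 * wsum N 1 (Y ^ 2) + wsum N 1 f2"
    using wsum_add[of 1 N "3 * Y ^ 2" f2] by (simp add: 3)
  also have "\<dots> \<le> 4 * Q ^ 4" using Y2 f p[of 1 4] by simp
  also have "\<dots> \<le> Q * Q ^ 4" using X4 by (intro mult_right_mono) auto
  finally show "wsum N 1 (3 * Y ^ 2 + f2) \<le> Q ^ 5" by (simp add: power_numeral_reduce)
  have "wsum N 1 (3 * Y) \<le> 3 * Q ^ 2" using Y by (simp add: 3)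
  also have "\<dots> \<le> Q * Q ^ 2" using X4 by (intro mult_right_mono) auto
  finally show "wsum N 1 (3 * Y) \<le> Q ^ 3" by (simp add: power_numeral_reduce)
qed

lemma cutoff_int:
  assumes "\<And>i. i < j \<Longrightarrow> real L * \<eta> $ i \<in> \<int>"
  defines "Y \<equiv> fps_cutoff j \<eta>"
  shows "int_fps (fps_const (real L ^ 3) * (Y ^ 3 + f2 * Y + f3))"
    "int_fps (fps_const (real L ^ 3) * (3 * Y ^ 2 + f2))" "int_fps (fps_const (real L ^ 3) * (3 * Y))"
proof -
  define K where "K = fps_const (real L)"
  have K: "int_fps K" by (simp add: K_def int_fps_const)
  have KY: "int_fps (K * Y)"
    using assms by (auto simp: int_fps_def K_def)
  have K3: "fps_const (real L ^ 3) = K ^ 3"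
    by (simp add: K_def fps_const_power)
  have three: "int_fps 3" using int_fps_const[of 3] by (simp add: numeral_fps_const)
  have "K ^ 3 * (Y ^ 3 + f2 * Y + f3) = (K * Y) ^ 3 + K ^ 2 * f2 * (K * Y) + K ^ 3 * f3"
    by (simp add: algebra_simps power2_eq_square power3_eq_cube)
  then show "int_fps (fps_const (real L ^ 3) * (Y ^ 3 + f2 * Y + f3))"
    unfolding K3 by (simp only:) (intro int_fps_add int_fps_mult int_fps_power K KY int)
  have "K ^ 3 * (3 * Y ^ 2 + f2) = 3 * K * (K * Y) ^ 2 + K ^ 3 * f2"
    by (simp add: algebra_simps power2_eq_square power3_eq_cube)
  then show "int_fps (fps_const (real L ^ 3) * (3 * Y ^ 2 + f2))"
    unfolding K3 by (simp only:) (intro int_fps_add int_fps_mult int_fps_power K KY int three)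
  have "K ^ 3 * (3 * Y) = 3 * K ^ 2 * (K * Y)"
    by (simp add: algebra_simps power2_eq_square power3_eq_cube)
  then show "int_fps (fps_const (real L ^ 3) * (3 * Y))"
    unfolding K3 by (simp only:) (intro int_fps_mult int_fps_power K KY three)
qed

text \<open>
  After the substitution \<open>\<eta> = Y + u\<^sup>j z\<close> the lowest order terms of the equation give a nonzero
  cubic polynomial with the root \<open>z(0) = \<eta>\<^sub>j\<close>; the size of its coefficients is controlled by the
  earlier coefficients of \<open>\<eta>\<close>, so the bounds can be propagated from each index to the next.
\<close>

lemma initial_coefficients:
  assumes "j \<le> X0"
  shows "\<exists>L::nat. 1 \<le> L \<and> L \<le> X0 ^ (12 ^ j) \<and>
    (\<forall>i<j. real L * \<eta> $ i \<in> \<int> \<and> \<bar>\<eta> $ i\<bar> \<le> real (X0 ^ (12 ^ j)))"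
  using assms
proof (induction j)
  case 0
  then show ?case using X0 by (intro exI[of _ 1]) auto
next
  case (Suc j)
  define Q where "Q = real (X0 ^ (12 ^ j))"
  from Suc obtain L :: nat where L: "1 \<le> L" "L \<le> X0 ^ (12 ^ j)"
    "\<And>i. i < j \<Longrightarrow> real L * \<eta> $ i \<in> \<int>" "\<And>i. i < j \<Longrightarrow> \<bar>\<eta> $ i\<bar> \<le> Q"
    by (auto simp: Q_def)
  have "X0 ^ 1 \<le> X0 ^ (12 ^ j)" using X0 by (intro power_increasing) auto
  then have Q: "Q \<ge> X0" unfolding Q_def by (simp only: of_nat_le_iff power_one_right)
  with X0 have Q4: "Q \<ge> 4" by linarith
  note Q = Q Q4
  have jX: "real j \<le> Q" using Suc.prems Q by simp
  define Y where "Y = fps_cutoff j \<eta>"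
  define z where "z = fps_shift j \<eta>"
  have \<eta>: "\<eta> = Y + fps_X ^ j * z"
    unfolding Y_def z_def by (rule fps_ext) (simp add: fps_X_power_mult_nth)
  define a b c e where "a = Y ^ 3 + f2 * Y + f3" "b = fps_X ^ j * (3 * Y ^ 2 + f2)"
    "c = fps_X ^ (2 * j) * (3 * Y)" "e = (fps_X ^ (3 * j) :: real fps)"
  note defs = this
  have eq: "a + b * z + c * z ^ 2 + e * z ^ 3 = 0"
    using root unfolding \<eta> defs power_mult[of fps_X j, simplified mult.commute[of j]]
    by (simp add: algebra_simps power2_eq_square power3_eq_cube)
  \<comment> \<open>At the lowest index \<open>r\<close> at which one of the four series is nonzero, only the constant term of \<open>z\<close> enters.\<close>
  define NZ where "NZ r \<longleftrightarrow> \<not> (a $ r = 0 \<and> b $ r = 0 \<and> c $ r = 0 \<and> e $ r = 0)" for r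
  have "NZ (3 * j)" by (simp add: NZ_def defs)
  then obtain r where r: "NZ r" "\<And>i. i < r \<Longrightarrow> \<not> NZ i"
    by (metis LeastI not_less_Least)
  have "(a + b * z + c * z ^ 2 + e * z ^ 3) $ r = a $ r + b $ r * z $ 0 + c $ r * (z $ 0) ^ 2 + e $ r * (z $ 0) ^ 3"
    using r(2) by (simp add: shifted_mult_nth NZ_def fps_nth_power_0)
  moreover have "z $ 0 = \<eta> $ j" by (simp add: z_def)
  ultimately have "a $ r + b $ r * \<eta> $ j + c $ r * (\<eta> $ j) ^ 2 + e $ r * (\<eta> $ j) ^ 3 = 0"
    unfolding eq by simp
  moreover define K where "K = fps_const (real L ^ 3)"
  have K: "(K * F) $ r = real L ^ 3 * F $ r" for F by (simp add: K_def)
  ultimately have cubic: "(K * a) $ r + (K * b) $ r * \<eta> $ j + (K * c) $ r * (\<eta> $ j) ^ 2 + (K * e) $ r * (\<eta> $ j) ^ 3 = 0"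
    unfolding K mult.assoc distrib_left[symmetric] by simp
  have "K * b = fps_X ^ j * (K * (3 * Y ^ 2 + f2))" "K * c = fps_X ^ (2 * j) * (K * (3 * Y))"
    by (simp_all add: defs)
  then have ints: "int_fps (K * a)" "int_fps (K * b)" "int_fps (K * c)" "int_fps (K * e)"
    using cutoff_int[of j L, OF L(3), folded K_def Y_def]
    by (simp_all only: defs int_fps_mult int_fps_X_power)
      (simp add: K_def int_fps_mult int_fps_X_power int_fps_const del: fps_const_power)
  have LQ: "real L \<le> Q" using L(2) unfolding Q_def by (simp only: of_nat_le_iff)
  have L3: "real L ^ 3 \<le> Q ^ 3" using LQ by (intro power_mono) simp_all
  have p: "Q ^ a \<le> Q ^ b" if "a \<le> b" for a b :: nat
    using that Q by (intro power_increasing) auto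
  note sz = cutoff_size[OF L(4) jX Q(1), folded Y_def]
  have w1: "wsum N 1 (fps_X ^ n * F) \<le> wsum N 1 F" for N n and F :: "real fps"
    using order_trans[OF wsum_mult[of 1 N "fps_X ^ n" F]
        mult_right_mono[OF wsum_X_power wsum_nonneg[of 1 N F]]] by simp
  have bd: "\<bar>(K * F) $ r\<bar> \<le> Q ^ 10" if "wsum r 1 F \<le> Q ^ 7" for F
  proof -
    have "\<bar>(K * F) $ r\<bar> = real L ^ 3 * \<bar>F $ r\<bar>" unfolding K by (simp add: abs_mult)
    also have "\<dots> \<le> Q ^ 3 * Q ^ 7"
      using order_trans[OF coeff_le_wsum that] L3 Q by (intro mult_mono) auto
    finally show ?thesis by (simp add: power_add[symmetric])
  qed
  have "wsum r 1 b \<le> Q ^ 7" "wsum r 1 c \<le> Q ^ 7" "wsum r 1 e \<le> Q ^ 7"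
    unfolding defs
    using order_trans[OF w1 order_trans[OF sz(3) p]] order_trans[OF w1 order_trans[OF sz(4) p]]
      order_trans[OF wsum_X_power p[of 0 7, simplified power_0]] by simp_all
  then have bds: "\<bar>(K * a) $ r\<bar> \<le> Q ^ 10" "\<bar>(K * b) $ r\<bar> \<le> Q ^ 10"
    "\<bar>(K * c) $ r\<bar> \<le> Q ^ 10" "\<bar>(K * e) $ r\<bar> \<le> Q ^ 10"
    using sz(2)[of r] unfolding defs(1)[symmetric] by (simp_all only: bd)
  have nz: "\<not> ((K * a) $ r = 0 \<and> (K * b) $ r = 0 \<and> (K * c) $ r = 0 \<and> (K * e) $ r = 0)"
    using r(1) L(1) unfolding K NZ_def by auto
  note I = ints[unfolded int_fps_def, rule_format, of r]
  obtain d where d: "d \<in> \<int>" "d \<noteq> 0" "\<bar>d\<bar> \<le> Q ^ 10" "d * \<eta> $ j \<in> \<int>"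
    using cubic_rat_root_denominator[OF cubic rat I nz bds] by blast
  have \<eta>j: "\<bar>\<eta> $ j\<bar> \<le> Q ^ 10"
    by (rule cubic_rat_root_bound[OF cubic rat I nz bds])
  obtain k :: int where k: "d = of_int k" using d(1) by (auto elim: Ints_cases)
  \<comment> \<open>One step costs at most \<open>Q\<^sup>1\<^sup>1\<close>, whence the exponents \<open>12 ^ j\<close> of \<open>X0\<close>.\<close>
  define M where "M = L * nat \<bar>k\<bar>"
  have M: "real M = real L * \<bar>d\<bar>" by (simp only: M_def k of_nat_mult) simp
  have Q12: "real (X0 ^ (12 ^ Suc j)) = Q ^ 12"
    unfolding Q_def power_Suc2[of 12 j] power_mult[of X0 "12 ^ j" 12] of_nat_power[of _ 12] ..
  have "real M \<le> Q * Q ^ 10"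
    unfolding M using LQ d(3) Q by (intro mult_mono) simp_all
  also have "\<dots> \<le> Q ^ 12" using p[of 11 12] by (simp add: power_numeral_reduce)
  finally have M12: "real M \<le> real (X0 ^ (12 ^ Suc j))" unfolding Q12 .
  have "real M * \<eta> $ i \<in> \<int> \<and> \<bar>\<eta> $ i\<bar> \<le> real (X0 ^ (12 ^ Suc j))" if "i < Suc j" for i
  proof (cases "i = j")
    case True
    have "\<bar>d\<bar> * \<eta> $ j \<in> \<int>" using d(4) by (auto simp: abs_if)
    then have "real L * (\<bar>d\<bar> * \<eta> $ j) \<in> \<int>" by (rule Ints_mult[OF Ints_of_nat])
    then show ?thesis using \<eta>j p[of 10 12] True unfolding Q12 M by (auto simp: mult.assoc)
  next
    case False
    then have i: "i < j" using that by simp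
    have "\<bar>d\<bar> * (real L * \<eta> $ i) \<in> \<int>"
      using d(1) L(3)[OF i] by (auto simp: abs_if intro: Ints_mult)
    then show ?thesis using L(4)[OF i] p[of 1 12] unfolding Q12 M by (auto simp: mult_ac)
  qed
  moreover have "1 \<le> M" using L(1) d(2) by (simp add: M_def k)
  ultimately show ?case using M12 unfolding of_nat_le_iff by blast
qed

text \<open>
  Beyond the order \<open>f\<close> of the derivative \<open>3\<eta>\<^sup>2 + f\<^sub>2\<close> the coefficients are determined by Hensel's
  recursion, in which the only division is by the leading coefficient \<open>\<beta>\<close> of the derivative. The
  substitution \<open>u \<mapsto> \<beta>\<^sup>2 u\<close> removes these divisions. This is Eisenstein's theorem, with constants
  that depend only on \<open>X0\<close>.
\<close>

theorem eisenstein: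
  assumes m: "3 * \<eta> ^ 2 + f2 \<noteq> 0" and f: "subdegree (3 * \<eta> ^ 2 + f2) < X0"
  defines "E \<equiv> (X0 ^ (12 ^ X0)) ^ 30"
  shows "\<exists>D::nat. 1 \<le> D \<and> D \<le> E \<and>
    (\<forall>i. real D ^ (i + 1) * \<eta> $ i \<in> \<int> \<and> \<bar>\<eta> $ i\<bar> \<le> real E ^ (i + 1))"
proof -
  define f where "f = subdegree (3 * \<eta> ^ 2 + f2)"
  have f: "Suc f \<le> X0" using f by (simp add: f_def)
  define Q where "Q = real (X0 ^ (12 ^ X0))"
  have E: "real E = Q ^ 30" by (simp add: E_def Q_def)
  have "X0 ^ (12 ^ Suc f) \<le> X0 ^ (12 ^ X0)"
    using X0 f by (intro power_increasing) auto
  then have Qf: "real (X0 ^ (12 ^ Suc f)) \<le> Q"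
    unfolding Q_def of_nat_le_iff .
  from initial_coefficients[OF f] obtain L :: nat where L: "1 \<le> L" "L \<le> X0 ^ (12 ^ Suc f)"
    "\<And>i. i < Suc f \<Longrightarrow> real L * \<eta> $ i \<in> \<int>"
    "\<And>i. i < Suc f \<Longrightarrow> \<bar>\<eta> $ i\<bar> \<le> real (X0 ^ (12 ^ Suc f))"
    by blast
  have L4: "\<bar>\<eta> $ i\<bar> \<le> Q" if "i < Suc f" for i
    using L(4)[OF that] Qf by linarith
  have LQ: "real L \<le> Q"
    using L(2) Qf unfolding of_nat_le_iff[where ?'a = real, symmetric] by (rule order_trans)
  have "X0 ^ 1 \<le> X0 ^ (12 ^ X0)" using X0 by (intro power_increasing) auto
  then have QX: "Q \<ge> X0" unfolding Q_def by (simp only: of_nat_le_iff power_one_right)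
  with X0 have Q4: "Q \<ge> 4" by linarith
  have fQ: "real (Suc f) \<le> Q" using f QX by linarith
  have p: "Q ^ a \<le> Q ^ b" if "a \<le> b" for a b :: nat
    using that Q4 by (intro power_increasing) auto
  define Y where "Y = fps_cutoff (Suc f) \<eta>"
  define z where "z = fps_shift f (\<eta> - Y)"
  have Yn: "(\<eta> - Y) $ i = 0" if "i \<le> f" for i using that by (simp add: Y_def)
  have \<eta>: "\<eta> = Y + fps_X ^ f * z"
    using Yn by (intro fps_ext) (simp add: z_def fps_X_power_mult_nth)
  have z0: "z $ 0 = 0" using Yn[of f] by (simp add: z_def)
  define K where "K = fps_const (real L ^ 3)"
  define m where "m = 3 * Y ^ 2 + f2"
  define b where "b = fps_shift f m"
  define g where "g = Y ^ 3 + f2 * Y + f3"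
  define G where "G = fps_shift (2 * f) g"
  have agr: "agree (Suc f) (3 * \<eta> ^ 2 + f2) m"
    unfolding m_def power2_eq_square
    by (intro agree_add agree_mult agree_refl) (simp_all add: agree_def Y_def)
  define m\<eta> where "m\<eta> = 3 * \<eta> ^ 2 + f2"
  have agr: "m\<eta> $ i = m $ i" if "i \<le> f" for i
    using agr[unfolded agree_def, rule_format, of i] that by (simp only: m\<eta>_def less_Suc_eq_le)
  have fm: "f = subdegree m\<eta>" by (simp only: f_def m\<eta>_def)
  have msub: "m $ i = 0" if "i < f" for i
    using agr[OF less_imp_le[OF that]] nth_less_subdegree_zero[OF that[unfolded fm]] by metis
  have mf: "m $ f \<noteq> 0"
    using agr[OF order_refl] nth_subdegree_nonzero[OF m, folded m\<eta>_def, folded fm] by metis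
  have mb: "m = fps_X ^ f * b"
    using msub by (intro fps_ext) (simp add: b_def fps_X_power_mult_nth)
  define w where "w = (fps_X ^ f :: real fps)"
  have "(Y + w * z) ^ 3 + f2 * (Y + w * z) + f3 = 0"
    using root \<eta> by (simp only: w_def)
  moreover have "3 * Y ^ 2 + f2 = w * b" using mb by (simp only: w_def m_def)
  moreover have "g = ((Y + w * z) ^ 3 + f2 * (Y + w * z) + f3) - (3 * Y ^ 2 + f2) * (w * z)
      - 3 * Y * (w * z) ^ 2 - (w * z) ^ 3"
    unfolding g_def by (simp add: algebra_simps power2_eq_square power3_eq_cube)
  ultimately have "g = - (w * b * (w * z)) - 3 * Y * (w * z) ^ 2 - (w * z) ^ 3"
    by simp
  also have "\<dots> = w * w * (- (b * z + 3 * Y * z ^ 2 + w * z ^ 3))"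
    by (simp add: algebra_simps power2_eq_square power3_eq_cube)
  finally have gg: "g = w * w * (- (b * z + 3 * Y * z ^ 2 + w * z ^ 3))" .
  have sh2: "fps_shift (2 * f) (fps_X ^ (2 * f) * F) = F" for F :: "real fps"
    by (rule fps_ext) (simp add: fps_X_power_mult_nth)
  have "w * w = fps_X ^ (2 * f)" by (simp add: w_def power_add[symmetric] mult_2)
  then have "G = - (b * z + 3 * Y * z ^ 2 + fps_X ^ f * z ^ 3)"
    unfolding G_def gg by (simp only: sh2) (simp only: w_def)
  then have eqG: "G + b * z + 3 * Y * z ^ 2 + fps_X ^ f * z ^ 3 = 0" by simp
  have G0: "G $ 0 = 0" using arg_cong[OF eqG, of "\<lambda>F. F $ 0"] z0
    by (simp add: power2_eq_square power3_eq_cube)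
  define a' b' c' e' where "a' = K * G" "b' = K * b" "c' = K * (3 * Y)" "e' = K * fps_X ^ f"
  note defs = this
  have eq: "a' + b' * z + c' * z ^ 2 + e' * z ^ 3 = 0"
  proof -
    have "a' + b' * z + c' * z ^ 2 + e' * z ^ 3 = K * (G + b * z + 3 * Y * z ^ 2 + fps_X ^ f * z ^ 3)"
      unfolding defs by (simp add: algebra_simps)
    then show ?thesis using eqG by simp
  qed
  note ci = cutoff_int[of "Suc f" L, OF L(3), folded K_def Y_def]
  have sh: "K * fps_shift n F = fps_shift n (K * F)" for n F
    by (rule fps_ext) (simp add: K_def)
  have ints: "int_fps a'" "int_fps b'" "int_fps c'" "int_fps e'"
    unfolding defs G_def b_def g_def m_def sh using ci
    by (auto intro!: int_fps_shift int_fps_mult int_fps_X_power simp: K_def int_fps_const)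
  have KQ: "wsum N 1 (K * F) \<le> Q ^ 3 * W" if "wsum N 1 F \<le> W" for F N W
  proof -
    have "wsum N 1 (K * F) = real L ^ 3 * wsum N 1 F" by (simp add: K_def wsum_const_mult)
    also have "\<dots> \<le> Q ^ 3 * W"
      using LQ that Q4 wsum_nonneg[of 1 N F] by (intro mult_mono power_mono) auto
    finally show ?thesis .
  qed
  note cs = cutoff_size[of "Suc f" Q, OF L4 fQ QX, folded Y_def]
  have Q37: "Q ^ 3 * Q ^ n \<le> Q ^ 10" if "n \<le> 7" for n
    unfolding power_add[symmetric] by (rule p) (use that in simp)
  have sizes: "wsum N 1 a' \<le> Q ^ 10" "wsum N 1 b' \<le> Q ^ 10" "wsum N 1 c' \<le> Q ^ 10"
    "wsum N 1 e' \<le> Q ^ 10" for N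
  proof -
    show "wsum N 1 a' \<le> Q ^ 10"
      unfolding defs G_def g_def
      by (rule order_trans[OF KQ[OF order_trans[OF wsum_shift cs(2)]] Q37[of 7]]) simp_all
    show "wsum N 1 b' \<le> Q ^ 10"
      unfolding defs b_def m_def
      by (rule order_trans[OF KQ[OF order_trans[OF wsum_shift cs(3)]] Q37[of 5]]) simp_all
    show "wsum N 1 c' \<le> Q ^ 10"
      unfolding defs by (rule order_trans[OF KQ[OF cs(4)] Q37[of 3]]) simp_all
    show "wsum N 1 e' \<le> Q ^ 10"
      unfolding defs by (rule order_trans[OF KQ[OF wsum_X_power[of N f]]]) (use Q37[of 0] in simp)
  qed
  define \<beta> where "\<beta> = b' $ 0"
  have \<beta>: "\<beta> \<in> \<int>" "\<beta> \<noteq> 0" "\<bar>\<beta>\<bar> \<le> Q ^ 10"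
    using ints(2)[unfolded int_fps_def] order_trans[OF coeff_le_wsum sizes(2), of 0] mf L(1)
    by (simp_all only: \<beta>_def) (simp add: defs b_def K_def)
  have \<beta>1: "\<bar>\<beta>\<bar> \<ge> 1" using \<beta> by (intro Ints_nonzero_abs_ge1)
  \<comment> \<open>The weight is \<open>r = s\<^sup>2\<close>: the constant and the linear coefficient have no term of order zero and contribute
    a factor \<open>r\<close> each, and the nonlinear terms contribute \<open>s\<^sup>2\<close>.\<close>
  define s where "s = 1 / (4 * Q ^ 10)"
  define r where "r = s * s"
  have Q10: "Q ^ 10 \<ge> 1" using p[of 0 10] by simp
  have s: "0 < s" "s \<le> 1 / 4" "Q ^ 10 * s = 1 / 4"
    using Q4 Q10 frac_le[of 1 1 4 "4 * Q ^ 10"] by (simp_all add: s_def)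
  have rs: "r \<le> 1" "0 < r" using s unfolding r_def by (auto intro!: mult_le_one)
  define i\<beta> where "i\<beta> = fps_const (1 / \<beta>)"
  have ib: "i\<beta> * fps_const \<beta> = 1" using \<beta> by (simp add: i\<beta>_def)
  have zfix: "z = - (i\<beta> * a') + (- (i\<beta> * (b' - fps_const \<beta>))) * z + (- (i\<beta> * c')) * z ^ 2 + (- (i\<beta> * e')) * z ^ 3"
  proof -
    have "- (i\<beta> * a') + (- (i\<beta> * (b' - fps_const \<beta>))) * z + (- (i\<beta> * c')) * z ^ 2 + (- (i\<beta> * e')) * z ^ 3
       = i\<beta> * fps_const \<beta> * z - i\<beta> * (a' + b' * z + c' * z ^ 2 + e' * z ^ 3)"
      by (simp add: algebra_simps)
    then show ?thesis using eq ib by simp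
  qed
  have wi: "wsum N r (- (i\<beta> * F)) \<le> wsum N r F" for N F
  proof -
    have "wsum N r (- (i\<beta> * F)) = 1 / \<bar>\<beta>\<bar> * wsum N r F"
      by (simp add: i\<beta>_def wsum_const_mult)
    also have "\<dots> \<le> 1 * wsum N r F"
      using \<beta>1 wsum_nonneg[of r N F] rs by (intro mult_right_mono) auto
    finally show ?thesis by simp
  qed
  have w1: "wsum N r F \<le> wsum N 1 F" for N and F :: "real fps"
    by (rule wsum_mono_r) (use rs in auto)
  have a0: "a' $ 0 = 0" using G0 by (simp add: defs K_def)
  have b0: "(b' - fps_const \<beta>) $ 0 = 0" by (simp add: \<beta>_def)
  have "wsum N 1 (b' - fps_const \<beta>) \<le> wsum N 1 b'" for N
    unfolding wsum_def by (intro sum_mono) (auto simp: \<beta>_def)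
  then have wb: "wsum N 1 (b' - fps_const \<beta>) \<le> Q ^ 10" for N
    using sizes(2)[of N] order_trans by blast
  have zs: "wsum N r z \<le> s" for N
  proof (rule wsum_cubic[OF z0 _ zfix])
    show "wsum N r (- (i\<beta> * a')) \<le> r * Q ^ 10" for N
      by (rule order_trans[OF wi order_trans[OF wsum_zero_const[OF a0]]])
         (use rs sizes in \<open>auto intro: mult_left_mono\<close>)
    show "wsum N r (- (i\<beta> * (b' - fps_const \<beta>))) \<le> r * Q ^ 10" for N
      by (rule order_trans[OF wi order_trans[OF wsum_zero_const[OF b0]]])
         (use rs wb in \<open>auto intro: mult_left_mono\<close>)
    show "wsum N r (- (i\<beta> * c')) \<le> Q ^ 10" for N
      by (rule order_trans[OF wi order_trans[OF w1 sizes(3)]])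
    show "wsum N r (- (i\<beta> * e')) \<le> Q ^ 10" for N
      by (rule order_trans[OF wi order_trans[OF w1 sizes(4)]])
    have "r * Q ^ 10 = s / 4" using s unfolding r_def by (simp add: mult.assoc mult.commute)
    moreover have "Q ^ 10 * s ^ 2 = s / 4" using s(3) by (simp add: power2_eq_square mult.assoc[symmetric])
    moreover have "Q ^ 10 * s ^ 3 = s * s / 4" using s(3) by (simp add: power3_eq_cube mult.assoc[symmetric])
    moreover have "s * s \<le> s * 1" using s by (intro mult_left_mono) auto
    moreover from \<open>r * Q ^ 10 = s / 4\<close> have "r * Q ^ 10 * s = s * s / 4" by simp
    ultimately show "r * Q ^ 10 + r * Q ^ 10 * s + Q ^ 10 * s ^ 2 + Q ^ 10 * s ^ 3 \<le> s"
      using s(1,2) by linarith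
  qed (use s rs b0 in \<open>auto simp: i\<beta>_def\<close>)
  have "1 / r = 16 * Q ^ 20" by (simp add: r_def s_def power_add[symmetric])
  also have "\<dots> \<le> Q ^ 2 * Q ^ 20" using power_mono[OF Q4, of 2] by (intro mult_right_mono) auto
  also have "\<dots> \<le> Q ^ 30" unfolding power_add[symmetric] by (rule p) simp
  finally have r30: "1 / r \<le> Q ^ 30" .
  have zb: "\<bar>z $ n\<bar> \<le> (Q ^ 30) ^ n" for n
  proof -
    have "\<bar>z $ n\<bar> \<le> wsum n r z / r ^ n" using wsum_coeff[of r z n] rs by simp
    also have "\<dots> \<le> 1 / r ^ n" using zs[of n] s rs by (intro divide_right_mono) auto
    also have "\<dots> = (1 / r) ^ n" by (simp add: power_divide)
    also have "\<dots> \<le> (Q ^ 30) ^ n" using r30 rs by (intro power_mono) auto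
    finally show ?thesis .
  qed
  \<comment> \<open>The series \<open>\<zeta>(u) = z(\<beta>\<^sup>2 u) / \<beta>\<close> satisfies an equation without denominators: each series that is
    divided by \<open>\<beta>\<close> has no constant term, so the substitution gives it a factor \<open>\<beta>\<^sup>2\<close>.\<close>
  define S :: "real fps \<Rightarrow> real fps" where "S F = Abs_fps (\<lambda>n. (\<beta> ^ 2) ^ n * F $ n)" for F
  have S_nth: "S F $ n = (\<beta> ^ 2) ^ n * F $ n" for F n by (simp add: S_def)
  interpret S: ring_map S
  proof
    show "S (F * F') = S F * S F'" for F F'
    proof (rule fps_ext)
      fix n
      have "(\<beta> ^ 2) ^ n * (F $ i * F' $ (n - i)) = (\<beta> ^ 2) ^ i * F $ i * ((\<beta> ^ 2) ^ (n - i) * F' $ (n - i))"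
        if "i \<le> n" for i
      proof -
        have "(\<beta> ^ 2) ^ n = (\<beta> ^ 2) ^ i * (\<beta> ^ 2) ^ (n - i)"
          unfolding power_add[symmetric] using that by simp
        then show ?thesis by (simp only: mult_ac)
      qed
      then show "S (F * F') $ n = (S F * S F') $ n"
        unfolding S_nth fps_mult_nth sum_distrib_left by (intro sum.cong) auto
    qed
  qed (auto intro!: fps_ext simp: S_nth distrib_left)
  have Sint: "int_fps F \<Longrightarrow> int_fps (S F)" for F
    using \<beta>(1) by (auto simp: int_fps_def S_nth)
  have Sdiv: "int_fps (i\<beta> * S F)" if "int_fps F" "F $ 0 = 0" for F
    unfolding int_fps_def
  proof
    fix n
    show "(i\<beta> * S F) $ n \<in> \<int>"
    proof (cases n)
      case (Suc k)
      then have "(i\<beta> * S F) $ n = \<beta> * (\<beta> ^ 2) ^ k * F $ n"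
        using \<beta>(2) by (simp add: i\<beta>_def S_nth power2_eq_square)
      then show ?thesis using \<beta>(1) that by (auto simp: int_fps_def)
    qed (use that in \<open>simp add: i\<beta>_def S_nth\<close>)
  qed
  define \<zeta> where "\<zeta> = i\<beta> * S z"
  have \<zeta>: "S z = fps_const \<beta> * \<zeta>" using ib by (simp add: \<zeta>_def mult.assoc[symmetric] mult.commute)
  have Si: "S (fps_const c) = fps_const c" for c by (rule fps_ext) (simp add: S_nth)
  have "\<zeta> = (- (i\<beta> * S a') * i\<beta>) + (- (i\<beta> * S (b' - fps_const \<beta>))) * \<zeta> + (- S c') * \<zeta> ^ 2
      + (- (fps_const \<beta> * S e')) * \<zeta> ^ 3"
  proof -
    define q where "q = fps_const \<beta>"
    have iq: "i\<beta> * q = 1" using ib by (simp add: q_def)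
    have "S (a' + b' * z + c' * z ^ 2 + e' * z ^ 3) = 0" by (simp add: eq S.zero)
    then have E: "S a' + S b' * (q * \<zeta>) + S c' * (q * \<zeta>) ^ 2 + S e' * (q * \<zeta>) ^ 3 = 0"
      by (simp add: S.hom \<zeta> q_def)
    have Sb: "S (b' - q) = S b' - q" by (simp add: S.diff Si q_def)
    have "(- (i\<beta> * S a') * i\<beta>) + (- (i\<beta> * (S b' - q))) * \<zeta> + (- S c') * \<zeta> ^ 2 + (- (q * S e')) * \<zeta> ^ 3 - \<zeta> = 0"
    proof -
      have "i\<beta> * i\<beta> * (S a' + S b' * (q * \<zeta>) + S c' * (q * \<zeta>) ^ 2 + S e' * (q * \<zeta>) ^ 3)
          = i\<beta> * i\<beta> * S a' + i\<beta> * (i\<beta> * q) * S b' * \<zeta> + (i\<beta> * q) ^ 2 * S c' * \<zeta> ^ 2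
            + (i\<beta> * q) ^ 2 * q * S e' * \<zeta> ^ 3"
        by (simp only: algebra_simps power2_eq_square power3_eq_cube)
      then have "i\<beta> * i\<beta> * S a' + i\<beta> * S b' * \<zeta> + S c' * \<zeta> ^ 2 + q * S e' * \<zeta> ^ 3 = 0"
        by (simp add: E iq)
      moreover have "(- (i\<beta> * S a') * i\<beta>) + (- (i\<beta> * (S b' - q))) * \<zeta> + (- S c') * \<zeta> ^ 2 + (- (q * S e')) * \<zeta> ^ 3 - \<zeta>
          = (i\<beta> * q) * \<zeta> - \<zeta> - (i\<beta> * i\<beta> * S a' + i\<beta> * S b' * \<zeta> + S c' * \<zeta> ^ 2 + q * S e' * \<zeta> ^ 3)"
        by (simp add: algebra_simps)
      ultimately show ?thesis by (simp add: iq)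
    qed
    then have "(- (i\<beta> * S a') * i\<beta>) + (- (i\<beta> * (S b' - q))) * \<zeta> + (- S c') * \<zeta> ^ 2 + (- (q * S e')) * \<zeta> ^ 3 = \<zeta>"
      by (simp only: right_minus_eq)
    then show ?thesis unfolding Sb[symmetric] unfolding q_def by (rule sym)
  qed
  moreover have "int_fps (- (i\<beta> * S a') * i\<beta>)"
    unfolding int_fps_def
  proof
    fix n
    show "(- (i\<beta> * S a') * i\<beta>) $ n \<in> \<int>"
    proof (cases n)
      case (Suc k)
      then have "(- (i\<beta> * S a') * i\<beta>) $ n = - ((\<beta> ^ 2) ^ k * a' $ n)"
        using \<beta>(2) by (simp add: i\<beta>_def S_nth power2_eq_square)
      then show ?thesis using \<beta>(1) ints(1) by (auto simp: int_fps_def)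
    qed (use a0 in \<open>simp add: i\<beta>_def S_nth\<close>)
  qed
  ultimately have int\<zeta>: "int_fps \<zeta>"
  proof (rule cubic_fps_int[rotated 2])
    show "\<zeta> $ 0 = 0" by (simp add: \<zeta>_def S_nth z0 i\<beta>_def)
    show "(- (i\<beta> * S (b' - fps_const \<beta>))) $ 0 = 0" using b0 by (simp add: i\<beta>_def S_nth)
    show "int_fps (- (i\<beta> * S (b' - fps_const \<beta>)))"
      using b0 ints(2) \<beta>(1) by (intro int_fps_uminus Sdiv int_fps_diff int_fps_const) auto
    show "int_fps (- S c')" "int_fps (- (fps_const \<beta> * S e'))"
      using ints \<beta>(1) by (auto intro!: int_fps_uminus int_fps_mult int_fps_const Sint)
  qed
  have zint: "\<beta> ^ (2 * n) * z $ n / \<beta> \<in> \<int>" for n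
    using int\<zeta> by (auto simp: int_fps_def \<zeta>_def i\<beta>_def S_nth power_mult)
  obtain k :: int where k: "\<beta> = of_int k" using \<beta>(1) by (auto elim: Ints_cases)
  define D where "D = L * nat (k ^ 2)"
  have D: "real D = real L * \<beta> ^ 2" by (simp add: D_def k)
  have "0 < k ^ 2" using \<beta>(2) k by simp
  then have "1 \<le> D" using L(1) unfolding D_def by (cases "nat (k ^ 2)") auto
  moreover have "real D \<le> real E"
  proof -
    have "real D \<le> Q * (Q ^ 10) ^ 2"
      unfolding D using LQ \<beta>(3) Q4 power_mono[OF \<beta>(3), of 2] by (intro mult_mono) auto
    also have "\<dots> = Q ^ 21" by (simp add: power_mult[symmetric] power_Suc[symmetric] del: power_Suc)
    also have "\<dots> \<le> real E" unfolding E by (rule p) simp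
    finally show ?thesis .
  qed
  moreover have "real D ^ (i + 1) * \<eta> $ i \<in> \<int> \<and> \<bar>\<eta> $ i\<bar> \<le> real E ^ (i + 1)" for i
  proof (cases "i \<le> f")
    case True
    have "real D ^ (i + 1) * \<eta> $ i = real D ^ i * \<beta> ^ 2 * (real L * \<eta> $ i)"
      by (simp add: D)
    also have "\<dots> \<in> \<int>" 
      by (rule Ints_mult[OF Ints_mult[OF Ints_power[OF Ints_of_nat] Ints_power[OF \<beta>(1)]] L(3)])
        (use True in simp)
    finally have "real D ^ (i + 1) * \<eta> $ i \<in> \<int>" .
    moreover have "\<bar>\<eta> $ i\<bar> \<le> real E ^ (i + 1)"
    proof -
      have "\<bar>\<eta> $ i\<bar> \<le> Q ^ 1" using L4 True by simp
      also have "\<dots> \<le> Q ^ (30 * (i + 1))" by (rule p) simp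
      finally show ?thesis by (simp only: E power_mult)
    qed
    ultimately show ?thesis by blast
  next
    case False
    define n where "n = i - f"
    have i: "i = f + n" "n \<ge> 1" using False by (auto simp: n_def)
    have \<eta>i: "\<eta> $ i = z $ n" using i by (simp add: z_def Y_def add.commute)
    have "2 * (i + 1) = 2 * n + (2 * f + 2)" using i by simp
    then have "real D ^ (i + 1) = real L ^ (i + 1) * \<beta> ^ (2 * n + (2 * f + 2))"
      unfolding D power_mult_distrib power_mult[symmetric] by simp
    then have "real D ^ (i + 1) * \<eta> $ i
        = real L ^ (i + 1) * \<beta> ^ (2 * f + 3) * (\<beta> ^ (2 * n) * z $ n / \<beta>)"
      unfolding \<eta>i power_add using \<beta>(2) by (simp add: power_numeral_reduce)
    also have "\<dots> \<in> \<int>" using zint \<beta>(1) by (intro Ints_mult Ints_power) auto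
    finally have "real D ^ (i + 1) * \<eta> $ i \<in> \<int>" .
    moreover have "\<bar>\<eta> $ i\<bar> \<le> real E ^ (i + 1)"
    proof -
      have "\<bar>\<eta> $ i\<bar> \<le> (Q ^ 30) ^ n" using zb \<eta>i by simp
      also have "\<dots> \<le> (Q ^ 30) ^ (i + 1)" using i p[of 0 30] by (intro power_increasing) auto
      finally show ?thesis by (simp only: E)
    qed
    ultimately show ?thesis by blast
  qed
  ultimately show ?thesis unfolding of_nat_le_iff by blast
qed

end

section \<open>Siegel's lemma and rational function approximation\<close>

text \<open>
  The map sends the box \<open>{0..H}\<^sup>N\<close> into a box with fewer points, so two points have the same image and their difference is a
  solution. The hypothesis states \<open>R / (N - R) < e\<close> without subtraction.
\<close>

lemma siegel:
  fixes G :: "nat \<Rightarrow> nat \<Rightarrow> int"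
  assumes G: "\<And>i j. i < R \<Longrightarrow> j < N \<Longrightarrow> \<bar>G i j\<bar> \<le> int M"
    and M: "1 \<le> M" and less: "(e + 1) * R < e * N"
  shows "\<exists>x. (\<exists>j<N. x j \<noteq> 0) \<and> (\<forall>j<N. \<bar>x j\<bar> \<le> int ((2 * N * M + 1) ^ e)) \<and>
    (\<forall>i<R. (\<Sum>j<N. G i j * x j) = 0)"
proof -
  define K where "K = 2 * N * M + 1"
  define H where "H = K ^ e - 1"
  have N: "1 \<le> N" using less by (cases N) auto
  have K: "1 < K" using N M by (simp add: K_def)
  have H: "H + 1 = K ^ e" using K by (simp add: H_def)
  define S where "S = {..<N} \<rightarrow>\<^sub>E {0..int H}"
  define B where "B = int (N * M * H)"
  define V where "V = {..<R} \<rightarrow>\<^sub>E {- B..B}"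
  define f where "f = (\<lambda>x. restrict (\<lambda>i. \<Sum>j<N. G i j * x j) {..<R})"
  have "f ` S \<subseteq> V"
  proof
    fix y assume "y \<in> f ` S"
    then obtain x where x: "x \<in> S" "y = f x" by blast
    have "(\<Sum>j<N. G i j * x j) \<in> {- B..B}" if i: "i < R" for i
    proof -
      have "\<bar>\<Sum>j<N. G i j * x j\<bar> \<le> (\<Sum>j<N. \<bar>G i j * x j\<bar>)" by (rule sum_abs)
      also have "\<dots> \<le> (\<Sum>j<N. int M * int H)"
      proof (rule sum_mono)
        fix j assume j: "j \<in> {..<N}"
        then have "x j \<in> {0..int H}" using PiE_mem[OF x(1)[unfolded S_def]] by blast
        then show "\<bar>G i j * x j\<bar> \<le> int M * int H"
          unfolding abs_mult using G[of i j] i j by (intro mult_mono) auto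
      qed
      also have "\<dots> = B" by (simp add: B_def)
      finally show ?thesis by auto
    qed
    then show "y \<in> V" unfolding x(2) f_def V_def by (intro restrict_PiE_iff[THEN iffD2]) simp
  qed
  moreover have finV: "finite V" by (auto simp: V_def intro!: finite_PiE)
  ultimately have "card (f ` S) \<le> card V" by (intro card_mono)
  also have "card V = (2 * (N * M * H) + 1) ^ R"
  proof -
    have "B - - B + 1 = int (2 * (N * M * H) + 1)" by (simp add: B_def)
    then have "card {- B..B} = 2 * (N * M * H) + 1" by (simp only: card_atLeastAtMost_int nat_int)
    then show ?thesis by (simp add: V_def card_PiE)
  qed
  also have "\<dots> \<le> (K * (H + 1)) ^ R"
    by (intro power_mono) (auto simp: K_def algebra_simps)
  also have "\<dots> = K ^ ((e + 1) * R)"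
    unfolding H by (simp add: power_mult[symmetric] power_Suc[symmetric] del: power_Suc)
  also have "\<dots> < K ^ (e * N)"
    using less K by (intro power_strict_increasing) auto
  also have "\<dots> = card S"
    using H by (simp add: S_def card_PiE power_mult nat_add_distrib)
  finally have "\<not> inj_on f S" by (rule pigeonhole)
  then obtain x y where xy: "x \<in> S" "y \<in> S" "f x = f y" "x \<noteq> y"
    by (auto simp: inj_on_def)
  have nz: "\<exists>j<N. x j - y j \<noteq> 0"
  proof (rule ccontr)
    assume "\<not> ?thesis"
    then have "x j = y j" if "j \<in> {..<N}" for j using that by auto
    then have "x = y" using PiE_ext[OF xy(1,2)[unfolded S_def]] by blast
    with xy(4) show False ..
  qed
  have bd: "\<bar>x j - y j\<bar> \<le> int (K ^ e)" if "j < N" for j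
  proof -
    have "x j \<in> {0..int H}" "y j \<in> {0..int H}"
      using that PiE_mem[OF xy(1)[unfolded S_def]] PiE_mem[OF xy(2)[unfolded S_def]] by blast+
    then show ?thesis unfolding H[symmetric] atLeastAtMost_iff by linarith
  qed
  have sol: "(\<Sum>j<N. G i j * (x j - y j)) = 0" if "i < R" for i
  proof -
    have "f x i = f y i" using xy(3) by simp
    then show ?thesis using that by (simp add: f_def right_diff_distrib sum_subtractf)
  qed
  show ?thesis unfolding K_def[symmetric]
    by (rule exI[of _ "\<lambda>j. x j - y j"]) (intro conjI allI impI nz bd sol)
qed

abbreviation rps :: "int poly \<Rightarrow> real fps" where
  "rps p \<equiv> fps_of_poly (map_poly of_int p)"

lemma rps_nth: "rps p $ n = of_int (coeff p n)"
  by (simp add: coeff_map_poly)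

lemma abs_int_le_real: "\<bar>z\<bar> \<le> int n \<Longrightarrow> \<bar>real_of_int z\<bar> \<le> real n"
  by linarith

lemma coeff_sum_monom: "coeff (\<Sum>j\<le>k. monom (c j) j) n = (if n \<le> k then c n else 0)"
  by (simp add: coeff_sum)

text \<open>
  The unknowns are the coefficients of the denominator \<open>B\<close>; vanishing at the indices
  \<open>k + 1, \<dots>, k + R\<close> gives \<open>R = (s - 1) l\<close> equations for \<open>k + 1 = s l + 1\<close> unknowns, so the exponent in
  Siegel's lemma is at most \<open>s\<close> and the heights grow only geometrically with \<open>k\<close>. The numerator \<open>A\<close>
  is the truncation of \<open>B \<eta>\<close>.
\<close>

lemma pade_approximation:
  fixes \<eta> :: "real fps" and D E s l :: nat
  assumes DE: "1 \<le> D" "D \<le> E" "2 \<le> E"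
    and den: "\<And>i. real D ^ (i + 1) * \<eta> $ i \<in> \<int>"
    and size: "\<And>i. \<bar>\<eta> $ i\<bar> \<le> real E ^ (i + 1)"
    and sl: "1 \<le> s" "1 \<le> l"
  defines "k \<equiv> s * l" and "R \<equiv> (s - 1) * l"
  defines "C \<equiv> real E ^ (12 * k * s)"
  shows "\<exists>A B :: int poly. degree A \<le> k \<and> degree B \<le> k \<and> B \<noteq> 0 \<and>
    (\<forall>i. \<bar>real_of_int (coeff A i)\<bar> \<le> C \<and> \<bar>real_of_int (coeff B i)\<bar> \<le> C) \<and>
    (\<forall>n\<le>k + R. (rps A - rps B * \<eta>) $ n = 0) \<and>
    (\<forall>n. \<bar>(rps A - rps B * \<eta>) $ n\<bar> \<le> C * real E ^ (n + 1))"
proof -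
  have k: "1 \<le> k" using sl unfolding k_def by (cases s; cases l) auto
  have Rk: "R + l = k" unfolding k_def R_def using sl by (cases s) (auto simp: algebra_simps)
  have E1: "1 \<le> real E" and E2: "2 \<le> real E" using DE by auto
  have pw: "real E ^ a \<le> real E ^ b" if "a \<le> b" for a b
    using that E1 by (rule power_increasing)
  have DEr: "real D ^ a \<le> real E ^ a" for a using DE by (intro power_mono) auto
  have kE: "real (k + 1) \<le> real E ^ k"
  proof -
    have "k + 1 \<le> 2 ^ k" using less_exp[of k] by (simp add: Suc_le_eq)
    also have "\<dots> \<le> E ^ k" using DE by (intro power_mono) auto
    finally have "real (k + 1) \<le> real (E ^ k)" by (simp only: of_nat_le_iff)
    then show ?thesis by (simp only: of_nat_power)
  qed
  have den': "real D ^ (n + 1) * \<eta> $ i \<in> \<int>" if "i \<le> n" for n i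
  proof -
    have "real D ^ (n + 1) = real D ^ (n - i) * real D ^ (i + 1)"
      unfolding power_add[symmetric] using that by simp
    then have "real D ^ (n + 1) * \<eta> $ i = real D ^ (n - i) * (real D ^ (i + 1) * \<eta> $ i)" by (simp only: mult.assoc)
    also have "\<dots> \<in> \<int>" by (intro Ints_mult[OF _ den] Ints_power Ints_of_nat)
    finally show ?thesis .
  qed
  \<comment> \<open>Row \<open>i\<close> expresses that the coefficient of \<open>B \<eta>\<close> with index \<open>k + 1 + i\<close> vanishes; the power of \<open>D\<close> makes it integral.\<close>
  define G where "G i j = \<lfloor>real D ^ (k + 1 + i + 1) * \<eta> $ (k + 1 + i - j)\<rfloor>" for i j
  have G: "real_of_int (G i j) = real D ^ (k + 1 + i + 1) * \<eta> $ (k + 1 + i - j)" if "j < k + 1" for i j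
    unfolding G_def by (rule of_int_floor) (rule den', use that in simp)
  have Gs: "\<bar>G i j\<bar> \<le> int (E ^ (4 * k))" if "i < R" "j < k + 1" for i j
  proof -
    have "\<bar>real_of_int (G i j)\<bar> = real D ^ (k + 1 + i + 1) * \<bar>\<eta> $ (k + 1 + i - j)\<bar>"
      unfolding G[OF that(2)] by (simp add: abs_mult)
    also have "\<dots> \<le> real E ^ (k + 1 + i + 1) * real E ^ (k + 1 + i - j + 1)"
      by (intro mult_mono DEr size) auto
    also have "\<dots> \<le> real E ^ (4 * k)"
      unfolding power_add[symmetric] by (rule pw) (use that Rk sl in linarith)
    finally have "real_of_int \<bar>G i j\<bar> \<le> real_of_int (int (E ^ (4 * k)))" by simp
    then show ?thesis by (simp only: of_int_le_iff)
  qed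
  have EM: "1 \<le> E ^ (4 * k)" using DE by simp
  have less: "(s + 1) * R < s * (k + 1)"
  proof -
    obtain s' where s': "s = Suc s'" using sl by (cases s) auto
    show ?thesis unfolding R_def k_def s' by (simp add: algebra_simps)
  qed
  obtain x where x: "\<exists>j<k + 1. x j \<noteq> 0" "\<And>j. j < k + 1 \<Longrightarrow> \<bar>x j\<bar> \<le> int ((2 * (k + 1) * E ^ (4 * k) + 1) ^ s)"
    "\<And>i. i < R \<Longrightarrow> (\<Sum>j<k + 1. G i j * x j) = 0"
    using siegel[of R "k + 1" G "E ^ (4 * k)" s, OF Gs EM less] by blast
  have xs: "\<bar>real_of_int (x j)\<bar> \<le> real E ^ (7 * k * s)" if "j < k + 1" for j
  proof -
    have "\<bar>real_of_int (x j)\<bar> \<le> real ((2 * (k + 1) * E ^ (4 * k) + 1) ^ s)"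
      by (rule abs_int_le_real[OF x(2)[OF that]])
    also have "\<dots> = (2 * real (k + 1) * real E ^ (4 * k) + 1) ^ s"
      by (simp only: of_nat_power of_nat_add of_nat_mult of_nat_1 of_nat_numeral)
    also have "\<dots> \<le> (real E ^ (7 * k)) ^ s"
    proof (rule power_mono)
      have "2 * real (k + 1) * real E ^ (4 * k) \<le> real E ^ 1 * real E ^ k * real E ^ (4 * k)"
        by (intro mult_mono kE) (use E2 in auto)
      also have "\<dots> \<le> real E ^ (6 * k)"
        unfolding power_add[symmetric] by (rule pw) (use k in simp)
      finally have "2 * real (k + 1) * real E ^ (4 * k) + 1 \<le> 2 * real E ^ (6 * k)"
        using pw[of 0 "6 * k"] by simp
      also have "\<dots> \<le> real E ^ 1 * real E ^ (6 * k)" using E2 by (intro mult_right_mono) auto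
      also have "\<dots> \<le> real E ^ (7 * k)"
        unfolding power_add[symmetric] by (rule pw) (use k in simp)
      finally show "2 * real (k + 1) * real E ^ (4 * k) + 1 \<le> real E ^ (7 * k)" .
    qed auto
    finally show ?thesis by (simp only: power_mult)
  qed
  \<comment> \<open>The factor makes the coefficients of \<open>B \<eta>\<close> up to index \<open>k\<close> integral; they are the numerator.\<close>
  define b where "b j = int D ^ (k + 1) * x j" for j
  have bs: "\<bar>real_of_int (b j)\<bar> \<le> real E ^ (9 * k * s)" if "j < k + 1" for j
  proof -
    have "\<bar>real_of_int (b j)\<bar> = real D ^ (k + 1) * \<bar>real_of_int (x j)\<bar>" by (simp add: b_def abs_mult)
    also have "\<dots> \<le> real E ^ (k + 1) * real E ^ (7 * k * s)"
      by (intro mult_mono DEr xs that) auto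
    also have "\<dots> \<le> real E ^ (9 * k * s)"
      unfolding power_add[symmetric]
    proof (rule pw)
      have "k * 1 \<le> k * s" using sl by (intro mult_le_mono2)
      then show "k + 1 + 7 * k * s \<le> 9 * k * s" using k by linarith
    qed
    finally show ?thesis .
  qed
  define B where "B = (\<Sum>j\<le>k. monom (b j) j)"
  have Bc: "coeff B n = (if n \<le> k then b n else 0)" for n
    unfolding B_def by (rule coeff_sum_monom)
  define a where "a n = \<lfloor>(rps B * \<eta>) $ n\<rfloor>" for n
  have BE: "(rps B * \<eta>) $ n = (\<Sum>j=0..n. of_int (coeff B j) * \<eta> $ (n - j))" for n
    unfolding fps_mult_nth rps_nth ..
  have a: "real_of_int (a n) = (rps B * \<eta>) $ n" if "n \<le> k" for n
    unfolding a_def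
  proof (rule of_int_floor)
    have "of_int (coeff B j) * \<eta> $ (n - j) \<in> \<int>" if "j \<in> {0..n}" for j
    proof -
      have "of_int (coeff B j) * \<eta> $ (n - j) = of_int (x j) * (real D ^ (k + 1) * \<eta> $ (n - j))"
        using that \<open>n \<le> k\<close> by (simp add: Bc b_def)
      also have "\<dots> \<in> \<int>" using \<open>n \<le> k\<close> by (intro Ints_mult Ints_of_int den') simp
      finally show ?thesis .
    qed
    then show "(rps B * \<eta>) $ n \<in> \<int>" unfolding BE by (rule Ints_sum)
  qed
  have Bn: "\<bar>(rps B * \<eta>) $ n\<bar> \<le> real E ^ (10 * k * s) * real E ^ (n + 1)" for n
  proof -
    have "\<bar>(rps B * \<eta>) $ n\<bar> \<le> (\<Sum>j=0..n. \<bar>of_int (coeff B j) * \<eta> $ (n - j)\<bar>)"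
      unfolding BE by (rule sum_abs)
    also have "\<dots> = (\<Sum>j\<in>{0..n} \<inter> {..k}. \<bar>of_int (coeff B j) * \<eta> $ (n - j)\<bar>)"
      by (rule sum.mono_neutral_right) (auto simp: Bc)
    also have "\<dots> \<le> (\<Sum>j\<in>{0..n} \<inter> {..k}. real E ^ (9 * k * s) * real E ^ (n + 1))"
    proof (rule sum_mono)
      fix j assume j: "j \<in> {0..n} \<inter> {..k}"
      have "\<bar>\<eta> $ (n - j)\<bar> \<le> real E ^ (n + 1)" by (rule order_trans[OF size pw]) simp
      moreover have "\<bar>real_of_int (coeff B j)\<bar> \<le> real E ^ (9 * k * s)" using j bs[of j] by (simp add: Bc)
      ultimately show "\<bar>of_int (coeff B j) * \<eta> $ (n - j)\<bar> \<le> real E ^ (9 * k * s) * real E ^ (n + 1)"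
        unfolding abs_mult by (intro mult_mono) auto
    qed
    also have "\<dots> = real (card ({0..n} \<inter> {..k})) * (real E ^ (9 * k * s) * real E ^ (n + 1))" by simp
    also have "\<dots> \<le> real E ^ k * (real E ^ (9 * k * s) * real E ^ (n + 1))"
    proof (rule mult_right_mono)
      have "card ({0..n} \<inter> {..k}) \<le> card {..k}" by (rule card_mono) auto
      then have "real (card ({0..n} \<inter> {..k})) \<le> real (k + 1)" by simp
      then show "real (card ({0..n} \<inter> {..k})) \<le> real E ^ k" using kE by linarith
    qed auto
    also have "\<dots> = real E ^ (k + 9 * k * s) * real E ^ (n + 1)" by (simp add: power_add)
    also have "\<dots> \<le> real E ^ (10 * k * s) * real E ^ (n + 1)"
    proof (rule mult_right_mono[OF pw])
      have "k * 1 \<le> k * s" using sl by (intro mult_le_mono2)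
      then show "k + 9 * k * s \<le> 10 * k * s" by linarith
    qed auto
    finally show ?thesis .
  qed
  have C10: "real E ^ (10 * k * s) \<le> C" unfolding C_def by (rule pw) simp
  have Bn': "\<bar>(rps B * \<eta>) $ n\<bar> \<le> C * real E ^ (n + 1)" for n
    by (rule order_trans[OF Bn mult_right_mono[OF C10]]) simp
  define A where "A = (\<Sum>j\<le>k. monom (a j) j)"
  have Ac: "coeff A n = (if n \<le> k then a n else 0)" for n
    unfolding A_def by (rule coeff_sum_monom)
  have h: "(rps A - rps B * \<eta>) $ n = (if n \<le> k then 0 else - (rps B * \<eta>) $ n)" for n
    using a[of n] by (simp add: coeff_map_poly Ac)
  have "degree A \<le> k" "degree B \<le> k" by (auto intro!: degree_le simp: Ac Bc)
  moreover have "B \<noteq> 0"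
  proof -
    obtain j where j: "j < k + 1" "x j \<noteq> 0" using x(1) by blast
    then have "coeff B j \<noteq> 0" using DE by (simp add: Bc b_def)
    then show ?thesis by auto
  qed
  moreover have "\<bar>real_of_int (coeff B i)\<bar> \<le> C" for i
  proof (cases "i \<le> k")
    case True
    have "\<bar>real_of_int (b i)\<bar> \<le> real E ^ (9 * k * s)" using True by (intro bs) simp
    also have "\<dots> \<le> C" unfolding C_def by (rule pw) simp
    finally show ?thesis using True by (simp add: Bc)
  qed (simp add: Bc C_def)
  moreover have "\<bar>real_of_int (coeff A i)\<bar> \<le> C" for i
  proof (cases "i \<le> k")
    case True
    have "\<bar>real_of_int (a i)\<bar> \<le> real E ^ (10 * k * s) * real E ^ (i + 1)" unfolding a[OF True] by (rule Bn)
    also have "\<dots> \<le> C"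
      unfolding C_def power_add[symmetric]
    proof (rule pw)
      have "k * 1 \<le> k * s" using sl by (intro mult_le_mono2)
      then show "10 * k * s + (i + 1) \<le> 12 * k * s" using k True by linarith
    qed
    finally show ?thesis using True by (simp add: Ac)
  qed (simp add: Ac C_def)
  moreover have "(rps A - rps B * \<eta>) $ n = 0" if n: "n \<le> k + R" for n
  proof (cases "n \<le> k")
    case False
    define i where "i = n - (k + 1)"
    have i: "n = k + 1 + i" "i < R" using False n by (auto simp: i_def)
    have "(rps B * \<eta>) $ n = (\<Sum>j<k + 1. of_int (coeff B j) * \<eta> $ (n - j))"
      unfolding BE by (rule sum.mono_neutral_right) (use False in \<open>auto simp: Bc\<close>)
    also have "\<dots> * real D ^ (n + 1) = (\<Sum>j<k + 1. real D ^ (k + 1) * (of_int (x j) * of_int (G i j)))"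
      unfolding sum_distrib_right
    proof (rule sum.cong)
      fix j assume "j \<in> {..<k + 1}"
      then have j: "j < k + 1" by simp
      show "of_int (coeff B j) * \<eta> $ (n - j) * real D ^ (n + 1) = real D ^ (k + 1) * (of_int (x j) * of_int (G i j))"
        unfolding G[OF j] i(1) using j by (simp add: Bc b_def mult_ac)
    qed simp
    also have "\<dots> = real D ^ (k + 1) * of_int (\<Sum>j<k + 1. G i j * x j)"
      unfolding of_int_sum sum_distrib_left of_int_mult by (simp only: mult.commute)
    also have "\<dots> = 0" unfolding x(3)[OF i(2)] by simp
    finally have "(rps B * \<eta>) $ n = 0" using DE by simp
    then show ?thesis unfolding h by simp
  qed (simp only: h if_True)
  moreover have "\<bar>(rps A - rps B * \<eta>) $ n\<bar> \<le> C * real E ^ (n + 1)" for n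
    unfolding h using Bn'[of n] by (simp add: C_def del: fps_mult_nth split: if_split)
  ultimately show ?thesis by blast
qed

section \<open>The Riccati equation of a cubic and its Wronskian\<close>

text \<open>
  The roots of \<open>Y\<^sup>3 + pY + q\<close> satisfy the Riccati equation
  \<open>6 \<Delta> y' = \<Delta>' y - 6 w (3 y\<^sup>2 + 2 p)\<close> with \<open>\<Delta> = 4p\<^sup>3 + 27q\<^sup>2\<close> and \<open>w = 2pq' - 3qp'\<close>. A Riccati equation
  induces a linear differential operator on the pairs \<open>(A, B)\<close> standing for linear forms \<open>A - B y\<close>;
  \<open>con_A\<close> and \<open>con_B\<close> are its components for the normalization in which \<open>(A - B y) / (3y\<^sup>2 + p)\<close> is
  differentiated, and \<open>wronskian\<close> is the determinant of \<open>(A, B)\<close> and its image. The derivatives are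
  separate arguments, so that the same formulas serve polynomials and power series.
\<close>

definition disc :: "'a :: comm_ring_1 \<Rightarrow> 'a \<Rightarrow> 'a" where
  "disc p q = 4 * p ^ 3 + 27 * q ^ 2"

definition disc' :: "'a :: comm_ring_1 \<Rightarrow> 'a \<Rightarrow> 'a \<Rightarrow> 'a \<Rightarrow> 'a" where
  "disc' p q p' q' = 12 * p ^ 2 * p' + 54 * q * q'"

definition ric_w :: "'a :: comm_ring_1 \<Rightarrow> 'a \<Rightarrow> 'a \<Rightarrow> 'a \<Rightarrow> 'a" where
  "ric_w p q p' q' = 2 * p * q' - 3 * q * p'"

definition con_A :: "'a :: comm_ring_1 \<Rightarrow> 'a \<Rightarrow> 'a \<Rightarrow> 'a \<Rightarrow> 'a \<Rightarrow> 'a \<Rightarrow> 'a \<Rightarrow> 'a" where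
  "con_A p q p' q' A B A' = 6 * disc p q * A' - 2 * disc' p q p' q' * A + 12 * p * ric_w p q p' q' * B"

definition con_B :: "'a :: comm_ring_1 \<Rightarrow> 'a \<Rightarrow> 'a \<Rightarrow> 'a \<Rightarrow> 'a \<Rightarrow> 'a \<Rightarrow> 'a \<Rightarrow> 'a" where
  "con_B p q p' q' A B B' = 6 * disc p q * B' - disc' p q p' q' * B - 18 * ric_w p q p' q' * A"

definition wronskian :: "'a :: comm_ring_1 \<Rightarrow> 'a \<Rightarrow> 'a \<Rightarrow> 'a \<Rightarrow> 'a \<Rightarrow> 'a \<Rightarrow> 'a \<Rightarrow> 'a \<Rightarrow> 'a" where
  "wronskian p q p' q' A B A' B' = A * con_B p q p' q' A B B' - B * con_A p q p' q' A B A'"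

lemmas con_defs = disc_def disc'_def ric_w_def con_A_def con_B_def

context ring_map
begin

lemma hom_disc: "h (disc p q) = disc (h p) (h q)"
  by (simp only: disc_def hom)

lemma hom_wronskian:
  "h (wronskian p q p' q' A B A' B')
    = wronskian (h p) (h q) (h p') (h q') (h A) (h B) (h A') (h B')"
  by (simp only: wronskian_def con_defs hom)

end

text \<open>
  The cofactor is the one of the Euclidean algorithm for the cubic and its derivative. Division by
  \<open>3 y\<^sup>2 + p\<close> thus costs only a factor \<open>disc p q\<close>.
\<close>

lemma deriv_times_cofactor:
  fixes y p q :: "'a :: idom"
  assumes "y ^ 3 + p * y + q = 0"
  shows "(3 * y ^ 2 + p) * (6 * p * y ^ 2 - 9 * q * y + 4 * p ^ 2) = disc p q"
  using assms unfolding disc_def by Groebner_Basis.algebra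

lemma riccati:
  fixes y y' p q p' q' :: "'a :: idom"
  assumes root: "y ^ 3 + p * y + q = 0" and "(3 * y ^ 2 + p) * y' = - (p' * y + q')"
  shows "6 * disc p q * y' = disc' p q p' q' * y - 6 * ric_w p q p' q' * (3 * y ^ 2 + 2 * p)"
proof -
  have "6 * disc p q * y' = 6 * (6 * p * y ^ 2 - 9 * q * y + 4 * p ^ 2) * ((3 * y ^ 2 + p) * y')"
    unfolding deriv_times_cofactor[OF root, symmetric] by Groebner_Basis.algebra
  then show ?thesis
    unfolding assms(2) using root unfolding disc'_def ric_w_def by Groebner_Basis.algebra
qed

text \<open>
  For every root \<open>y\<close> the operator acts on \<open>A - B y\<close> as a differential operator of order one.
\<close>

lemma con_linear_form:
  fixes y y' p q p' q' :: "'a :: idom"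
  assumes "6 * disc p q * y' = disc' p q p' q' * y - 6 * ric_w p q p' q' * (3 * y ^ 2 + 2 * p)"
  shows "con_A p q p' q' A B A' - con_B p q p' q' A B B' * y
    = 6 * disc p q * (A' - B' * y - B * y') + 18 * ric_w p q p' q' * y * (A - B * y)
      - 2 * disc' p q p' q' * (A - B * y)"
  using assms unfolding con_A_def con_B_def by Groebner_Basis.algebra

lemma deriv_of_derivative:
  fixes y y' p q p' q' :: "'a :: idom"
  assumes "y ^ 3 + p * y + q = 0"
    and "6 * disc p q * y' = disc' p q p' q' * y - 6 * ric_w p q p' q' * (3 * y ^ 2 + 2 * p)"
  shows "6 * disc p q * (6 * y * y' + p') = (3 * y ^ 2 + p) * (2 * disc' p q p' q' - 18 * ric_w p q p' q' * y)"
proof -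
  have "6 * disc p q * (6 * y * y' + p')
      = 6 * y * (disc' p q p' q' * y - 6 * ric_w p q p' q' * (3 * y ^ 2 + 2 * p)) + 6 * disc p q * p'"
    unfolding assms(2)[symmetric] by Groebner_Basis.algebra
  then show ?thesis using assms(1) unfolding con_defs by Groebner_Basis.algebra
qed

text \<open>
  This is the reason for the normalization: the quotients \<open>g = (A - B y) / (3y\<^sup>2 + p)\<close> for the roots
  \<open>y\<close> span the solutions of one linear system, and their Wronskians are, up to units, the
  polynomial \<open>wronskian\<close>.
\<close>

lemma wronskian_of_quotients:
  fixes p q :: "'a :: idom"
  assumes r1: "y1 ^ 3 + p * y1 + q = 0"
      "6 * disc p q * y1' = disc' p q p' q' * y1 - 6 * ric_w p q p' q' * (3 * y1 ^ 2 + 2 * p)"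
    and r2: "y2 ^ 3 + p * y2 + q = 0"
      "6 * disc p q * y2' = disc' p q p' q' * y2 - 6 * ric_w p q p' q' * (3 * y2 ^ 2 + 2 * p)"
    and g1: "g1 * (3 * y1 ^ 2 + p) = A - B * y1"
      "g1' * (3 * y1 ^ 2 + p) + g1 * (6 * y1 * y1' + p') = A' - B' * y1 - B * y1'"
    and g2: "g2 * (3 * y2 ^ 2 + p) = A - B * y2"
      "g2' * (3 * y2 ^ 2 + p) + g2 * (6 * y2 * y2' + p') = A' - B' * y2 - B * y2'"
  shows "6 * disc p q * (3 * y1 ^ 2 + p) * (3 * y2 ^ 2 + p) * (g1 * g2' - g1' * g2)
    = wronskian p q p' q' A B A' B' * (y1 - y2)"
proof -
  have *: "6 * disc p q * (g' * (3 * y ^ 2 + p)) = con_A p q p' q' A B A' - con_B p q p' q' A B B' * y"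
    if r: "y ^ 3 + p * y + q = 0"
      "6 * disc p q * y' = disc' p q p' q' * y - 6 * ric_w p q p' q' * (3 * y ^ 2 + 2 * p)"
      and g: "g * (3 * y ^ 2 + p) = A - B * y"
      "g' * (3 * y ^ 2 + p) + g * (6 * y * y' + p') = A' - B' * y - B * y'"
    for y y' g g'
  proof -
    have "6 * disc p q * (g' * (3 * y ^ 2 + p))
        = 6 * disc p q * (A' - B' * y - B * y') - g * (6 * disc p q * (6 * y * y' + p'))"
      unfolding g(2)[symmetric] by Groebner_Basis.algebra
    also have "\<dots> = 6 * disc p q * (A' - B' * y - B * y')
        - (g * (3 * y ^ 2 + p)) * (2 * disc' p q p' q' - 18 * ric_w p q p' q' * y)"
      unfolding deriv_of_derivative[OF r] by Groebner_Basis.algebra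
    finally show ?thesis
      unfolding con_linear_form[OF r(2)] g(1) by Groebner_Basis.algebra
  qed
  have "6 * disc p q * (3 * y1 ^ 2 + p) * (3 * y2 ^ 2 + p) * (g1 * g2' - g1' * g2)
      = (g1 * (3 * y1 ^ 2 + p)) * (6 * disc p q * (g2' * (3 * y2 ^ 2 + p)))
        - (g2 * (3 * y2 ^ 2 + p)) * (6 * disc p q * (g1' * (3 * y1 ^ 2 + p)))"
    by Groebner_Basis.algebra
  also have "\<dots> = wronskian p q p' q' A B A' B' * (y1 - y2)"
    unfolding *[OF r1 g1] *[OF r2 g2] g1(1) g2(1) wronskian_def by Groebner_Basis.algebra
  finally show ?thesis .
qed

lemma fps_deriv_root:
  fixes y p q :: "'a :: field_char_0 fps"
  assumes root: "y ^ 3 + p * y + q = 0"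
  shows "6 * disc p q * fps_deriv y = disc' p q (fps_deriv p) (fps_deriv q) * y
    - 6 * ric_w p q (fps_deriv p) (fps_deriv q) * (3 * y ^ 2 + 2 * p)"
proof (rule riccati[OF root])
  have "fps_deriv (y * y * y + p * y + q) = 0"
    using root by (simp add: power3_eq_cube)
  then have "3 * y ^ 2 * fps_deriv y + fps_deriv p * y + p * fps_deriv y + fps_deriv q = 0"
    by (simp add: algebra_simps power2_eq_square)
  then show "(3 * y ^ 2 + p) * fps_deriv y = - (fps_deriv p * y + fps_deriv q)"
    by (simp add: algebra_simps add_eq_0_iff)
qed

lemma fps_X_deriv_monomial:
  fixes u :: "'a :: field_char_0 fps"
  shows "fps_X * fps_deriv (fps_X ^ n * u) = fps_X ^ n * (of_nat n * u + fps_X * fps_deriv u)"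
proof (induction n)
  case (Suc n)
  have "fps_X * fps_deriv (fps_X ^ Suc n * u) = fps_X * fps_deriv (fps_X * (fps_X ^ n * u))"
    by (simp only: power_Suc mult.assoc)
  also have "\<dots> = fps_X * (fps_X * fps_deriv (fps_X ^ n * u)) + fps_X * (fps_X ^ n * u)"
    by (simp add: algebra_simps)
  also have "\<dots> = fps_X ^ Suc n * (of_nat (Suc n) * u + fps_X * fps_deriv u)"
    unfolding Suc by (simp add: algebra_simps)
  finally show ?case .
qed simp

lemma subdegree_decompose_unit:
  fixes f :: "'a :: field_char_0 fps"
  assumes "f \<noteq> 0"
  obtains u where "f = fps_X ^ subdegree f * u" "u $ 0 \<noteq> 0"
  using assms subdegree_decompose[of f] that[of "fps_shift (subdegree f) f"]
  by (simp add: mult.commute)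

text \<open>
  The logarithmic derivative of \<open>a / b\<close> has a simple pole, with residue \<open>subdegree a - subdegree b\<close>.
\<close>

lemma log_derivative_pole:
  fixes a b :: "'a :: field_char_0 fps"
  assumes "a \<noteq> 0" "b \<noteq> 0" "subdegree a \<noteq> subdegree b"
  shows "(fps_X * (fps_deriv a * b - a * fps_deriv b)) $ (subdegree a + subdegree b) \<noteq> 0"
proof -
  define m n where "m = subdegree a" "n = subdegree b"
  obtain u where u: "a = fps_X ^ m * u" "u $ 0 \<noteq> 0"
    using subdegree_decompose_unit[OF assms(1)] unfolding m_n_def by metis
  obtain v where v: "b = fps_X ^ n * v" "v $ 0 \<noteq> 0"
    using subdegree_decompose_unit[OF assms(2)] unfolding m_n_def by metis
  have "fps_X * (fps_deriv a * b - a * fps_deriv b)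
      = (fps_X * fps_deriv a) * b - a * (fps_X * fps_deriv b)"
    by (simp add: algebra_simps)
  also have "\<dots> = fps_X ^ (m + n) * ((of_nat m * u + fps_X * fps_deriv u) * v - u * (of_nat n * v + fps_X * fps_deriv v))"
    unfolding u(1) v(1) fps_X_deriv_monomial by (simp add: algebra_simps power_add)
  finally have "(fps_X * (fps_deriv a * b - a * fps_deriv b)) $ (m + n)
      = ((of_nat m * u + fps_X * fps_deriv u) * v - u * (of_nat n * v + fps_X * fps_deriv v)) $ 0"
    by (simp add: fps_X_power_mult_nth)
  also have "\<dots> = (of_nat m - of_nat n) * (u $ 0 * v $ 0)"
    by (simp add: algebra_simps fps_of_nat[symmetric])
  also have "\<dots> \<noteq> 0" using u v assms(3) unfolding m_n_def by simp
  finally show ?thesis unfolding m_n_def .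
qed

lemma subdegree_derivative_le:
  fixes y p q :: "'a :: field_char_0 fps"
  assumes "y ^ 3 + p * y + q = 0" "disc p q \<noteq> 0"
  shows "3 * y ^ 2 + p \<noteq> 0" "subdegree (3 * y ^ 2 + p) \<le> subdegree (disc p q)"
proof -
  note c = deriv_times_cofactor[OF assms(1)]
  show m: "3 * y ^ 2 + p \<noteq> 0" using c assms(2) by (metis mult_zero_left)
  have "6 * p * y ^ 2 - 9 * q * y + 4 * p ^ 2 \<noteq> 0" using c assms(2) by (metis mult_zero_right)
  with m have "subdegree (disc p q) = subdegree (3 * y ^ 2 + p) + subdegree (6 * p * y ^ 2 - 9 * q * y + 4 * p ^ 2)"
    unfolding c[symmetric] by (rule subdegree_mult)
  then show "subdegree (3 * y ^ 2 + p) \<le> subdegree (disc p q)" by simp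
qed

text \<open>
  This is the equation for the logarithmic derivative of \<open>h\<^sup>2 D / (B\<^sup>2 m\<^sup>4)\<close> with the denominators cleared.
\<close>

lemma wronskian_zero_identity:
  fixes y p q :: "'a :: idom"
  assumes r: "y ^ 3 + p * y + q = 0"
      "6 * disc p q * y' = disc' p q p' q' * y - 6 * ric_w p q p' q' * (3 * y ^ 2 + 2 * p)"
    and W: "wronskian p q p' q' A B A' B' = 0"
  defines "h \<equiv> A - B * y" and "h' \<equiv> A' - B' * y - B * y'" and "m \<equiv> 3 * y ^ 2 + p"
    and "m' \<equiv> 6 * y * y' + p'" and "D \<equiv> disc p q" and "D' \<equiv> disc' p q p' q'" and "w \<equiv> ric_w p q p' q'"
  shows "6 * ((2 * h * h' * D + h ^ 2 * D') * (B ^ 2 * m ^ 4)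
      - (h ^ 2 * D) * (2 * B * B' * m ^ 4 + B ^ 2 * (4 * m ^ 3 * m'))) = - 36 * w * h ^ 3 * B * m ^ 4"
proof -
  have 1: "B * (6 * D * h' + 18 * w * y * h - 2 * D' * h) = h * (6 * D * B' - D' * B - 18 * w * (h + B * y))"
    using W con_linear_form[OF r(2), of A B A' B'] unfolding wronskian_def con_B_def h_def h'_def D_def D'_def w_def by Groebner_Basis.algebra
  have 2: "6 * D * m' = m * (2 * D' - 18 * w * y)"
    using deriv_of_derivative[OF r] unfolding D_def D'_def w_def m_def m'_def .
  have "6 * ((2 * h * h' * D + h ^ 2 * D') * (B ^ 2 * m ^ 4)
      - (h ^ 2 * D) * (2 * B * B' * m ^ 4 + B ^ 2 * (4 * m ^ 3 * m')))
    = 2 * h * B * m ^ 4 * (B * (6 * D * h') - h * (6 * D * B')) + 6 * h ^ 2 * D' * B ^ 2 * m ^ 4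
      - 4 * h ^ 2 * B ^ 2 * m ^ 3 * (6 * D * m')"
    by Groebner_Basis.algebra
  also have "\<dots> = 2 * h * B * m ^ 4 * (B * (6 * D * h') - h * (6 * D * B')) + 6 * h ^ 2 * D' * B ^ 2 * m ^ 4
      - 4 * h ^ 2 * B ^ 2 * m ^ 4 * (2 * D' - 18 * w * y)"
    unfolding 2 by Groebner_Basis.algebra
  also have "B * (6 * D * h') - h * (6 * D * B') = h * (- D' * B - 18 * w * (h + B * y)) - 18 * w * y * h * B + 2 * D' * h * B"
    using 1 by Groebner_Basis.algebra
  also have "2 * h * B * m ^ 4 * (h * (- D' * B - 18 * w * (h + B * y)) - 18 * w * y * h * B + 2 * D' * h * B)
      + 6 * h ^ 2 * D' * B ^ 2 * m ^ 4 - 4 * h ^ 2 * B ^ 2 * m ^ 4 * (2 * D' - 18 * w * y) = - 36 * w * h ^ 3 * B * m ^ 4"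
    by Groebner_Basis.algebra
  finally show ?thesis .
qed

text \<open>
  If the Wronskian vanished, then \<open>A / B\<close> would be a rational solution of the Riccati equation. For
  \<open>h = A - B y\<close> and \<open>m = 3y\<^sup>2 + p\<close> the quotient \<open>h\<^sup>2 \<Delta> / (B\<^sup>2 m\<^sup>4)\<close> would then have the logarithmic
  derivative \<open>- 6 w h / (B \<Delta>)\<close>, which is regular when \<open>h\<close> vanishes to high order. The quotient
  would vanish at \<open>0\<close>, whereas the logarithmic derivative of a function has a pole at each zero.
\<close>

lemma wronskian_nonzero:
  fixes y p q A B :: "'a :: field_char_0 fps"
  assumes root: "y ^ 3 + p * y + q = 0" and D: "disc p q \<noteq> 0"
    and B: "B \<noteq> 0" and h: "A - B * y \<noteq> 0"
    and high: "subdegree (A - B * y) > subdegree B + 2 * subdegree (disc p q)"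
  shows "wronskian p q (fps_deriv p) (fps_deriv q) A B (fps_deriv A) (fps_deriv B) \<noteq> 0"
proof
  assume W: "wronskian p q (fps_deriv p) (fps_deriv q) A B (fps_deriv A) (fps_deriv B) = 0"
  define H where "H = A - B * y"
  define m where "m = 3 * y ^ 2 + p"
  define a where "a = H ^ 2 * disc p q"
  define b where "b = B ^ 2 * m ^ 4"
  define w where "w = ric_w p q (fps_deriv p) (fps_deriv q)"
  have dH: "fps_deriv H = fps_deriv A - fps_deriv B * y - B * fps_deriv y"
    unfolding H_def by (simp add: algebra_simps)
  have dm: "fps_deriv m = 6 * y * fps_deriv y + fps_deriv p"
    unfolding m_def by (simp add: power2_eq_square algebra_simps)
  have dD: "fps_deriv (disc p q) = disc' p q (fps_deriv p) (fps_deriv q)"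
    unfolding disc_def disc'_def by (simp add: power2_eq_square power3_eq_cube algebra_simps)
  have da: "fps_deriv a = 2 * H * fps_deriv H * disc p q + H ^ 2 * fps_deriv (disc p q)"
    unfolding a_def by (simp add: power2_eq_square algebra_simps)
  have "fps_deriv (m ^ 4) = 4 * m ^ 3 * fps_deriv m"
    using fps_deriv_power[of m 4] by (simp add: fps_of_nat[symmetric] mult_ac)
  then have db: "fps_deriv b = 2 * B * fps_deriv B * m ^ 4 + B ^ 2 * (4 * m ^ 3 * fps_deriv m)"
    unfolding b_def by (simp add: power2_eq_square algebra_simps)
  have "6 * (fps_deriv a * b - a * fps_deriv b) = - 36 * w * H ^ 3 * B * m ^ 4"
    unfolding da db unfolding a_def b_def
    using wronskian_zero_identity[OF root fps_deriv_root[OF root] W]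
    unfolding H_def[symmetric] m_def[symmetric] w_def[symmetric] dH[symmetric] dm[symmetric] dD[symmetric] .
  also have "\<dots> = 6 * (- 6 * w * H ^ 3 * B * m ^ 4)" by simp
  finally have eq6: "6 * (fps_deriv a * b - a * fps_deriv b) = 6 * (- 6 * w * H ^ 3 * B * m ^ 4)" .
  have "(6 :: 'a fps) \<noteq> 0" by simp
  from eq6[unfolded mult_left_cancel[OF this]]
  have eq: "fps_deriv a * b - a * fps_deriv b = - 6 * w * H ^ 3 * B * m ^ 4" .
  have H0: "H \<noteq> 0" using h unfolding H_def .
  have m0: "m \<noteq> 0" and f: "subdegree m \<le> subdegree (disc p q)"
    unfolding m_def by (rule subdegree_derivative_le[OF root D])+
  have a0: "a \<noteq> 0" and b0: "b \<noteq> 0" using H0 D B m0 unfolding a_def b_def by simp_all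
  have sa: "subdegree a = 2 * subdegree H + subdegree (disc p q)"
    unfolding a_def using H0 D by (simp add: subdegree_power)
  have sb: "subdegree b = 2 * subdegree B + 4 * subdegree m"
    unfolding b_def using B m0 by (simp add: subdegree_power)
  have hi: "subdegree H > subdegree B + 2 * subdegree (disc p q)" using high unfolding H_def .
  have "subdegree a \<noteq> subdegree b" unfolding sa sb using hi f by linarith
  note pole = log_derivative_pole[OF a0 b0 this]
  have "fps_X * (fps_deriv a * b - a * fps_deriv b) = (H ^ 3 * B * m ^ 4) * (fps_X * (- 6 * w))"
    unfolding eq by (simp add: algebra_simps)
  moreover have "((H ^ 3 * B * m ^ 4) * (fps_X * (- 6 * w))) $ (subdegree a + subdegree b) = 0"
  proof (cases "w = 0")
    case False
    define W where "W = (H ^ 3 * B * m ^ 4) * (fps_X * (- 6 * w))"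
    have "subdegree (H ^ 3 * B * m ^ 4) = 3 * subdegree H + subdegree B + 4 * subdegree m"
      using H0 B m0 by (simp add: subdegree_power)
    moreover have "subdegree (fps_X * (- 6 * w)) = 1 + subdegree (- 6 * w)"
      using False by (subst subdegree_mult) simp_all
    moreover have "subdegree W = subdegree (H ^ 3 * B * m ^ 4) + subdegree (fps_X * (- 6 * w))"
      unfolding W_def using False H0 B m0 by (intro subdegree_mult) simp_all
    ultimately have "subdegree a + subdegree b < subdegree W"
      unfolding sa sb using hi f by linarith
    then show ?thesis unfolding W_def[symmetric] by (rule nth_less_subdegree_zero)
  qed simp
  ultimately show False using pole by simp
qed

section \<open>Integral Taylor coefficients at an integer\<close>

text \<open>
  The polynomial \<open>Q\<close> inverts the derivative at \<open>x\<close> up to the factor \<open>D\<close>. The equation for \<open>z\<close> is \<open>Q / D\<^sup>2\<close> times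
  the Taylor expansion of the cubic at \<open>x\<close> with increment \<open>D z\<close>.
\<close>

lemma hensel_root_identity:
  fixes x z p0 q0 D p1 q1 s Q :: "'a :: idom"
  assumes "x ^ 3 + p0 * x + q0 = 0" and Q: "Q * (3 * x ^ 2 + p0) = D" and "Q \<noteq> 0"
    and z: "z = - (Q * s * (p1 * x + q1)) + (- (Q * s * D * p1)) * z + (- (3 * Q * x)) * z ^ 2 + (- (Q * D)) * z ^ 3"
  shows "(x + D * z) ^ 3 + (p0 + s * D ^ 2 * p1) * (x + D * z) + (q0 + s * D ^ 2 * q1) = 0"
proof -
  have "Q * ((x + D * z) ^ 3 + (p0 + s * D ^ 2 * p1) * (x + D * z) + (q0 + s * D ^ 2 * q1)) = 0"
    using assms by Groebner_Basis.algebra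
  with \<open>Q \<noteq> 0\<close> show ?thesis by simp
qed

lemma hensel_derivative_identity:
  fixes x z p0 D p1 s Q \<theta> :: "'a :: idom"
  assumes Q: "Q * (3 * x ^ 2 + p0) = D"
    and \<theta>: "(1 + Q * (6 * x * z + 3 * D * z ^ 2 + D * s * p1)) * \<theta> = 1"
  shows "(3 * (x + D * z) ^ 2 + (p0 + s * D ^ 2 * p1)) * \<theta> = 3 * x ^ 2 + p0"
proof -
  have "(3 * x ^ 2 + p0) * (1 + Q * (6 * x * z + 3 * D * z ^ 2 + D * s * p1))
      = (3 * x ^ 2 + p0) + (Q * (3 * x ^ 2 + p0)) * (6 * x * z + 3 * D * z ^ 2 + D * s * p1)"
    by Groebner_Basis.algebra
  also have "\<dots> = 3 * (x + D * z) ^ 2 + (p0 + s * D ^ 2 * p1)"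
    unfolding Q by Groebner_Basis.algebra
  finally have "3 * (x + D * z) ^ 2 + (p0 + s * D ^ 2 * p1)
      = (3 * x ^ 2 + p0) * (1 + Q * (6 * x * z + 3 * D * z ^ 2 + D * s * p1))" ..
  then show ?thesis using \<theta> by (simp add: mult.assoc)
qed

lemma roots_sum_zero:
  fixes y1 y2 y3 p q :: "'a :: idom"
  assumes "y1 ^ 3 + p * y1 + q = 0" "y2 ^ 3 + p * y2 + q = 0" "y3 ^ 3 + p * y3 + q = 0"
    and "y1 \<noteq> y2" "y1 \<noteq> y3" "y2 \<noteq> y3"
  shows "y1 + y2 + y3 = 0" "p = - (y1 ^ 2 + y1 * y2 + y2 ^ 2)"
proof -
  have "(y1 - y2) * (y1 ^ 2 + y1 * y2 + y2 ^ 2 + p) = 0" "(y1 - y3) * (y1 ^ 2 + y1 * y3 + y3 ^ 2 + p) = 0"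
    using assms(1-3) by Groebner_Basis.algebra+
  then have *: "y1 ^ 2 + y1 * y2 + y2 ^ 2 + p = 0" "y1 ^ 2 + y1 * y3 + y3 ^ 2 + p = 0"
    using assms(4,5) by simp_all
  then have "(y2 - y3) * (y1 + y2 + y3) = 0" by Groebner_Basis.algebra
  then show "y1 + y2 + y3 = 0" using assms(6) by simp
  show "p = - (y1 ^ 2 + y1 * y2 + y2 ^ 2)" using *(1) by Groebner_Basis.algebra
qed

text \<open>
  By Lagrange interpolation the quotients \<open>(A - B y) / (3y\<^sup>2 + p)\<close> have trace zero.
\<close>

lemma trace_zero:
  fixes y1 y2 y3 p q A B :: "'a :: idom"
  assumes r: "y1 ^ 3 + p * y1 + q = 0" "y2 ^ 3 + p * y2 + q = 0" "y3 ^ 3 + p * y3 + q = 0"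
    and ne: "y1 \<noteq> y2" "y1 \<noteq> y3" "y2 \<noteq> y3"
    and g: "g1 * (3 * y1 ^ 2 + p) = A - B * y1" "g2 * (3 * y2 ^ 2 + p) = A - B * y2"
      "g3 * (3 * y3 ^ 2 + p) = A - B * y3"
  shows "g1 + g2 + g3 = 0"
proof -
  note s = roots_sum_zero[OF r ne]
  have y3: "y3 = - y1 - y2" using s(1) by Groebner_Basis.algebra
  have "(y1 - y2) * (y1 - y3) * (y2 - y3) * (g1 + g2 + g3)
     = g1 * (3 * y1 ^ 2 + p) * (y2 - y3) - g2 * (3 * y2 ^ 2 + p) * (y1 - y3) + g3 * (3 * y3 ^ 2 + p) * (y1 - y2)"
    unfolding s(2) y3 by Groebner_Basis.algebra
  also have "\<dots> = 0" unfolding g by Groebner_Basis.algebra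
  finally show ?thesis using ne by simp
qed

text \<open>
  By Lagrange interpolation the trace of \<open>x\<^sup>i / (3 x\<^sup>2 + p)\<close> is \<open>0\<close>, \<open>0\<close>, \<open>1\<close> for \<open>i = 0, 1, 2\<close>.
\<close>

lemma quadratic_coefficient_zero:
  fixes x1 x2 x3 p q :: "'a :: idom"
  assumes r: "x1 ^ 3 + p * x1 + q = 0" "x2 ^ 3 + p * x2 + q = 0" "x3 ^ 3 + p * x3 + q = 0"
    and ne: "x1 \<noteq> x2" "x1 \<noteq> x3" "x2 \<noteq> x3"
    and g: "g1 * (3 * x1 ^ 2 + p) = a + b * x1 + c * x1 ^ 2" "g2 * (3 * x2 ^ 2 + p) = a + b * x2 + c * x2 ^ 2"
      "g3 * (3 * x3 ^ 2 + p) = a + b * x3 + c * x3 ^ 2"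
    and t: "g1 + g2 + g3 = 0"
  shows "c = 0"
proof -
  note s = roots_sum_zero[OF r ne]
  have x3: "x3 = - x1 - x2" using s(1) by Groebner_Basis.algebra
  have "g1 * (3 * x1 ^ 2 + p) * (x2 - x3) - g2 * (3 * x2 ^ 2 + p) * (x1 - x3) + g3 * (3 * x3 ^ 2 + p) * (x1 - x2)
      = (x1 - x2) * (x1 - x3) * (x2 - x3) * (g1 + g2 + g3)"
    unfolding s(2) x3 by Groebner_Basis.algebra
  also have "\<dots> = 0" using t by simp
  finally have "(a + b * x1 + c * x1 ^ 2) * (x2 - x3) - (a + b * x2 + c * x2 ^ 2) * (x1 - x3)
     + (a + b * x3 + c * x3 ^ 2) * (x1 - x2) = 0" unfolding g .
  then have "c * ((x1 - x2) * (x1 - x3) * (x2 - x3)) = 0" by Groebner_Basis.algebra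
  then show ?thesis using ne by simp
qed

definition evc :: "complex \<Rightarrow> int poly \<Rightarrow> complex" where
  "evc x p = poly (map_poly of_int p) x"

lemma ring_map_evc: "ring_map (evc x)"
  unfolding evc_def by (rule ring_map_eval)

lemma evc_const: "evc x [:c:] = of_int c"
  by (simp add: evc_def map_poly_pCons)

lemma evc_X: "evc x [:0, 1:] = x"
  by (simp add: evc_def map_poly_pCons)

lemma reduce_mod_cubic:
  fixes V :: "int poly" and p0 q0 :: int
  shows "\<exists>a b c. \<forall>x. x ^ 3 + of_int p0 * x + of_int q0 = 0 \<longrightarrow>
    evc x V = of_int a + of_int b * x + of_int c * x ^ 2"
proof (induction V)
  case 0
  show ?case by (intro exI[of _ 0]) (simp add: evc_def)
next
  case (pCons d V)
  then obtain a b c where abc: "\<And>x. x ^ 3 + of_int p0 * x + of_int q0 = 0 \<Longrightarrow>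
      evc x V = of_int a + of_int b * x + of_int c * x ^ 2"
    by blast
  have "evc x (pCons d V) = of_int (d - q0 * c) + of_int (a - p0 * c) * x + of_int b * x ^ 2"
    if "x ^ 3 + of_int p0 * x + of_int q0 = 0" for x
  proof -
    have "evc x (pCons d V) = of_int d + x * evc x V" by (simp add: evc_def map_poly_pCons)
    then show ?thesis using that abc[OF that] unfolding of_int_diff of_int_mult by Groebner_Basis.algebra
  qed
  then show ?case by blast
qed

lemma agree_zero_cancel:
  fixes F G :: "complex fps"
  assumes "agree n (F * G) 0" "G $ 0 \<noteq> 0"
  shows "agree n F 0"
proof -
  have "agree n (F * G * inverse G) (0 * inverse G)"
    using assms(1) by (intro agree_mult agree_refl)
  moreover have "F * G * inverse G = F" using inverse_mult_eq_1[OF assms(2)] by (simp add: mult.assoc mult.commute)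
  ultimately show ?thesis by simp
qed

lemma agree_deriv: "agree (Suc n) F G \<Longrightarrow> agree n (fps_deriv F) (fps_deriv G)"
  by (simp add: agree_def)

lemma agree_mono: "agree n F G \<Longrightarrow> m \<le> n \<Longrightarrow> agree m F G"
  by (simp add: agree_def)

lemma agree_diff: "agree n f g \<Longrightarrow> agree n f' g' \<Longrightarrow> agree n (f - f') (g - g')"
  by (simp add: agree_def)

text \<open>
  The lift \<open>z\<close> and the factor \<open>\<theta>\<close> have coefficients in \<open>\<int>[Y]\<close>: a root \<open>x\<close> of \<open>Y\<^sup>3 + p\<^sub>0 Y + q\<^sub>0\<close>
  extends to the root \<open>x + D z(x)\<close> of the cubic with coefficients \<open>p\<close> and \<open>q\<close>, and \<open>\<theta>(x)\<close> is the
  ratio of the derivatives at the two roots. The increments of \<open>p\<close> and \<open>q\<close> are divisible by \<open>D\<^sup>2\<close>,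
  the square of the discriminant, and this keeps the recursion integral. The polynomial \<open>Q\<close> is the cofactor
  of the derivative, and the equations for \<open>z\<close> and \<open>\<theta>\<close> are those of \<open>hensel_root_identity\<close> and
  \<open>hensel_derivative_identity\<close>.
\<close>

locale local_lift =
  fixes p0 q0 :: int and p1 q1 :: "int fps" and z \<theta> :: "int poly fps" and D :: int
  assumes D: "D = disc p0 q0" "D \<noteq> 0"
  fixes Q :: "int poly"
  assumes Q: "Q = [:4 * p0 ^ 2, - 9 * q0, 6 * p0:]"
  assumes z0: "z $ 0 = 0"
    and z: "z = - (fps_const Q * fps_X * (map_fps (\<lambda>c. [:c:]) p1 * fps_const [:0, 1:] + map_fps (\<lambda>c. [:c:]) q1))
      + (- (fps_const Q * fps_X * fps_const [:D:] * map_fps (\<lambda>c. [:c:]) p1)) * z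
      + (- (3 * fps_const Q * fps_const [:0, 1:])) * z ^ 2 + (- (fps_const Q * fps_const [:D:])) * z ^ 3"
    and \<theta>: "(1 + fps_const Q * (6 * fps_const [:0, 1:] * z + 3 * fps_const [:D:] * z ^ 2
        + fps_const [:D:] * fps_X * map_fps (\<lambda>c. [:c:]) p1)) * \<theta> = 1"
begin

definition pt :: "int fps" where "pt = fps_const p0 + fps_X * fps_const D ^ 2 * p1"
definition qt :: "int fps" where "qt = fps_const q0 + fps_X * fps_const D ^ 2 * q1"

definition cx :: "int fps \<Rightarrow> complex fps" where "cx = map_fps of_int"

lemma ring_map_cx: "ring_map cx"
  unfolding cx_def by (rule ring_map_map_fps[OF ring_map_of_int])

definition ev :: "complex \<Rightarrow> int poly fps \<Rightarrow> complex fps" where "ev x = map_fps (evc x)"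

lemma ring_map_ev: "ring_map (ev x)"
  unfolding ev_def by (rule ring_map_map_fps[OF ring_map_evc])

lemma ev_const: "ev x (fps_const c) = fps_const (evc x c)"
  unfolding ev_def by (rule map_fps_const[OF ring_map_evc])

lemma ev_X: "ev x fps_X = fps_X"
  unfolding ev_def by (rule map_fps_X[OF ring_map_evc])

lemma ev_lift: "ev x (map_fps (\<lambda>c. [:c:]) F) = cx F"
  by (rule fps_ext) (simp add: ev_def cx_def evc_const)

definition root :: "complex \<Rightarrow> bool" where
  "root x \<longleftrightarrow> x ^ 3 + of_int p0 * x + of_int q0 = 0"

definition \<eta> :: "complex \<Rightarrow> complex fps" where "\<eta> x = fps_const x + of_int D * ev x z"

definition m0 :: "complex \<Rightarrow> complex" where "m0 x = 3 * x ^ 2 + of_int p0"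

lemma cQ: "evc x Q = 6 * of_int p0 * x ^ 2 - 9 * of_int q0 * x + 4 * of_int p0 ^ 2"
  unfolding Q evc_def by (simp add: map_poly_pCons algebra_simps power2_eq_square)

lemma Qm0: "root x \<Longrightarrow> evc x Q * m0 x = of_int D"
proof -
  assume "root x"
  then have "(3 * x ^ 2 + of_int p0) * (6 * of_int p0 * x ^ 2 - 9 * of_int q0 * x + 4 * of_int p0 ^ 2) = disc (of_int p0) (of_int q0)"
    unfolding root_def by (rule deriv_times_cofactor)
  also have "disc (of_int p0) (of_int q0) = (of_int D :: complex)"
    unfolding D(1) by (rule ring_map.hom_disc[OF ring_map_of_int, symmetric])
  finally show ?thesis unfolding cQ m0_def by (simp only: mult.commute)
qed

lemma m0_nonzero: "root x \<Longrightarrow> m0 x \<noteq> 0"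
  using Qm0[of x] D(2) by auto

lemma ev_z0: "ev x z $ 0 = 0"
  by (simp add: ev_def z0 evc_def)

lemma eta0: "\<eta> x $ 0 = x"
  by (simp add: \<eta>_def ev_z0 fps_of_int[symmetric])

lemma z_eq:
  "ev x z = - (fps_const (evc x Q) * fps_X * (cx p1 * fps_const x + cx q1))
    + (- (fps_const (evc x Q) * fps_X * of_int D * cx p1)) * ev x z
    + (- (3 * fps_const (evc x Q) * fps_const x)) * ev x z ^ 2 + (- (fps_const (evc x Q) * of_int D)) * ev x z ^ 3"
proof -
  interpret ring_map "ev x" by (rule ring_map_ev)
  have "ev x z = ev x (- (fps_const Q * fps_X * (map_fps (\<lambda>c. [:c:]) p1 * fps_const [:0, 1:] + map_fps (\<lambda>c. [:c:]) q1))
      + (- (fps_const Q * fps_X * fps_const [:D:] * map_fps (\<lambda>c. [:c:]) p1)) * z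
      + (- (3 * fps_const Q * fps_const [:0, 1:])) * z ^ 2 + (- (fps_const Q * fps_const [:D:])) * z ^ 3)"
    by (rule arg_cong[OF z])
  then show ?thesis by (simp only: hom ev_const ev_X ev_lift evc_X evc_const fps_of_int)
qed

lemma theta_eq:
  "(1 + fps_const (evc x Q) * (6 * fps_const x * ev x z + 3 * of_int D * ev x z ^ 2 + of_int D * fps_X * cx p1)) * ev x \<theta> = 1"
proof -
  interpret ring_map "ev x" by (rule ring_map_ev)
  have "ev x ((1 + fps_const Q * (6 * fps_const [:0, 1:] * z + 3 * fps_const [:D:] * z ^ 2
        + fps_const [:D:] * fps_X * map_fps (\<lambda>c. [:c:]) p1)) * \<theta>) = ev x 1"
    by (rule arg_cong[OF \<theta>])
  then show ?thesis by (simp only: hom ev_const ev_X ev_lift evc_X evc_const fps_of_int)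
qed

lemma cx_pt: "cx pt = of_int p0 + fps_X * of_int D ^ 2 * cx p1"
  and cx_qt: "cx qt = of_int q0 + fps_X * of_int D ^ 2 * cx q1"
proof -
  interpret ring_map cx by (rule ring_map_cx)
  have c: "cx (fps_const c) = of_int c" for c
    unfolding cx_def map_fps_const[OF ring_map_of_int] by (simp only: fps_of_int)
  have X: "cx fps_X = fps_X" unfolding cx_def by (rule map_fps_X[OF ring_map_of_int])
  show "cx pt = of_int p0 + fps_X * of_int D ^ 2 * cx p1" "cx qt = of_int q0 + fps_X * of_int D ^ 2 * cx q1"
    unfolding pt_def qt_def by (simp_all only: hom c X)
qed

lemma cQ_fps: "root x \<Longrightarrow> fps_const (evc x Q) * (3 * fps_const x ^ 2 + of_int p0) = of_int D"
proof -
  assume "root x"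
  have "fps_const (evc x Q) * (3 * fps_const x ^ 2 + of_int p0) = fps_const (evc x Q * m0 x)"
    by (simp add: m0_def fps_of_int[symmetric] fps_const_power numeral_fps_const)
  then show ?thesis using Qm0[OF \<open>root x\<close>] by (simp add: fps_of_int)
qed

lemma eta_root:
  assumes "root x"
  shows "\<eta> x ^ 3 + cx pt * \<eta> x + cx qt = 0"
proof -
  have "fps_const x ^ 3 + of_int p0 * fps_const x + of_int q0 = fps_const (x ^ 3 + of_int p0 * x + of_int q0)"
    by (simp add: fps_of_int[symmetric] fps_const_power)
  then have 1: "fps_const x ^ 3 + of_int p0 * fps_const x + of_int q0 = 0"
    using assms by (simp add: root_def)
  have "evc x Q \<noteq> 0" using Qm0[OF assms] D(2) by auto
  then have 2: "fps_const (evc x Q) \<noteq> 0" by simp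
  show ?thesis
    unfolding \<eta>_def cx_pt cx_qt
    by (rule hensel_root_identity[OF 1 cQ_fps[OF assms] 2]) (rule z_eq)
qed

lemma eta_deriv:
  assumes "root x"
  shows "(3 * \<eta> x ^ 2 + cx pt) * ev x \<theta> = fps_const (m0 x)"
proof -
  have "(3 * \<eta> x ^ 2 + cx pt) * ev x \<theta> = 3 * fps_const x ^ 2 + of_int p0"
    unfolding \<eta>_def cx_pt by (rule hensel_derivative_identity[OF cQ_fps[OF assms] theta_eq])
  then show ?thesis by (simp add: m0_def fps_of_int[symmetric] fps_const_power numeral_fps_const)
qed

text \<open>The numerator of \<open>(A - B \<eta>) / (3\<eta>\<^sup>2 + p)\<close> over the constant derivative at the root \<open>x\<close>.\<close>

definition V :: "int fps \<Rightarrow> int fps \<Rightarrow> int poly fps" where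
  "V A B = (map_fps (\<lambda>c. [:c:]) A - map_fps (\<lambda>c. [:c:]) B * (fps_const [:0, 1:] + fps_const [:D:] * z)) * \<theta>"

lemma ev_V: "ev x (V A B) = (cx A - cx B * \<eta> x) * ev x \<theta>"
proof -
  interpret ring_map "ev x" by (rule ring_map_ev)
  show ?thesis unfolding V_def \<eta>_def by (simp only: hom ev_const ev_lift evc_X evc_const fps_of_int)
qed

definition quot :: "int fps \<Rightarrow> int fps \<Rightarrow> complex \<Rightarrow> complex fps" where
  "quot A B x = fps_const (1 / m0 x) * ev x (V A B)"

lemma quot_eq:
  assumes "root x"
  shows "quot A B x * (3 * \<eta> x ^ 2 + cx pt) = cx A - cx B * \<eta> x"
proof -
  have "quot A B x * (3 * \<eta> x ^ 2 + cx pt)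
      = fps_const (1 / m0 x) * (cx A - cx B * \<eta> x) * ((3 * \<eta> x ^ 2 + cx pt) * ev x \<theta>)"
    unfolding quot_def ev_V by (simp only: mult_ac)
  also have "\<dots> = (fps_const (1 / m0 x) * fps_const (m0 x)) * (cx A - cx B * \<eta> x)"
    unfolding eta_deriv[OF assms] by (simp only: mult_ac)
  also have "fps_const (1 / m0 x) * fps_const (m0 x) = 1"
    using m0_nonzero[OF assms] by simp
  finally show ?thesis by simp
qed

text \<open>
  The trace of \<open>V / (3x\<^sup>2 + p\<^sub>0)\<close> vanishes, so the remainder of each coefficient of \<open>V\<close> modulo the
  cubic has no quadratic term: it is again a linear form in the root, with integer coefficients.
\<close>

lemma integral_linear_forms:
  assumes roots: "root x1" "root x2" "root x3" and ne: "x1 \<noteq> x2" "x1 \<noteq> x3" "x2 \<noteq> x3"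
  shows "\<exists>a b :: nat \<Rightarrow> int. \<forall>i. \<forall>x. root x \<longrightarrow> ev x (V A B) $ i = of_int (a i) - of_int (b i) * x"
proof -
  have "\<exists>a b :: int. \<forall>x. root x \<longrightarrow> ev x (V A B) $ i = of_int a - of_int b * x" for i
  proof -
    obtain a b c where abc: "\<And>x. root x \<Longrightarrow> evc x (V A B $ i) = of_int a + of_int b * x + of_int c * x ^ 2"
      using reduce_mod_cubic[of p0 q0 "V A B $ i"] unfolding root_def by blast
    have \<eta>ne: "\<eta> x1 \<noteq> \<eta> x2" "\<eta> x1 \<noteq> \<eta> x3" "\<eta> x2 \<noteq> \<eta> x3"
      using ne eta0 by metis+
    have "quot A B x1 + quot A B x2 + quot A B x3 = 0"
      by (rule trace_zero[OF eta_root[OF roots(1)] eta_root[OF roots(2)] eta_root[OF roots(3)] \<eta>ne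
            quot_eq[OF roots(1)] quot_eq[OF roots(2)] quot_eq[OF roots(3)]])
    then have tr: "quot A B x1 $ i + quot A B x2 $ i + quot A B x3 $ i = 0"
      by (metis fps_add_nth fps_zero_nth)
    have g: "quot A B x $ i * (3 * x ^ 2 + of_int p0) = of_int a + of_int b * x + of_int c * x ^ 2" if "root x" for x
    proof -
      have "quot A B x $ i * m0 x = ev x (V A B) $ i"
        using m0_nonzero[OF that] by (simp add: quot_def)
      then show ?thesis using abc[OF that] by (simp add: m0_def ev_def)
    qed
    have "(of_int c :: complex) = 0"
      by (rule quadratic_coefficient_zero[OF roots[unfolded root_def] ne g[OF roots(1)] g[OF roots(2)] g[OF roots(3)] tr])
    then have "ev x (V A B) $ i = of_int a - of_int (- b) * x" if "root x" for x
      using abc[OF that] by (simp add: ev_def)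
    then show ?thesis by blast
  qed
  then show ?thesis by metis
qed

text \<open>
  If the linear forms for the indices up to \<open>n\<close> are all proportional to one form \<open>X - x Y\<close>, then the
  quotients for two roots are proportional to each other up to order \<open>n\<close>, and their Wronskian vanishes.
\<close>

lemma proportional_imp_wronskian:
  fixes X0 Y0 :: int
  assumes roots: "root x1" "root x2" and ne: "x1 \<noteq> x2"
    and V: "\<And>x i. root x \<Longrightarrow> i \<le> n \<Longrightarrow> ev x (V A B) $ i = of_int (a i) - of_int (b i) * x"
    and par: "\<And>i. i \<le> n \<Longrightarrow> a i * Y0 = b i * X0" and Y0: "Y0 \<noteq> 0"
  shows "agree n (wronskian pt qt (fps_deriv pt) (fps_deriv qt) A B (fps_deriv A) (fps_deriv B)) 0"
proof -
  define L :: "complex fps" where "L = Abs_fps (\<lambda>i. of_int (b i) / of_int Y0)"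
  define k where "k x = (of_int X0 - of_int Y0 * x) / m0 x" for x
  have q: "agree (Suc n) (quot A B x) (fps_const (k x) * L)" if x: "root x" for x
    unfolding agree_def
  proof (intro allI impI)
    fix i assume "i < Suc n"
    then have i: "i \<le> n" by simp
    have "of_int (a i) * of_int Y0 = (of_int (b i) * of_int X0 :: complex)"
      using par[OF i] by (metis of_int_mult)
    then have "of_int (a i) = of_int (b i) / of_int Y0 * (of_int X0 :: complex)"
      using Y0 by (simp add: field_simps)
    moreover have "of_int (b i) = of_int (b i) / of_int Y0 * (of_int Y0 :: complex)" using Y0 by simp
    ultimately have "of_int (a i) - of_int (b i) * x = of_int (b i) / of_int Y0 * (of_int X0 - of_int Y0 * x)"
      unfolding right_diff_distrib by (metis mult.assoc)
    then show "quot A B x $ i = (fps_const (k x) * L) $ i"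
      unfolding quot_def by (simp add: V[OF x i] k_def L_def)
  qed
  define g1 g2 where "g1 = quot A B x1" "g2 = quot A B x2"
  define h1 h2 where "h1 = fps_const (k x1) * L" "h2 = fps_const (k x2) * L"
  have a1: "agree (Suc n) g1 h1" and a2: "agree (Suc n) g2 h2"
    using q roots unfolding g1_g2_def h1_h2_def by blast+
  have "agree n (g1 * fps_deriv g2 - fps_deriv g1 * g2) (h1 * fps_deriv h2 - fps_deriv h1 * h2)"
    by (intro agree_diff agree_mult agree_deriv a1 a2 agree_mono[OF a1] agree_mono[OF a2]) simp_all
  moreover have "h1 * fps_deriv h2 - fps_deriv h1 * h2 = 0"
    unfolding h1_h2_def by (simp add: mult_ac)
  ultimately have w0: "agree n (g1 * fps_deriv g2 - fps_deriv g1 * g2) 0" by simp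
  interpret cx: ring_map cx by (rule ring_map_cx)
  have dcx: "cx (fps_deriv F) = fps_deriv (cx F)" for F
    by (rule fps_ext) (simp add: cx_def)
  have g': "fps_deriv (quot A B x) * (3 * \<eta> x ^ 2 + cx pt) + quot A B x * (6 * \<eta> x * fps_deriv (\<eta> x) + cx (fps_deriv pt))
      = cx (fps_deriv A) - cx (fps_deriv B) * \<eta> x - cx B * fps_deriv (\<eta> x)" if x: "root x" for x
  proof -
    have "fps_deriv (quot A B x * (3 * \<eta> x ^ 2 + cx pt)) = fps_deriv (cx A - cx B * \<eta> x)"
      unfolding quot_eq[OF x] ..
    then show ?thesis unfolding dcx by (simp add: power2_eq_square algebra_simps)
  qed
  have r': "6 * disc (cx pt) (cx qt) * fps_deriv (\<eta> x) = disc' (cx pt) (cx qt) (cx (fps_deriv pt)) (cx (fps_deriv qt)) * \<eta> x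
      - 6 * ric_w (cx pt) (cx qt) (cx (fps_deriv pt)) (cx (fps_deriv qt)) * (3 * \<eta> x ^ 2 + 2 * cx pt)" if "root x" for x
    unfolding dcx by (rule fps_deriv_root[OF eta_root[OF that]])
  note W = wronskian_of_quotients[OF eta_root[OF roots(1)] r'[OF roots(1)] eta_root[OF roots(2)] r'[OF roots(2)]
      quot_eq[OF roots(1)] g'[OF roots(1)] quot_eq[OF roots(2)] g'[OF roots(2)]]
  have "agree n (6 * disc (cx pt) (cx qt) * (3 * \<eta> x1 ^ 2 + cx pt) * (3 * \<eta> x2 ^ 2 + cx pt) * (g1 * fps_deriv g2 - fps_deriv g1 * g2))
     (6 * disc (cx pt) (cx qt) * (3 * \<eta> x1 ^ 2 + cx pt) * (3 * \<eta> x2 ^ 2 + cx pt) * 0)"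
    by (rule agree_mult[OF agree_refl w0])
  then have "agree n (cx (wronskian pt qt (fps_deriv pt) (fps_deriv qt) A B (fps_deriv A) (fps_deriv B)) * (\<eta> x1 - \<eta> x2)) 0"
    unfolding g1_g2_def W cx.hom_wronskian by simp
  moreover have "(\<eta> x1 - \<eta> x2) $ 0 \<noteq> 0" using ne eta0 by simp
  ultimately have "agree n (cx (wronskian pt qt (fps_deriv pt) (fps_deriv qt) A B (fps_deriv A) (fps_deriv B))) 0"
    by (rule agree_zero_cancel)
  then show ?thesis by (simp add: agree_def cx_def)
qed

lemma eta_unique:
  assumes "root x" "y ^ 3 + cx pt * y + cx qt = 0" "y $ 0 = x"
  shows "y = \<eta> x"
proof -
  have "(y - \<eta> x) * (y ^ 2 + y * \<eta> x + \<eta> x ^ 2 + cx pt) = 0"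
    using assms(2) eta_root[OF assms(1)] by Groebner_Basis.algebra
  moreover have "(y ^ 2 + y * \<eta> x + \<eta> x ^ 2 + cx pt) $ 0 = m0 x"
    using assms(3) eta0[of x] by (simp add: m0_def fps_nth_power_0 cx_pt power2_eq_square fps_of_int[symmetric])
  then have "y ^ 2 + y * \<eta> x + \<eta> x ^ 2 + cx pt \<noteq> 0"
    using m0_nonzero[OF assms(1)] by (metis fps_zero_nth)
  ultimately show ?thesis by simp
qed

subsection \<open>Sizes of the coefficients\<close>

context
  fixes T r :: real and x :: complex
  assumes T: "T \<ge> 4" and r: "0 < r" "r \<le> 1 / T ^ 19"
    and sz: "\<bar>real_of_int p0\<bar> \<le> T" "\<bar>real_of_int q0\<bar> \<le> T" "\<bar>real_of_int D\<bar> \<le> T" "norm x \<le> T"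
    and p1: "\<And>N. wsum N r (cx p1) \<le> T" and q1: "\<And>N. wsum N r (cx q1) \<le> T"
begin

lemma pT: "a \<le> b \<Longrightarrow> T ^ a \<le> T ^ b"
  using T by (intro power_increasing) auto

lemma Q_size: "norm (evc x Q) \<le> T ^ 6"
proof -
  have T0: "T \<ge> 0" using T by simp
  have "norm (evc x Q) \<le> norm (6 * of_int p0 * x ^ 2 - 9 * of_int q0 * x) + norm (4 * of_int p0 ^ 2 :: complex)"
    unfolding cQ by (rule norm_triangle_ineq)
  also have "norm (6 * of_int p0 * x ^ 2 - 9 * of_int q0 * x) \<le> norm (6 * of_int p0 * x ^ 2) + norm (9 * of_int q0 * x)"
    by (rule norm_triangle_ineq4)
  also have "norm (6 * of_int p0 * x ^ 2) = 6 * \<bar>real_of_int p0\<bar> * norm x ^ 2"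
    by (simp add: norm_mult norm_power)
  also have "norm (9 * of_int q0 * x) = 9 * \<bar>real_of_int q0\<bar> * norm x" by (simp add: norm_mult)
  also have "norm (4 * of_int p0 ^ 2 :: complex) = 4 * \<bar>real_of_int p0\<bar> ^ 2" by (simp add: norm_mult norm_power)
  also have "6 * \<bar>real_of_int p0\<bar> * norm x ^ 2 \<le> 6 * T * T ^ 2"
    using sz T0 by (intro mult_mono power_mono) simp_all
  also have "9 * \<bar>real_of_int q0\<bar> * norm x \<le> 9 * T * T" using sz T0 by (intro mult_mono) simp_all
  also have "4 * \<bar>real_of_int p0\<bar> ^ 2 \<le> 4 * T ^ 2" using sz by (intro mult_mono power_mono) simp_all
  finally have "norm (evc x Q) \<le> 6 * T ^ 3 + 13 * T ^ 2" by (simp add: power2_eq_square power3_eq_cube)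
  also have "\<dots> \<le> 64 * T ^ 3"
  proof -
    have "T ^ 2 \<le> T ^ 3" by (rule pT) simp
    moreover have "0 \<le> T ^ 3" using T0 by simp
    ultimately show ?thesis by linarith
  qed
  also have "\<dots> \<le> T ^ 3 * T ^ 3" using power_mono[OF T, of 3] T by (intro mult_right_mono) simp_all
  finally show ?thesis by (simp add: power_add[symmetric])
qed

lemma wprod: "wsum N r F \<le> f \<Longrightarrow> wsum N r G \<le> g \<Longrightarrow> 0 \<le> f \<Longrightarrow> wsum N r (F * G) \<le> f * g" for F G :: "complex fps"
  using order_trans[OF wsum_mult mult_mono[of "wsum N r F" f "wsum N r G" g]] wsum_nonneg[of r N G] r by simp

lemma wX: "wsum N r (fps_X :: complex fps) \<le> r"
  by (rule wsum_X) (use r in simp)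

lemma wQ: "wsum N r (fps_const (evc x Q)) \<le> T ^ 6"
  using Q_size by (simp add: wsum_const)

lemma wD: "wsum N r (of_int D :: complex fps) \<le> T"
  unfolding fps_of_int[symmetric] wsum_const using sz by simp

lemma wx: "wsum N r (fps_const x) \<le> T"
  using sz by (simp add: wsum_const)

lemma wnum: "wsum N r (numeral n :: complex fps) \<le> numeral n"
  unfolding numeral_fps_const wsum_const by simp

lemma r_le: "r * T ^ 19 \<le> 1"
  using r T by (simp add: field_simps)

text \<open>
  The weight \<open>r \<le> T\<^sup>-\<^sup>1\<^sup>9\<close> makes the constant term of the equation for \<open>z\<close> smaller than \<open>T\<^sup>-\<^sup>9\<close>, and on the
  interval up to \<open>T\<^sup>-\<^sup>9\<close> the quadratic and cubic terms are negligible.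
\<close>

lemma z_size: "wsum N r (ev x z) \<le> 1 / T ^ 9"
proof (rule wsum_cubic[OF ev_z0 _ z_eq])
  have T0: "T \<ge> 0" "T > 0" using T by simp_all
  have n: "0 \<le> T ^ k" for k using T0 by simp
  show "(- (fps_const (evc x Q) * fps_X * of_int D * cx p1)) $ 0 = 0" by simp
  show "0 \<le> r" "0 \<le> 1 / T ^ 9" using r T0 by simp_all
  have "T * T + T \<le> 2 * T ^ 2" using T by (simp add: power2_eq_square)
  show "wsum N r (- (fps_const (evc x Q) * fps_X * (cx p1 * fps_const x + cx q1))) \<le> T ^ 6 * r * (T * T + T)" for N
    unfolding wsum_uminus
    by (intro wprod wQ wX order_trans[OF wsum_add add_mono] p1 q1 wx mult_nonneg_nonneg n) (use r T0 in simp_all)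
  show "wsum N r (- (fps_const (evc x Q) * fps_X * of_int D * cx p1)) \<le> T ^ 6 * r * T * T" for N
    unfolding wsum_uminus by (intro wprod wQ wX wD p1 mult_nonneg_nonneg n) (use r T0 in simp_all)
  show "wsum N r (- (3 * fps_const (evc x Q) * fps_const x)) \<le> 3 * T ^ 6 * T" for N
    unfolding wsum_uminus by (intro wprod wnum wQ wx mult_nonneg_nonneg n) simp_all
  show "wsum N r (- (fps_const (evc x Q) * of_int D)) \<le> T ^ 6 * T" for N
    unfolding wsum_uminus by (intro wprod wQ wD n)
  define s where "s = 1 / T ^ 9"
  have sT: "s * T ^ 9 = 1" and s0: "s > 0" using T0 by (simp_all add: s_def)
  have s1: "s * T ^ k \<le> 1 / 4 ^ (9 - k)" if "k \<le> 9" for k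
  proof -
    have "s * T ^ k * 4 ^ (9 - k) \<le> s * T ^ k * T ^ (9 - k)"
      using power_mono[OF T, of "9 - k"] s0 n by (intro mult_left_mono) simp_all
    also have "\<dots> = 1" using that sT by (simp add: mult.assoc power_add[symmetric])
    finally show ?thesis by (simp add: field_simps)
  qed
  have "T ^ 6 * r * (T * T + T) = r * T ^ 19 * (s * T ^ 9) * (T ^ 6 * (T * T + T)) / T ^ 19"
    using T0 sT by simp
  also have "\<dots> = (r * T ^ 19) * (s * (T ^ 17 + T ^ 16) / T ^ 19)"
    using T0 by (simp add: field_simps power_add[symmetric] power_numeral_reduce)
  also have "\<dots> \<le> 1 * (s * (T ^ 17 + T ^ 16) / T ^ 19)"
    using r_le s0 n T0 by (intro mult_right_mono) simp_all
  also have "\<dots> \<le> s / 4"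
  proof -
    have "4 * (T ^ 17 + T ^ 16) \<le> 8 * T ^ 17" using pT[of 16 17] by simp
    also have "\<dots> \<le> T ^ 2 * T ^ 17" using power_mono[OF T, of 2] by (intro mult_right_mono n) simp_all
    finally have "4 * (T ^ 17 + T ^ 16) \<le> T ^ 19" by (simp add: power_add[symmetric])
    then have "(T ^ 17 + T ^ 16) / T ^ 19 \<le> 1 / 4" using T0 by (simp add: field_simps)
    then have "s * ((T ^ 17 + T ^ 16) / T ^ 19) \<le> s * (1 / 4)" using s0 by (intro mult_left_mono) simp_all
    then show ?thesis by simp
  qed
  finally have 1: "T ^ 6 * r * (T * T + T) \<le> s / 4" .
  have "T ^ 6 * r * T * T * s \<le> T ^ 6 * r * (T * T + T) * 1"
  proof (rule mult_mono)
    show "T ^ 6 * r * T * T \<le> T ^ 6 * r * (T * T + T)" using n r T0 by (simp add: algebra_simps)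
    show "s \<le> 1" using s1[of 0] by simp
  qed (use s0 n r T0 in simp_all)
  then have 2: "T ^ 6 * r * T * T * s \<le> s / 4" using 1 by simp
  have "3 * T ^ 6 * T * s ^ 2 = 3 * (s * T ^ 7) * s" by (simp add: power2_eq_square power_numeral_reduce)
  also have "\<dots> \<le> 3 * (1 / 16) * s" using s1[of 7] s0 by (intro mult_right_mono) simp_all
  finally have "3 * T ^ 6 * T * s ^ 2 \<le> 3 * (1 / 16) * s" .
  then have 3: "3 * T ^ 6 * T * s ^ 2 \<le> s / 4" using s0 by linarith
  have "T ^ 6 * T * s ^ 3 = (s * T ^ 7) * s * s" by (simp add: power3_eq_cube power_numeral_reduce)
  also have "\<dots> \<le> (1 / 16) * 1 * s"
    using s1[of 7] s1[of 0] s0 n by (intro mult_mono) simp_all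
  finally have 4: "T ^ 6 * T * s ^ 3 \<le> s / 4" using s0 by simp
  show "T ^ 6 * r * (T * T + T) + T ^ 6 * r * T * T * (1 / T ^ 9) + 3 * T ^ 6 * T * (1 / T ^ 9) ^ 2
     + T ^ 6 * T * (1 / T ^ 9) ^ 3 \<le> 1 / T ^ 9"
    unfolding s_def[symmetric] using 1 2 3 4 by linarith
qed

lemma eta_size: "wsum N r (\<eta> x) \<le> 2 * T"
proof -
  have "wsum N r (\<eta> x) \<le> T + T * (1 / T ^ 9)"
    unfolding \<eta>_def by (intro order_trans[OF wsum_add add_mono] wx wprod wD z_size) (use r T in simp_all)
  also have "T * (1 / T ^ 9) \<le> T * 1" using pT[of 0 9] T by (intro mult_left_mono) simp_all
  finally show ?thesis by simp
qed

lemma theta_size: "wsum N r (ev x \<theta>) \<le> 2"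
proof -
  have T0: "T \<ge> 0" "T > 0" using T by simp_all
  have n: "0 \<le> T ^ k" for k using T0 by simp
  define s where "s = 1 / T ^ 9"
  have sT: "s * T ^ 9 = 1" and s0: "s > 0" using T0 by (simp_all add: s_def)
  define e where "e = fps_const (evc x Q) * (6 * fps_const x * ev x z + 3 * of_int D * ev x z ^ 2 + of_int D * fps_X * cx p1)"
  have "wsum N r e \<le> T ^ 6 * (6 * T * s + 3 * T * s ^ 2 + T * r * T)"
    unfolding e_def s_def
    by (intro wprod wQ wnum wx z_size wD wX p1 order_trans[OF wsum_add add_mono] order_trans[OF wsum_power power_mono]
        wsum_nonneg mult_nonneg_nonneg n) (use r T0 in simp_all)
  also have "\<dots> \<le> 1 / 2"
  proof -
    have s4: "s * T ^ 8 \<le> 1 / 4"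
    proof -
      have "s * T ^ 8 * 4 \<le> s * T ^ 8 * T" using T s0 n by (intro mult_left_mono) simp_all
      also have "\<dots> = s * T ^ 9" by (simp add: power_numeral_reduce)
      finally show ?thesis using sT by simp
    qed
    have s7: "s * T ^ 7 * 4 \<le> 1 / 4"
    proof -
      have "s * T ^ 7 * 4 \<le> s * T ^ 7 * T" using T s0 n by (intro mult_left_mono) simp_all
      also have "\<dots> = s * T ^ 8" by (simp add: power_numeral_reduce)
      finally show ?thesis using s4 by simp
    qed
    have s1: "s \<le> 1 / 64"
    proof -
      have "s * 64 \<le> s * T ^ 9" using power_mono[OF T, of 3] pT[of 3 9] s0 by (intro mult_left_mono) simp_all
      then show ?thesis using sT by simp
    qed
    have "T ^ 6 * (6 * T * s) = 6 * (s * T ^ 7)" by (simp add: power_numeral_reduce)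
    moreover have "T ^ 6 * (3 * T * s ^ 2) = 3 * (s * T ^ 7) * s" by (simp add: power_numeral_reduce power2_eq_square)
    moreover have "3 * (s * T ^ 7) * s \<le> 3 * (1 / 16) * (1 / 64)"
      using s7 s1 s0 mult_nonneg_nonneg[OF less_imp_le[OF s0] n[of 7]] by (intro mult_mono) simp_all
    moreover have "T ^ 6 * (T * r * T) \<le> 1 / 16"
    proof -
      have "T ^ 6 * (T * r * T) * 16 \<le> T ^ 6 * (T * r * T) * T ^ 11"
        using power_mono[OF T, of 2] pT[of 2 11] r T0 by (intro mult_left_mono) simp_all
      also have "\<dots> = r * T ^ 19" by (simp add: power_numeral_reduce)
      finally show ?thesis using r_le by simp
    qed
    ultimately show ?thesis using s7 unfolding distrib_left by linarith
  qed
  finally have e: "wsum N r e \<le> 1 / 2" .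
  have "(1 + e) * ev x \<theta> = 1" unfolding e_def by (rule theta_eq)
  then have "ev x \<theta> = 1 - e * ev x \<theta>" by (simp add: algebra_simps)
  then have "wsum N r (ev x \<theta>) \<le> wsum N r (1 :: complex fps) + wsum N r (e * ev x \<theta>)"
    using wsum_diff[of r N 1 "e * ev x \<theta>"] r by simp
  also have "wsum N r (1 :: complex fps) = 1" using wsum_const[of N r "1 :: complex"] by simp
  also have "wsum N r (e * ev x \<theta>) \<le> 1 / 2 * wsum N r (ev x \<theta>)"
    by (rule wprod[OF e order_refl]) simp
  finally show ?thesis by simp
qed

text \<open>
  There are two estimates because \<open>A - B \<eta> x\<close> is small for one of the three roots only; for the other roots \<open>A\<close> and
  \<open>B\<close> are estimated separately.
\<close>

lemma V_size_general:
  assumes "\<And>N. wsum N r (cx A) \<le> K" "\<And>N. wsum N r (cx B) \<le> K"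
  shows "norm (ev x (V A B) $ i) \<le> 2 * K * (1 + 2 * T) / r ^ i"
proof -
  have K: "K \<ge> 0" using assms(1)[of 0] wsum_nonneg[of r 0 "cx A"] r by simp
  have "wsum i r (ev x (V A B)) \<le> (K + K * (2 * T)) * 2"
    unfolding ev_V
    by (intro wprod theta_size order_trans[OF wsum_diff add_mono] assms eta_size K) (use r T K in simp_all)
  then have "wsum i r (ev x (V A B)) / r ^ i \<le> 2 * K * (1 + 2 * T) / r ^ i"
    using r by (intro divide_right_mono) (simp_all add: algebra_simps)
  with wsum_coeff[OF r(1), of "ev x (V A B)" i] show ?thesis by linarith
qed

lemma V_size_special:
  assumes "\<And>N. wsum N r (cx A - cx B * \<eta> x) \<le> K"
  shows "norm (ev x (V A B) $ i) \<le> 2 * K / r ^ i"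
proof -
  have K: "K \<ge> 0" using assms[of 0] wsum_nonneg[of r 0 "cx A - cx B * \<eta> x"] r by simp
  have "wsum i r (ev x (V A B)) \<le> K * 2"
    unfolding ev_V by (intro wprod theta_size assms K)
  then have "wsum i r (ev x (V A B)) / r ^ i \<le> 2 * K / r ^ i"
    using r by (intro divide_right_mono) simp_all
  with wsum_coeff[OF r(1), of "ev x (V A B)" i] show ?thesis by linarith
qed

end

end

lemma local_lift_exists:
  assumes "disc p0 q0 \<noteq> (0 :: int)"
  shows "\<exists>z \<theta>. local_lift p0 q0 p1 q1 z \<theta> (disc p0 q0) [:4 * p0 ^ 2, - 9 * q0, 6 * p0:]"
proof -
  define D where "D = disc p0 q0"
  define Q where "Q = fps_const [:4 * p0 ^ 2, - 9 * q0, 6 * p0:]"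
  define P1 where "P1 = map_fps (\<lambda>c. [:c:]) p1"
  define Q1 where "Q1 = map_fps (\<lambda>c. [:c:]) q1"
  define Y where "Y = fps_const [:0, 1 :: int:]"
  obtain z where z: "z $ 0 = 0" "z = - (Q * fps_X * (P1 * Y + Q1)) + (- (Q * fps_X * fps_const [:D:] * P1)) * z
      + (- (3 * Q * Y)) * z ^ 2 + (- (Q * fps_const [:D:])) * z ^ 3"
    using cubic_fps_exists[of "- (Q * fps_X * (P1 * Y + Q1))" "- (Q * fps_X * fps_const [:D:] * P1)"
        "- (3 * Q * Y)" "- (Q * fps_const [:D:])"] by auto
  define e where "e = Q * (6 * Y * z + 3 * fps_const [:D:] * z ^ 2 + fps_const [:D:] * fps_X * P1)"
  have e0: "e $ 0 = 0" using z(1) by (simp add: e_def power2_eq_square)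
  obtain y where "y $ 0 = 0" "y = - e + (- e) * y + 0 * y ^ 2 + 0 * y ^ 3"
    using cubic_fps_exists[of "- e" "- e" 0 0] e0 by auto
  then have "(1 + e) * (1 + y) = 1" by (simp add: algebra_simps)
  then have "local_lift p0 q0 p1 q1 z (1 + y) (disc p0 q0) [:4 * p0 ^ 2, - 9 * q0, 6 * p0:]"
    using z assms unfolding e_def D_def Q_def P1_def Q1_def Y_def
    by (intro local_lift.intro refl)
  then show ?thesis by blast
qed

section \<open>Recentering polynomials and power series at an integer\<close>

abbreviation cpoly :: "int poly \<Rightarrow> complex poly" where
  "cpoly \<equiv> map_poly of_int"

lemma ring_map_cpoly: "ring_map cpoly"
  by (rule ring_map_map_poly[OF ring_map_of_int])

lemma cpoly_smult: "cpoly (smult c p) = smult (of_int c) (cpoly p)"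
  by (rule poly_eqI) (simp add: coeff_map_poly)

lemma cpoly_pcompose: "cpoly (pcompose p q) = pcompose (cpoly p) (cpoly q)"
proof (induction p)
  case (pCons a p)
  interpret ring_map cpoly by (rule ring_map_cpoly)
  have "cpoly [:a:] = [:of_int a:]" by (simp add: map_poly_pCons)
  then show ?case using pCons.IH by (simp add: pcompose_pCons map_poly_pCons add mult)
qed simp

lemma cpoly_pderiv: "cpoly (pderiv p) = pderiv (cpoly p)"
  by (rule poly_eqI) (simp add: coeff_map_poly coeff_pderiv)

lemma degree_cpoly: "degree (cpoly p) = degree p"
  by (rule degree_map_poly) simp

text \<open>
  \<open>recenter t m \<phi>\<close> is \<open>t\<^sup>m \<phi>((1 + v) / t)\<close> as a polynomial in \<open>v\<close>; it has integer coefficients as soon as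
  \<open>m\<close> is at least the degree of \<open>\<phi>\<close>.
\<close>

definition recenter :: "nat \<Rightarrow> nat \<Rightarrow> int poly \<Rightarrow> int poly" where
  "recenter t m \<phi> = (\<Sum>i\<le>m. smult (coeff \<phi> i * int t ^ (m - i)) ([:1, 1:] ^ i))"

lemma poly_recenter:
  fixes v :: complex
  assumes "degree \<phi> \<le> m" "t > 0"
  shows "poly (cpoly (recenter t m \<phi>)) v = of_nat t ^ m * poly (cpoly \<phi>) ((1 + v) / of_nat t)"
proof -
  interpret ring_map cpoly by (rule ring_map_cpoly)
  have c11: "cpoly [:1, 1:] = [:1, 1:]" by (simp add: map_poly_pCons)
  have "cpoly (recenter t m \<phi>) = (\<Sum>i\<le>m. smult (of_int (coeff \<phi> i * int t ^ (m - i))) ([:1, 1:] ^ i))"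
    unfolding recenter_def by (simp only: sum cpoly_smult power c11)
  then have "poly (cpoly (recenter t m \<phi>)) v = (\<Sum>i\<le>m. of_int (coeff \<phi> i) * of_nat t ^ (m - i) * (1 + v) ^ i)"
    by (simp add: poly_sum poly_power)
  also have "\<dots> = (\<Sum>i\<le>m. of_nat t ^ m * (of_int (coeff \<phi> i) * ((1 + v) / of_nat t) ^ i))"
  proof (rule sum.cong)
    fix i assume "i \<in> {..m}"
    then have "(of_nat t :: complex) ^ m = of_nat t ^ (m - i) * of_nat t ^ i"
      by (simp add: power_add[symmetric])
    then show "of_int (coeff \<phi> i) * of_nat t ^ (m - i) * (1 + v) ^ i
        = of_nat t ^ m * (of_int (coeff \<phi> i) * ((1 + v) / of_nat t) ^ i)"
      using assms(2) by (simp add: power_divide)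
  qed simp
  also have "\<dots> = of_nat t ^ m * (\<Sum>i\<le>m. of_int (coeff \<phi> i) * ((1 + v) / of_nat t) ^ i)"
    by (simp only: sum_distrib_left)
  also have "(\<Sum>i\<le>m. of_int (coeff \<phi> i) * ((1 + v) / of_nat t) ^ i) = poly (cpoly \<phi>) ((1 + v) / of_nat t)"
    unfolding poly_altdef degree_cpoly
    by (rule sum.mono_neutral_cong_right) (use assms(1) in \<open>auto simp: coeff_map_poly coeff_eq_0\<close>)
  finally show ?thesis .
qed

lemma wsum_sum: "r \<ge> 0 \<Longrightarrow> wsum N r (\<Sum>i\<in>I. F i) \<le> (\<Sum>i\<in>I. wsum N r (F i))"
proof (induction I rule: infinite_finite_induct)
  case (insert x I)
  then show ?case using wsum_add[of r N "F x" "\<Sum>i\<in>I. F i"] by simp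
qed (simp_all add: wsum_def)

lemma recenter_size:
  assumes H: "\<And>i. \<bar>real_of_int (coeff \<phi> i)\<bar> \<le> H" and t: "2 \<le> t"
  shows "wsum N 1 (fps_of_poly (cpoly (recenter t m \<phi>))) \<le> H * (m + 1) * t ^ m"
proof -
  interpret ring_map cpoly by (rule ring_map_cpoly)
  have c11: "cpoly [:1, 1:] = [:1, 1:]" by (simp add: map_poly_pCons)
  have H0: "H \<ge> 0" using H[of 0] by linarith
  have lin: "wsum N 1 (fps_of_poly [:1, 1 :: complex:]) \<le> 2"
  proof -
    have "wsum N 1 (1 + fps_X :: complex fps) \<le> wsum N 1 (1 :: complex fps) + wsum N 1 (fps_X :: complex fps)"
      by (rule wsum_add) simp
    also have "\<dots> \<le> 1 + 1"
      using wsum_const[of N 1 "1 :: complex"] wsum_X[of 1 N, where ?'a = complex] by simp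
    finally show ?thesis by (simp add: fps_of_poly_pCons)
  qed
  have "cpoly (recenter t m \<phi>) = (\<Sum>i\<le>m. smult (of_int (coeff \<phi> i * int t ^ (m - i))) ([:1, 1:] ^ i))"
    unfolding recenter_def by (simp only: sum cpoly_smult power c11)
  then have "fps_of_poly (cpoly (recenter t m \<phi>)) = (\<Sum>i\<le>m. fps_const (of_int (coeff \<phi> i * int t ^ (m - i))) * fps_of_poly [:1, 1:] ^ i)"
    by (simp only: fps_of_poly_sum fps_of_poly_smult fps_of_poly_power)
  then have "wsum N 1 (fps_of_poly (cpoly (recenter t m \<phi>)))
      \<le> (\<Sum>i\<le>m. wsum N 1 (fps_const (of_int (coeff \<phi> i * int t ^ (m - i))) * fps_of_poly [:1, 1 :: complex:] ^ i))"
    by (simp only:) (rule wsum_sum, simp)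
  also have "\<dots> \<le> (\<Sum>i\<le>m. H * t ^ m)"
  proof (rule sum_mono)
    fix i assume i: "i \<in> {..m}"
    have "wsum N 1 (fps_of_poly [:1, 1 :: complex:] ^ i) \<le> wsum N 1 (fps_of_poly [:1, 1 :: complex:]) ^ i"
      by (rule wsum_power) simp
    also have "\<dots> \<le> 2 ^ i" by (intro power_mono lin wsum_nonneg) simp
    finally have p: "wsum N 1 (fps_of_poly [:1, 1 :: complex:] ^ i) \<le> 2 ^ i" .
    have "wsum N 1 (fps_const (of_int (coeff \<phi> i * int t ^ (m - i))) * fps_of_poly [:1, 1 :: complex:] ^ i)
        = \<bar>real_of_int (coeff \<phi> i)\<bar> * real t ^ (m - i) * wsum N 1 (fps_of_poly [:1, 1 :: complex:] ^ i)"
      unfolding wsum_const_mult by (simp add: norm_mult norm_power)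
    also have "\<dots> \<le> H * real t ^ (m - i) * real t ^ i"
      using H t order_trans[OF p power_mono[of 2 "real t" i]] H0
      by (intro mult_mono wsum_nonneg) simp_all
    also have "\<dots> = H * t ^ m" using i by (simp add: mult.assoc power_add[symmetric])
    finally show "wsum N 1 (fps_const (of_int (coeff \<phi> i * int t ^ (m - i))) * fps_of_poly [:1, 1 :: complex:] ^ i) \<le> H * t ^ m" .
  qed
  finally show ?thesis by (simp add: mult_ac)
qed

text \<open>
  The factors \<open>D\<^sup>i\<close> come from the substitution \<open>v \<mapsto> D v\<close> and are compensated by the weight \<open>r\<close>.
\<close>

lemma wsum_scaled_le:
  fixes F G :: "complex fps" and D r :: real
  assumes FG: "\<And>i. norm (F $ i) \<le> D ^ i * norm (G $ (i + k))" and r: "0 \<le> r" "D * r \<le> 1" "0 \<le> D"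
    and G: "\<And>N. wsum N 1 G \<le> K"
  shows "wsum N r F \<le> K"
proof -
  have "wsum N r F \<le> wsum N 1 (fps_shift k G)"
    unfolding wsum_def
  proof (rule sum_mono)
    fix i
    have "norm (F $ i) * r ^ i \<le> D ^ i * norm (G $ (i + k)) * r ^ i"
      using FG r by (intro mult_right_mono) simp_all
    also have "\<dots> = (D * r) ^ i * norm (G $ (i + k))" by (simp add: power_mult_distrib)
    also have "\<dots> \<le> 1 * norm (G $ (i + k))"
      using r by (intro mult_right_mono power_le_one) simp_all
    finally show "norm (F $ i) * r ^ i \<le> norm (fps_shift k G $ i) * 1 ^ i" by simp
  qed
  also have "wsum N 1 (fps_shift k G) = (\<Sum>i\<in>{k..N + k}. norm (G $ i))"
    unfolding wsum_def
    by (rule sum.reindex_bij_witness[of _ "\<lambda>i. i - k" "\<lambda>i. i + k"]) auto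
  also have "\<dots> \<le> wsum (N + k) 1 G"
    unfolding wsum_def by (simp, rule sum_mono2) auto
  also have "\<dots> \<le> K" by (rule G)
  finally show ?thesis .
qed

lemma poly_has_fps_expansion: "poly p has_fps_expansion fps_of_poly p" for p :: "complex poly"
proof (induction p)
  case (pCons a p)
  have "(\<lambda>x. a + x * poly p x) has_fps_expansion fps_const a + fps_X * fps_of_poly p"
    by (intro has_fps_expansion_add has_fps_expansion_const has_fps_expansion_mult has_fps_expansion_fps_X pCons.IH)
  moreover have e: "poly (pCons a p) = (\<lambda>x. a + x * poly p x)" by auto
  moreover have e': "fps_of_poly (pCons a p) = fps_const a + fps_X * fps_of_poly p"
    by (simp add: fps_of_poly_pCons mult.commute)
  ultimately show ?case unfolding e e' by blast
qed (simp add: has_fps_expansion_0)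

text \<open>
  The cubic is homogeneous when \<open>p\<close>, \<open>q\<close> and the root have the weights \<open>2\<close>, \<open>3\<close> and \<open>1\<close>; the factor \<open>l\<close> is the
  inner derivative of a linear substitution.
\<close>

lemma wronskian_scale:
  fixes P Q P' Q' A B A' B' u K l :: "'a :: idom"
  shows "wronskian (u ^ 2 * P) (u ^ 3 * Q) (u ^ 2 * l * P') (u ^ 3 * l * Q') (u * K * A) (K * B) (u * K * l * A') (K * l * B')
    = u ^ 7 * K ^ 2 * l * wronskian P Q P' Q' A B A' B'"
  unfolding wronskian_def con_defs by Groebner_Basis.algebra

lemma ring_map_pcompose: "ring_map (\<lambda>p. pcompose p q)"
  by unfold_locales (simp_all add: pcompose_add pcompose_mult pcompose_1)

lemma conv_radius_geometric:
  fixes F :: "complex fps"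
  assumes F: "\<And>n. norm (F $ n) \<le> K * c ^ n" and c: "c > 0"
  shows "fps_conv_radius F \<ge> ereal (1 / c)"
  unfolding fps_conv_radius_def
proof (rule conv_radius_geI_ex')
  fix r :: real assume r: "0 < r" "ereal r < ereal (1 / c)"
  then have cr: "c * r < 1" using c by (simp add: field_simps)
  show "summable (\<lambda>n. F $ n * of_real r ^ n)"
  proof (rule summable_comparison_test')
    show "summable (\<lambda>n. K * (c * r) ^ n)"
      using cr c r by (intro summable_mult summable_geometric) simp
    show "norm (F $ n * of_real r ^ n) \<le> K * (c * r) ^ n" for n
      using mult_right_mono[OF F[of n], of "r ^ n"] r
      by (simp add: norm_mult norm_power power_mult_distrib mult.assoc)
  qed
qed

text \<open>
  The tail of a series with coefficients \<open>K c\<^sup>n\<close> is dominated by twice its first term when \<open>2 c \<rho> \<le> 1\<close>.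
\<close>

lemma eval_fps_small:
  fixes F :: "complex fps" and u :: complex
  assumes F: "\<And>n. norm (F $ n) \<le> K * c ^ n" and z: "\<And>n. n < N \<Longrightarrow> F $ n = 0"
    and c: "c > 0" and K: "K \<ge> 0" and u: "norm u \<le> \<rho>" "2 * c * \<rho> \<le> 1"
  shows "norm (eval_fps F u) \<le> 2 * K * (2 * c * \<rho>) ^ N"
proof -
  have \<rho>: "\<rho> \<ge> 0" using u(1) norm_ge_zero[of u] by linarith
  have q0: "0 \<le> 2 * c * \<rho>" using c \<rho> by simp
  define g where "g n = K * (2 * c * \<rho>) ^ N * (1 / 2) ^ n" for n :: nat
  have b: "norm (F $ n * u ^ n) \<le> g n" for n
  proof (cases "n < N")
    case True
    then show ?thesis using z K q0 by (simp add: g_def)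
  next
    case False
    have "norm (F $ n * u ^ n) \<le> (K * c ^ n) * \<rho> ^ n"
      unfolding norm_mult norm_power using F u(1) K c by (intro mult_mono power_mono) simp_all
    also have "\<dots> = K * ((2 * c * \<rho>) ^ n * (1 / 2) ^ n)"
      by (simp add: power_mult_distrib[symmetric])
    also have "\<dots> \<le> K * ((2 * c * \<rho>) ^ N * (1 / 2) ^ n)"
      using False u(2) q0 K by (intro mult_left_mono mult_right_mono power_decreasing) simp_all
    finally show ?thesis by (simp add: g_def)
  qed
  have sg: "summable g" unfolding g_def by (intro summable_mult summable_geometric) simp
  have sn: "summable (\<lambda>n. norm (F $ n * u ^ n))"
    by (rule summable_comparison_test'[OF sg]) (use b in simp)
  have "norm (eval_fps F u) \<le> (\<Sum>n. norm (F $ n * u ^ n))"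
    unfolding eval_fps_def by (rule summable_norm[OF sn])
  also have "\<dots> \<le> suminf g" by (rule suminf_le[OF b sn sg])
  also have "suminf g = K * (2 * c * \<rho>) ^ N * (\<Sum>n. (1 / 2) ^ n)"
    unfolding g_def by (rule suminf_mult) (rule summable_geometric, simp)
  also have "(\<Sum>n. (1 / 2 :: real) ^ n) = 2" by (subst suminf_geometric) simp_all
  finally show ?thesis by (simp add: mult_ac)
qed

abbreviation cfps :: "real fps \<Rightarrow> complex fps" where
  "cfps \<equiv> map_fps of_real"

lemma ring_map_cfps: "ring_map cfps"
  by (rule ring_map_map_fps[OF ring_map_of_real])

lemma cfps_rps: "cfps (rps p) = fps_of_poly (cpoly p)"
  by (rule fps_ext) (simp add: coeff_map_poly)

text \<open>
  If \<open>|x| > 1\<close>, then \<open>|x|\<^sup>3 \<le> (|p| + |q|) |x|\<close>.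
\<close>

lemma cubic_root_bound:
  fixes x :: complex
  assumes "x ^ 3 + p * x + q = 0"
  shows "norm x \<le> 1 + norm p + norm q"
proof (rule ccontr)
  assume *: "\<not> ?thesis"
  then have x1: "norm x > 1 + norm p + norm q" by simp
  then have x: "norm x > 1" using norm_ge_zero[of p] norm_ge_zero[of q] by linarith
  have "x ^ 3 = - (p * x + q)" using assms by Groebner_Basis.algebra
  then have "norm x ^ 3 = norm (p * x + q)" by (metis norm_minus_cancel norm_power)
  also have "\<dots> \<le> norm p * norm x + norm q" using norm_triangle_ineq[of "p * x" q] by (simp add: norm_mult)
  also have "norm q \<le> norm q * norm x" using mult_left_mono[of 1 "norm x" "norm q"] x by simp
  finally have "norm x ^ 3 \<le> (norm p + norm q) * norm x" by (simp add: algebra_simps)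
  also have "\<dots> < norm x * norm x" using x1 x by (intro mult_strict_right_mono) linarith+
  also have "\<dots> \<le> norm x ^ 3" using x by (simp add: power3_eq_cube mult_le_cancel_left1)
  finally show False by simp
qed

text \<open>
  The other two roots solve \<open>x\<^sup>2 + x\<^sub>1 x + x\<^sub>1\<^sup>2 + p = 0\<close>, a quadratic equation with discriminant \<open>- (3 x\<^sub>1\<^sup>2 + 4 p)\<close>.
\<close>

lemma three_roots:
  fixes x1 p q :: complex
  assumes r: "x1 ^ 3 + p * x1 + q = 0" and D: "disc p q \<noteq> 0"
  shows "\<exists>x2 x3. x2 ^ 3 + p * x2 + q = 0 \<and> x3 ^ 3 + p * x3 + q = 0 \<and> x1 \<noteq> x2 \<and> x1 \<noteq> x3 \<and> x2 \<noteq> x3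
    \<and> 3 * x1 ^ 2 + p = (x1 - x2) * (x1 - x3)"
proof -
  define s where "s = csqrt (- (3 * x1 ^ 2 + 4 * p))"
  have s: "s ^ 2 = - (3 * x1 ^ 2 + 4 * p)" by (simp add: s_def)
  have fac: "disc p q = (3 * x1 ^ 2 + p) ^ 2 * (3 * x1 ^ 2 + 4 * p)"
    using r unfolding disc_def by Groebner_Basis.algebra
  have "3 * x1 ^ 2 + 4 * p = - (s ^ 2)" unfolding s by simp
  with fac have "disc p q = (3 * x1 ^ 2 + p) ^ 2 * (- (s ^ 2))" by simp
  with D have s0: "s \<noteq> 0" and m: "3 * x1 ^ 2 + p \<noteq> 0" by auto
  define x2 where "x2 = (- x1 + s) / 2"
  define x3 where "x3 = (- x1 - s) / 2"
  have x2: "2 * x2 = - x1 + s" and x3: "2 * x3 = - x1 - s" by (simp_all add: x2_def x3_def)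
  have "8 * (x2 ^ 3 + p * x2 + q) = 0" "8 * (x3 ^ 3 + p * x3 + q) = 0"
    using x2 x3 s r by Groebner_Basis.algebra+
  then have "x2 ^ 3 + p * x2 + q = 0" "x3 ^ 3 + p * x3 + q = 0"
    by (metis mult_eq_0_iff zero_neq_numeral)+
  moreover have "4 * ((x1 - x2) * (x1 - x3)) = 4 * (3 * x1 ^ 2 + p)"
    using x2 x3 s by Groebner_Basis.algebra
  then have d: "3 * x1 ^ 2 + p = (x1 - x2) * (x1 - x3)"
    by (metis mult_cancel_left zero_neq_numeral)
  moreover have "x2 \<noteq> x3" using x2 x3 s0 by auto
  moreover have "x1 \<noteq> x2" "x1 \<noteq> x3" using d m by auto
  ultimately show ?thesis by (intro exI[of _ x2] exI[of _ x3]) simp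
qed

lemma poly_eqI_le:
  assumes "\<And>i. i \<le> e \<Longrightarrow> coeff p i = 0" "degree p \<le> e"
  shows "p = 0"
proof (rule poly_eqI)
  fix i show "coeff p i = coeff 0 i"
    using assms by (cases "i \<le> e") (simp_all add: coeff_eq_0)
qed

section \<open>The basic inequality at one specialization\<close>

text \<open>
  At an integer \<open>t\<close> the expansion variable \<open>v\<close> with \<open>u = (1 + D\<^sup>2 v) / t\<close> makes every coefficient of the
  recentered approximation integral. If the Wronskian has order at most \<open>e\<close> at \<open>u = 1 / t\<close>, one of the
  first \<open>e + 2\<close> Taylor coefficients gives a linear form independent of \<open>x - \<xi> y\<close>.
\<close>

lemma basic_inequality:
  fixes f2 f3 A B :: "int poly" and \<eta> :: "real fps" and t d k R e :: nat and H E C T :: real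
    and x y :: int
  assumes root: "\<eta> ^ 3 + rps f2 * \<eta> + rps f3 = 0"
    and deg: "degree f2 \<le> 2 * d" "degree f3 \<le> 3 * d"
    and H: "\<And>i. \<bar>real_of_int (coeff f2 i)\<bar> \<le> H" "\<And>i. \<bar>real_of_int (coeff f3 i)\<bar> \<le> H"
    and E: "E \<ge> 1" "\<And>n. \<bar>\<eta> $ n\<bar> \<le> E ^ (n + 1)"
    and AB: "degree A \<le> k" "degree B \<le> k" "\<And>i. \<bar>real_of_int (coeff A i)\<bar> \<le> C" "\<And>i. \<bar>real_of_int (coeff B i)\<bar> \<le> C"
    and h0: "\<And>n. n \<le> k + R \<Longrightarrow> (rps A - rps B * \<eta>) $ n = 0"
    and hs: "\<And>n. \<bar>(rps A - rps B * \<eta>) $ n\<bar> \<le> C * E ^ (n + 1)"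
    and W: "wronskian f2 f3 (pderiv f2) (pderiv f3) A B (pderiv A) (pderiv B) \<noteq> 0"
      "degree (wronskian f2 f3 (pderiv f2) (pderiv f3) A B (pderiv A) (pderiv B)) \<le> k + R + e"
      "\<And>i. i < k + R \<Longrightarrow> coeff (wronskian f2 f3 (pderiv f2) (pderiv f3) A B (pderiv A) (pderiv B)) i = 0"
    and t: "4 * E \<le> t" 
    and D: "disc (coeff (recenter t (2 * d) f2) 0) (coeff (recenter t (3 * d) f3) 0) \<noteq> 0"
    and T: "4 \<le> T" "1 + \<bar>real_of_int (coeff (recenter t (2 * d) f2) 0)\<bar> + \<bar>real_of_int (coeff (recenter t (3 * d) f3) 0)\<bar> \<le> T"
      "\<bar>real_of_int (disc (coeff (recenter t (2 * d) f2) 0) (coeff (recenter t (3 * d) f3) 0))\<bar> \<le> T"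
      "H * (3 * d + 1) * t ^ (3 * d) \<le> T"
    and y: "y \<noteq> 0"
  defines "\<xi> \<equiv> real t ^ d * (\<Sum>n. \<eta> $ n * (1 / real t) ^ n)"
  shows "\<xi> ^ 3 + of_int (coeff (recenter t (2 * d) f2) 0) * \<xi> + of_int (coeff (recenter t (3 * d) f3) 0) = 0 \<and>
    1 \<le> \<bar>of_int y\<bar> * (8 * C * E * (4 * E / t) ^ (k + R + 1) * t ^ (k + d) * T ^ (19 * (e + 1)))
      + C * (k + d + 1) * t ^ (k + d) * T ^ (11 + 19 * (e + 1)) * \<bar>of_int x - \<xi> * of_int y\<bar>"
proof -
  define p0 where "p0 = coeff (recenter t (2 * d) f2) 0"
  define q0 where "q0 = coeff (recenter t (3 * d) f3) 0"
  define \<Delta> where "\<Delta> = disc p0 q0"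
  note D = D[folded p0_def q0_def, folded \<Delta>_def] and T = T[folded p0_def q0_def, folded \<Delta>_def]
  have t4: "4 \<le> real t" using t E(1) by linarith
  then have t0: "t > 0" and t2: "2 \<le> t" by simp_all
  have C0: "C \<ge> 0" using AB(3)[of 0] by linarith
  have H0: "H \<ge> 0" using H(1)[of 0] by linarith
  define r where "r = 1 / T ^ 19"
  have T1: "1 \<le> T" and T0: "0 < T" using T(1) by simp_all
  have r: "0 < r" "r \<le> 1 / T ^ 19" using T0 by (simp_all add: r_def)
  define S where "S = real_of_int (\<Delta> ^ 2)"
  have S1: "1 \<le> S"
  proof -
    have "1 \<le> \<Delta> ^ 2" using D by (simp add: int_one_le_iff_zero_less)
    then show ?thesis unfolding S_def by (simp only: of_int_1_le_iff)
  qed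
  have ST: "S \<le> T ^ 2"
  proof -
    have "S = \<bar>real_of_int \<Delta>\<bar> ^ 2" by (simp add: S_def)
    also have "\<dots> \<le> T ^ 2" using T(3) by (intro power_mono) simp_all
    finally show ?thesis .
  qed
  have Sr: "S * r \<le> 1 / 2"
  proof -
    have "S * r * 2 \<le> T ^ 2 * r * T" using ST r T by (intro mult_mono) simp_all
    also have "\<dots> = T ^ 3 / T ^ 19" by (simp add: r_def power_numeral_reduce)
    also have "\<dots> \<le> 1" using T1 power_increasing[of 3 19 T] T0 by simp
    finally show ?thesis by simp
  qed
  define G where "G m \<phi> = pcompose (recenter t m \<phi>) [:0, \<Delta> ^ 2:]" for m \<phi>
  have Gc: "coeff (G m \<phi>) i = (\<Delta> ^ 2) ^ i * coeff (recenter t m \<phi>) i" for m \<phi> i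
    unfolding G_def by (rule coeff_pcompose_linear)
  define p1 where "p1 = Abs_fps (\<lambda>i. (\<Delta> ^ 2) ^ i * coeff (recenter t (2 * d) f2) (Suc i))"
  define q1 where "q1 = Abs_fps (\<lambda>i. (\<Delta> ^ 2) ^ i * coeff (recenter t (3 * d) f3) (Suc i))"
  obtain z \<theta> where "local_lift p0 q0 p1 q1 z \<theta> \<Delta> [:4 * p0 ^ 2, - 9 * q0, 6 * p0:]"
    using local_lift_exists[of p0 q0 p1 q1] D unfolding \<Delta>_def by blast
  then interpret L: local_lift p0 q0 p1 q1 z \<theta> \<Delta> "[:4 * p0 ^ 2, - 9 * q0, 6 * p0:]" .
  have split0: "F = fps_const c + fps_X * fps_const \<Delta> ^ 2 * F1"
    if "F $ 0 = c" "\<And>i. F $ Suc i = \<Delta> ^ 2 * F1 $ i" for F F1 :: "int fps" and c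
  proof (rule fps_ext)
    fix n show "F $ n = (fps_const c + fps_X * fps_const \<Delta> ^ 2 * F1) $ n"
      using that by (cases n) (simp_all add: fps_const_power mult.assoc)
  qed
  have pt: "L.pt = fps_of_poly (G (2 * d) f2)" and qt: "L.qt = fps_of_poly (G (3 * d) f3)"
    unfolding L.pt_def L.qt_def
    by (rule split0[symmetric]; simp add: Gc p0_def q0_def p1_def q1_def mult.assoc)+
  have cxp: "L.cx (fps_of_poly p) = fps_of_poly (cpoly p)" for p
    unfolding L.cx_def by (rule map_fps_of_poly[OF ring_map_of_int])
  \<comment> \<open>The new variable \<open>v\<close> is given by \<open>u = (1 + \<Delta>\<^sup>2 v) / t\<close>; on the disc \<open>\<Omega>\<close> the point \<open>u\<close> stays in the region
    where \<open>\<eta>\<close> converges.\<close>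
  define U where "U v = (1 + of_real S * v) / of_nat t" for v :: complex
  have GU: "poly (cpoly (G m \<phi>)) v = of_nat t ^ m * poly (cpoly \<phi>) (U v)" if "degree \<phi> \<le> m" for m \<phi> v
  proof -
    have "poly (cpoly (G m \<phi>)) v = poly (cpoly (recenter t m \<phi>)) (of_real S * v)"
      unfolding G_def cpoly_pcompose poly_pcompose by (simp add: map_poly_pCons S_def mult.commute)
    then show ?thesis unfolding poly_recenter[OF that t0] U_def .
  qed
  have Unorm: "norm (U v) \<le> 2 / t" if "norm v \<le> 1 / S" for v
  proof -
    have "norm (1 + of_real S * v) \<le> 1 + S * norm v"
      using norm_triangle_ineq[of 1 "of_real S * v"] S1 by (simp add: norm_mult)
    also have "S * norm v \<le> 1" using that S1 by (simp add: field_simps)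
    finally show ?thesis unfolding U_def norm_divide using t0 by (simp add: divide_right_mono)
  qed
  have Unorm': "norm (U v) \<le> 3 / t" if "norm v \<le> 2 / S" for v
  proof -
    have "norm (1 + of_real S * v) \<le> 1 + S * norm v"
      using norm_triangle_ineq[of 1 "of_real S * v"] S1 by (simp add: norm_mult)
    also have "S * norm v \<le> 2" using that S1 by (simp add: field_simps)
    finally show ?thesis unfolding U_def norm_divide using t0 by (simp add: divide_right_mono)
  qed
  have rad: "ereal (3 / t) < ereal (1 / E)"
    using t t0 E(1) by (simp add: field_simps)
  define \<eta>c where "\<eta>c = cfps \<eta>"
  have \<eta>r: "fps_conv_radius \<eta>c \<ge> ereal (1 / E)"
    by (rule conv_radius_geometric[of _ E E]) (use E in \<open>simp_all add: \<eta>c_def\<close>)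
  define hc where "hc = cfps (rps A - rps B * \<eta>)"
  have hcn: "norm (hc $ n) \<le> C * E * E ^ n" for n
    using hs[of n] unfolding hc_def map_fps_nth norm_of_real by (simp only: power_add power_one_right mult_ac)
  have hr: "fps_conv_radius hc \<ge> ereal (1 / E)"
    by (rule conv_radius_geometric[OF hcn]) (use E in simp)
  interpret cf: ring_map cfps by (rule ring_map_cfps)
  have hc: "hc = fps_of_poly (cpoly A) - fps_of_poly (cpoly B) * \<eta>c"
    unfolding hc_def \<eta>c_def by (simp only: cf.hom cfps_rps)
  have \<eta>c3: "\<eta>c ^ 3 + fps_of_poly (cpoly f2) * \<eta>c + fps_of_poly (cpoly f3) = 0"
    using arg_cong[OF root, of cfps] unfolding \<eta>c_def by (simp only: cf.hom cfps_rps)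
  define f where "f = eval_fps \<eta>c"
  have rp: "fps_conv_radius (fps_of_poly p) = \<infinity>" for p :: "complex poly"
    by simp
  have inr: "ereal (norm u) < fps_conv_radius \<eta>c" if "norm u \<le> 3 / t" for u
    using that rad \<eta>r by (meson ereal_less_eq(3) le_less_trans less_le_trans)
  have hfun: "eval_fps hc u = poly (cpoly A) u - poly (cpoly B) u * f u" if "norm u \<le> 3 / t" for u
  proof -
    have *: "ereal (norm u) < fps_conv_radius (fps_of_poly (cpoly B) * \<eta>c)"
      by (rule less_le_trans[OF _ fps_conv_radius_mult]) (use inr[OF that] in simp)
    show ?thesis
      unfolding hc f_def using inr[OF that] * by (subst eval_fps_diff) (simp_all add: eval_fps_mult)
  qed
  have ffun: "f u ^ 3 + poly (cpoly f2) u * f u + poly (cpoly f3) u = 0" if "norm u \<le> 3 / t" for u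
  proof -
    have 1: "ereal (norm u) < fps_conv_radius (\<eta>c ^ 3)"
      by (rule less_le_trans[OF inr[OF that] fps_conv_radius_power])
    have 2: "ereal (norm u) < fps_conv_radius (fps_of_poly (cpoly f2) * \<eta>c)"
      by (rule less_le_trans[OF _ fps_conv_radius_mult]) (use inr[OF that] in simp)
    have 3: "ereal (norm u) < fps_conv_radius (\<eta>c ^ 3 + fps_of_poly (cpoly f2) * \<eta>c)"
      by (rule less_le_trans[OF _ fps_conv_radius_add]) (use 1 2 in simp)
    have "eval_fps (\<eta>c ^ 3 + fps_of_poly (cpoly f2) * \<eta>c + fps_of_poly (cpoly f3)) u
        = f u ^ 3 + poly (cpoly f2) u * f u + poly (cpoly f3) u"
      unfolding f_def using 1 2 3 inr[OF that]
      by (simp add: eval_fps_add eval_fps_mult eval_fps_power)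
    then show ?thesis unfolding \<eta>c3 by simp
  qed
  define e1 where "e1 v = of_nat t ^ d * f (U v)" for v
  define \<Omega> where "\<Omega> = ball (0 :: complex) (2 / S)"
  have \<Omega>: "open \<Omega>" "0 \<in> \<Omega>" using S1 by (simp_all add: \<Omega>_def)
  have U\<Omega>: "norm (U v) \<le> 3 / t" if "v \<in> \<Omega>" for v
    using that by (intro Unorm') (simp add: \<Omega>_def)
  have U\<Omega>_ball: "U ` \<Omega> \<subseteq> eball 0 (fps_conv_radius F)" if F: "fps_conv_radius F \<ge> ereal (1 / E)" for F :: "complex fps"
  proof
    fix w assume "w \<in> U ` \<Omega>"
    then obtain v where v: "v \<in> \<Omega>" "w = U v" by blast
    have "ereal (norm w) \<le> ereal (3 / t)" using U\<Omega>[OF v(1)] v(2) by simp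
    also have "\<dots> < ereal (1 / E)" by (rule rad)
    also have "\<dots> \<le> fps_conv_radius F" by (rule F)
    finally show "w \<in> eball 0 (fps_conv_radius F)" by (simp add: in_eball_iff)
  qed
  have Uhol: "U holomorphic_on \<Omega>" unfolding U_def using t0 by (intro holomorphic_intros) simp
  have "(f \<circ> U) holomorphic_on \<Omega>"
    unfolding f_def by (rule holomorphic_on_compose[OF Uhol holomorphic_on_eval_fps[OF U\<Omega>_ball[OF \<eta>r]]])
  then have fhol: "(\<lambda>v. f (U v)) holomorphic_on \<Omega>" by (simp add: o_def)
  define e1F where "e1F = fps_expansion e1 0"
  have e1exp: "e1 has_fps_expansion e1F"
    unfolding e1F_def using \<Omega> fhol unfolding e1_def
    by (intro has_fps_expansion_fps_expansion[of \<Omega>]) (auto intro!: holomorphic_intros)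
  have tpow: "of_nat t ^ (2 * d) = (of_nat t ^ d) ^ 2" "of_nat t ^ (3 * d) = (of_nat t ^ d :: complex) ^ 3"
    by (simp_all add: power_mult[symmetric] mult.commute)
  have e1root: "e1 v ^ 3 + poly (cpoly (G (2 * d) f2)) v * e1 v + poly (cpoly (G (3 * d) f3)) v = 0"
    if "v \<in> \<Omega>" for v
  proof -
    have "e1 v ^ 3 + poly (cpoly (G (2 * d) f2)) v * e1 v + poly (cpoly (G (3 * d) f3)) v
        = (of_nat t ^ d) ^ 3 * (f (U v) ^ 3 + poly (cpoly f2) (U v) * f (U v) + poly (cpoly f3) (U v))"
      unfolding GU[OF deg(1)] GU[OF deg(2)] e1_def tpow by (simp add: algebra_simps power2_eq_square power3_eq_cube)
    then show ?thesis using ffun[OF U\<Omega>[OF that]] by simp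
  qed
  have ev\<Omega>: "eventually (\<lambda>v. v \<in> \<Omega>) (nhds 0)" using \<Omega> by (rule eventually_nhds_in_open)
  have e1Froot: "e1F ^ 3 + L.cx L.pt * e1F + L.cx L.qt = 0"
  proof -
    have "(\<lambda>v. e1 v ^ 3 + poly (cpoly (G (2 * d) f2)) v * e1 v + poly (cpoly (G (3 * d) f3)) v)
        has_fps_expansion (e1F ^ 3 + L.cx L.pt * e1F + L.cx L.qt)"
      unfolding pt qt cxp
      by (intro has_fps_expansion_add has_fps_expansion_mult has_fps_expansion_power poly_has_fps_expansion e1exp)
    moreover have "(\<lambda>v. e1 v ^ 3 + poly (cpoly (G (2 * d) f2)) v * e1 v + poly (cpoly (G (3 * d) f3)) v)
        has_fps_expansion 0"
      using has_fps_expansion_cong[of "\<lambda>v. e1 v ^ 3 + poly (cpoly (G (2 * d) f2)) v * e1 v + poly (cpoly (G (3 * d) f3)) v" "\<lambda>v. 0" 0 0]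
        eventually_mono[OF ev\<Omega> e1root] has_fps_expansion_0 by simp
    ultimately show ?thesis by (rule fps_expansion_unique_complex)
  qed
  \<comment> \<open>The expansion of \<open>t\<^sup>d \<eta>(u)\<close> at \<open>v = 0\<close> is the lift of the real root \<open>\<xi>\<close>.\<close>
  define x1 where "x1 = e1 0"
  have e1F0: "e1F $ 0 = x1"
    using fps_nth_fps_expansion[OF e1exp, of 0] by (simp add: x1_def)
  have rootx: "L.root x1"
  proof -
    have "(e1F ^ 3 + L.cx L.pt * e1F + L.cx L.qt) $ 0 = 0" unfolding e1Froot by simp
    then show ?thesis
      unfolding L.root_def L.cx_pt L.cx_qt by (simp add: fps_nth_power_0 e1F0 fps_of_int[symmetric] power2_eq_square)
  qed
  have x1r: "x1 = of_real \<xi>"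
  proof -
    have su: "summable (\<lambda>n. \<eta> $ n * (1 / real t) ^ n)"
    proof (rule summable_comparison_test')
      have "E / t < 1" using t t0 E(1) by (simp add: field_simps)
      then show "summable (\<lambda>n. E * (E / t) ^ n)"
        using E(1) by (intro summable_mult summable_geometric) simp
      show "norm (\<eta> $ n * (1 / real t) ^ n) \<le> E * (E / t) ^ n" for n
        using mult_right_mono[OF E(2)[of n], of "(1 / real t) ^ n"]
        by (simp add: abs_mult power_divide)
    qed
    have "f (1 / of_nat t) = (\<Sum>n. of_real (\<eta> $ n * (1 / real t) ^ n))"
      unfolding f_def eval_fps_def \<eta>c_def by simp
    also have "\<dots> = of_real (\<Sum>n. \<eta> $ n * (1 / real t) ^ n)" by (rule suminf_of_real[OF su, symmetric])
    finally show ?thesis by (simp add: x1_def e1_def U_def \<xi>_def)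
  qed
  have real_root: "\<xi> ^ 3 + of_int p0 * \<xi> + of_int q0 = 0"
  proof -
    have "complex_of_real (\<xi> ^ 3 + of_int p0 * \<xi> + of_int q0) = 0"
      using rootx unfolding L.root_def x1r by simp
    then show ?thesis by (simp only: of_real_eq_0_iff)
  qed
  have cdisc: "disc (of_int p0) (of_int q0 :: complex) = of_int \<Delta>"
    unfolding \<Delta>_def by (rule ring_map.hom_disc[OF ring_map_of_int, symmetric])
  obtain x2 x3 where x23: "L.root x2" "L.root x3" "x1 \<noteq> x2" "x1 \<noteq> x3" "x2 \<noteq> x3"
    "3 * x1 ^ 2 + of_int p0 = (x1 - x2) * (x1 - x3)"
    using three_roots[OF rootx[unfolded L.root_def]] D unfolding cdisc L.root_def by auto
  have Tx: "norm x \<le> T" if "L.root x" for x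
    using cubic_root_bound[OF that[unfolded L.root_def]] T(2) by simp
  \<comment> \<open>The weight \<open>r = T\<^sup>-\<^sup>1\<^sup>9\<close> absorbs the factors \<open>\<Delta>\<^sup>2\<close> of the substitution.\<close>
  have rH: "wsum N 1 (fps_of_poly (cpoly (recenter t m \<phi>))) \<le> T"
    if "\<And>i. \<bar>real_of_int (coeff \<phi> i)\<bar> \<le> H" "m \<le> 3 * d" for N m \<phi>
  proof -
    have "wsum N 1 (fps_of_poly (cpoly (recenter t m \<phi>))) \<le> H * (m + 1) * t ^ m"
      by (rule recenter_size[OF that(1) t2])
    also have "\<dots> \<le> H * (3 * d + 1) * t ^ (3 * d)"
      using H0 that(2) t4 by (intro mult_mono power_increasing) simp_all
    finally show ?thesis using T(4) by linarith
  qed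
  have Sr1: "S * r \<le> 1" using Sr by simp
  have S0: "0 \<le> S" using S1 by simp
  have sz1: "wsum N r (L.cx p1) \<le> T" "wsum N r (L.cx q1) \<le> T" for N
    by (rule wsum_scaled_le[OF _ less_imp_le[OF r(1)] Sr1 S0 rH[OF H(1), of "2 * d"], of _ 1];
        simp add: L.cx_def p1_def S_def coeff_map_poly norm_mult norm_power)
      (rule wsum_scaled_le[OF _ less_imp_le[OF r(1)] Sr1 S0 rH[OF H(2), of "3 * d"], of _ 1];
        simp add: L.cx_def q1_def S_def coeff_map_poly norm_mult norm_power)
  have szT: "\<bar>real_of_int p0\<bar> \<le> T" "\<bar>real_of_int q0\<bar> \<le> T" "\<bar>real_of_int \<Delta>\<bar> \<le> T"
    using T(2,3) by linarith+
  define At where "At = fps_of_poly (G (k + d) A)"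
  define Bt where "Bt = fps_of_poly (G k B)"
  define K where "K = C * (k + d + 1) * t ^ (k + d)"
  have szG: "wsum N r (L.cx (fps_of_poly (G m \<phi>))) \<le> C * (m + 1) * t ^ m"
    if "\<And>i. \<bar>real_of_int (coeff \<phi> i)\<bar> \<le> C" for N m \<phi>
    by (rule wsum_scaled_le[OF _ less_imp_le[OF r(1)] Sr1 S0 recenter_size[OF that t2, where m = m], where k = 0])
      (simp add: cxp coeff_map_poly Gc norm_mult norm_power S_def)
  have szA: "wsum N r (L.cx At) \<le> K" for N
    unfolding At_def K_def using szG[OF AB(3), of N "k + d"] by simp
  have szB: "wsum N r (L.cx Bt) \<le> K" for N
  proof -
    have "C * (k + 1) * t ^ k \<le> K"
      unfolding K_def using C0 t4 by (intro mult_mono power_increasing) simp_all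
    then show ?thesis unfolding Bt_def using szG[OF AB(4), of N k] by linarith
  qed
  \<comment> \<open>Since \<open>A - B \<eta>\<close> vanishes to order \<open>k + R + 1\<close> at \<open>u = 0\<close>, it is small on the circle \<open>|v| = 1 / \<Delta>\<^sup>2\<close>, and Cauchy's
    inequality carries this over to the Taylor coefficients at \<open>u = 1 / t\<close>.\<close>
  define M where "M = real t ^ (k + d) * (2 * (C * E) * (4 * E / t) ^ (k + R + 1))"
  define Hf where "Hf v = of_nat t ^ (k + d) * eval_fps hc (U v)" for v
  have Hf: "Hf v = poly (cpoly (G (k + d) A)) v - poly (cpoly (G k B)) v * e1 v" if "v \<in> \<Omega>" for v
  proof -
    have "degree A \<le> k + d" using AB(1) by simp
    then show ?thesis
      unfolding Hf_def hfun[OF U\<Omega>[OF that]] GU[OF \<open>degree A \<le> k + d\<close>] GU[OF AB(2)] e1_def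
      by (simp add: algebra_simps power_add)
  qed
  define HF where "HF = L.cx At - L.cx Bt * e1F"
  have HFexp: "Hf has_fps_expansion HF"
  proof -
    have "(\<lambda>v. poly (cpoly (G (k + d) A)) v - poly (cpoly (G k B)) v * e1 v) has_fps_expansion HF"
      unfolding HF_def At_def Bt_def cxp
      by (intro has_fps_expansion_diff has_fps_expansion_mult poly_has_fps_expansion e1exp)
    moreover have "eventually (\<lambda>v. Hf v = poly (cpoly (G (k + d) A)) v - poly (cpoly (G k B)) v * e1 v) (nhds 0)"
      by (rule eventually_mono[OF ev\<Omega> Hf])
    ultimately show ?thesis by (simp only: has_fps_expansion_cong[OF _ refl])
  qed
  have "(eval_fps hc \<circ> U) holomorphic_on \<Omega>"
    by (rule holomorphic_on_compose[OF Uhol holomorphic_on_eval_fps[OF U\<Omega>_ball[OF hr]]])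
  then have Hhol: "Hf holomorphic_on \<Omega>" unfolding Hf_def o_def by (intro holomorphic_intros)
  have CE: "0 \<le> C * E" using C0 E(1) by simp
  have Hb: "norm (Hf v) \<le> M" if "norm v \<le> 1 / S" for v
  proof -
    have u: "2 * E * (2 / t) \<le> 1" using t t0 by (simp add: field_simps)
    have "norm (eval_fps hc (U v)) \<le> 2 * (C * E) * (2 * E * (2 / t)) ^ (k + R + 1)"
    proof (rule eval_fps_small[OF _ _ _ CE Unorm[OF that] u])
      show "norm (hc $ n) \<le> C * E * E ^ n" for n by (rule hcn)
      show "hc $ n = 0" if "n < k + R + 1" for n
      using h0[of n] that unfolding hc_def map_fps_nth by simp
      show "E > 0" using E by simp
    qed
    then have *: "norm (eval_fps hc (U v)) \<le> 2 * (C * E) * (4 * E / t) ^ (k + R + 1)" by simp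
    show ?thesis
      unfolding Hf_def M_def norm_mult norm_power norm_of_nat by (rule mult_left_mono[OF *]) simp
  qed
  have HFc: "norm (HF $ n) \<le> M * S ^ n" for n
  proof -
    have "norm ((deriv ^^ n) Hf 0) \<le> fact n * M / (1 / S) ^ n"
    proof (rule Cauchy_inequality)
      have sub: "cball 0 (1 / S) \<subseteq> \<Omega>" using S1 by (auto simp: \<Omega>_def field_simps)
      show "Hf holomorphic_on ball 0 (1 / S)"
        by (rule holomorphic_on_subset[OF Hhol]) (use sub in auto)
      show "continuous_on (cball 0 (1 / S)) Hf"
        by (rule holomorphic_on_imp_continuous_on[OF holomorphic_on_subset[OF Hhol sub]])
      show "0 < 1 / S" using S1 by simp
      show "norm (Hf v) \<le> M" if "norm (0 - v) = 1 / S" for v using Hb[of v] that by simp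
    qed
    then have "norm (HF $ n) \<le> M / (1 / S) ^ n"
      unfolding fps_nth_fps_expansion[OF HFexp] norm_divide by (simp add: field_simps)
    then show ?thesis by (simp add: power_divide)
  qed
  have M0: "0 \<le> M" using order_trans[OF norm_ge_zero HFc[of 0]] by simp
  have szH: "wsum N r HF \<le> 2 * M" for N
  proof -
    have "wsum N r HF \<le> (\<Sum>i\<le>N. M * (1 / 2) ^ i)"
      unfolding wsum_def
    proof (rule sum_mono)
      fix i
      have "norm (HF $ i) * r ^ i \<le> M * S ^ i * r ^ i" using HFc r by (intro mult_right_mono) simp_all
      also have "\<dots> = M * (S * r) ^ i" by (simp add: power_mult_distrib)
      also have "\<dots> \<le> M * (1 / 2) ^ i" using Sr S0 r M0 by (intro mult_left_mono power_mono) simp_all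
      finally show "norm (HF $ i) * r ^ i \<le> M * (1 / 2) ^ i" .
    qed
    also have "\<dots> = M * (\<Sum>i\<le>N. (1 / 2) ^ i)" by (simp only: sum_distrib_left)
    also have "\<dots> \<le> M * 2"
    proof (rule mult_left_mono[OF _ M0])
      have "(\<Sum>i<Suc N. (1 / 2 :: real) ^ i) = ((1 / 2) ^ Suc N - 1) / (1 / 2 - 1)"
        by (rule geometric_sum) simp
      then show "(\<Sum>i\<le>N. (1 / 2 :: real) ^ i) \<le> 2" unfolding lessThan_Suc_atMost by simp
    qed
    finally show ?thesis by simp
  qed
  have e1\<eta>: "e1F = L.\<eta> x1" by (rule L.eta_unique[OF rootx e1Froot e1F0])
  \<comment> \<open>Without its factor \<open>u\<^sup>k\<^sup>+\<^sup>R\<close> the Wronskian has degree at most \<open>e\<close>, so it cannot vanish to order \<open>e + 1\<close> at \<open>u = 1 / t\<close>.\<close>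
  obtain a b where ab: "\<And>i x. L.root x \<Longrightarrow> L.ev x (L.V At Bt) $ i = of_int (a i) - of_int (b i) * x"
    using L.integral_linear_forms[OF rootx x23(1,2,3,4,5), of At Bt] by blast
  define Wt where "Wt = wronskian L.pt L.qt (fps_deriv L.pt) (fps_deriv L.qt) At Bt (fps_deriv At) (fps_deriv Bt)"
  have Wt: "\<not> agree (e + 1) Wt 0"
  proof
    assume ag: "agree (e + 1) Wt 0"
    define l where "l = [:of_real S / of_nat t :: complex:]"
    define Lp where "Lp = [:1 / of_nat t, of_real S / of_nat t :: complex:]"
    define u where "u = [:of_nat t ^ d :: complex:]"
    define c where "c = [:of_nat t ^ k :: complex:]"
    have GL: "cpoly (G m \<phi>) = smult (of_nat t ^ m) (pcompose (cpoly \<phi>) Lp)" if "degree \<phi> \<le> m" for m \<phi>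
    proof -
      have "poly (cpoly (G m \<phi>)) = poly (smult (of_nat t ^ m) (pcompose (cpoly \<phi>) Lp))"
        using GU[OF that] by (intro ext) (simp add: poly_pcompose Lp_def U_def add_divide_distrib mult.commute)
      then show ?thesis by (simp only: poly_eq_poly_eq_iff)
    qed
    have GLd: "cpoly (pderiv (G m \<phi>)) = smult (of_nat t ^ m) (l * pcompose (cpoly (pderiv \<phi>)) Lp)" if "degree \<phi> \<le> m" for m \<phi>
      unfolding cpoly_pderiv GL[OF that] pderiv_smult pderiv_pcompose
      by (simp add: Lp_def l_def pderiv_pCons mult.commute)
    have sm: "smult a p = [:a:] * p" for a :: complex and p by simp
    have u2: "[:of_nat t ^ (2 * d) :: complex:] = u ^ 2" and u3: "[:of_nat t ^ (3 * d) :: complex:] = u ^ 3"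
      and uc: "[:of_nat t ^ (k + d) :: complex:] = u * c"
      unfolding u_def c_def tpow by (simp_all add: poly_const_pow power_add power2_eq_square power3_eq_cube mult_ac)
    have dA: "degree A \<le> k + d" using AB(1) by simp
    define W where "W = wronskian f2 f3 (pderiv f2) (pderiv f3) A B (pderiv A) (pderiv B)"
    interpret rf: ring_map "fps_of_poly :: int poly \<Rightarrow> int fps" by (rule ring_map_fps_of_poly)
    interpret cp: ring_map cpoly by (rule ring_map_cpoly)
    interpret pc: ring_map "\<lambda>p. pcompose p Lp" by (rule ring_map_pcompose)
    have "Wt = fps_of_poly (wronskian (G (2 * d) f2) (G (3 * d) f3) (pderiv (G (2 * d) f2)) (pderiv (G (3 * d) f3))
        (G (k + d) A) (G k B) (pderiv (G (k + d) A)) (pderiv (G k B)))"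
      unfolding Wt_def pt qt At_def Bt_def fps_of_poly_pderiv[symmetric] rf.hom_wronskian ..
    then have "L.cx Wt = fps_of_poly (cpoly (wronskian (G (2 * d) f2) (G (3 * d) f3) (pderiv (G (2 * d) f2)) (pderiv (G (3 * d) f3))
        (G (k + d) A) (G k B) (pderiv (G (k + d) A)) (pderiv (G k B))))"
      by (simp only: cxp)
    also have "cpoly (wronskian (G (2 * d) f2) (G (3 * d) f3) (pderiv (G (2 * d) f2)) (pderiv (G (3 * d) f3))
        (G (k + d) A) (G k B) (pderiv (G (k + d) A)) (pderiv (G k B)))
      = wronskian (u ^ 2 * pcompose (cpoly f2) Lp) (u ^ 3 * pcompose (cpoly f3) Lp)
          (u ^ 2 * l * pcompose (cpoly (pderiv f2)) Lp) (u ^ 3 * l * pcompose (cpoly (pderiv f3)) Lp)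
          (u * c * pcompose (cpoly A) Lp) (c * pcompose (cpoly B) Lp)
          (u * c * l * pcompose (cpoly (pderiv A)) Lp) (c * l * pcompose (cpoly (pderiv B)) Lp)"
      unfolding cp.hom_wronskian GL[OF deg(1)] GL[OF deg(2)] GL[OF dA] GL[OF AB(2)]
        GLd[OF deg(1)] GLd[OF deg(2)] GLd[OF dA] GLd[OF AB(2)] sm u2 u3 uc c_def[symmetric]
      by (simp only: mult.assoc)
    also have "\<dots> = u ^ 7 * c ^ 2 * l * wronskian (pcompose (cpoly f2) Lp) (pcompose (cpoly f3) Lp)
          (pcompose (cpoly (pderiv f2)) Lp) (pcompose (cpoly (pderiv f3)) Lp)
          (pcompose (cpoly A) Lp) (pcompose (cpoly B) Lp)
          (pcompose (cpoly (pderiv A)) Lp) (pcompose (cpoly (pderiv B)) Lp)"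
      by (rule wronskian_scale)
    also have "\<dots> = u ^ 7 * c ^ 2 * l * pcompose (cpoly W) Lp"
      unfolding W_def cp.hom_wronskian pc.hom_wronskian ..
    also have "cpoly W = [:0, 1:] ^ (k + R) * poly_shift (k + R) (cpoly W)"
    proof (rule poly_eqI)
      fix n
      have "[:0, 1:] ^ (k + R) = (monom 1 (k + R) :: complex poly)" by (simp add: monom_altdef)
      then show "coeff (cpoly W) n = coeff ([:0, 1:] ^ (k + R) * poly_shift (k + R) (cpoly W)) n"
        using W(3)[of n] unfolding W_def[symmetric]
        by (simp add: coeff_monom_mult coeff_poly_shift coeff_map_poly)
    qed
    finally have cW: "L.cx Wt = fps_of_poly (pcompose (poly_shift (k + R) (cpoly W)) Lp) * fps_of_poly (u ^ 7 * c ^ 2 * l * Lp ^ (k + R))"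
      unfolding pc.mult pc.power fps_of_poly_mult[symmetric] by (simp add: pcompose_pCons mult_ac)
    have "agree (e + 1) (L.cx Wt) 0" using ag by (simp add: agree_def L.cx_def)
    moreover have "fps_of_poly (u ^ 7 * c ^ 2 * l * Lp ^ (k + R)) $ 0 \<noteq> 0"
      using t0 S1 by (simp add: u_def c_def l_def Lp_def coeff_mult_0 coeff_0_power)
    ultimately have ag0: "agree (e + 1) (fps_of_poly (pcompose (poly_shift (k + R) (cpoly W)) Lp)) 0"
      unfolding cW by (rule agree_zero_cancel)
    have dL: "degree Lp = 1" using t0 S1 by (simp add: Lp_def)
    have "degree (poly_shift (k + R) (cpoly W)) \<le> e"
    proof (rule degree_le, intro allI impI)
      fix i assume "e < i"
      then have "degree W < i + (k + R)" using W(2) unfolding W_def[symmetric] by linarith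
      then show "coeff (poly_shift (k + R) (cpoly W)) i = 0"
        by (simp add: coeff_poly_shift coeff_map_poly coeff_eq_0)
    qed
    then have "degree (pcompose (poly_shift (k + R) (cpoly W)) Lp) \<le> e"
      using dL by (simp add: degree_pcompose)
    then have "pcompose (poly_shift (k + R) (cpoly W)) Lp = 0"
      using ag0 unfolding agree_def by (intro poly_eqI_le[of e]) simp_all
    then have sh0: "poly_shift (k + R) (cpoly W) = 0"
      by (rule pcompose_eq_0) (use dL in linarith)
    have "coeff W i = 0" for i
    proof (cases "i < k + R")
      case True
      then show ?thesis using W(3)[of i] unfolding W_def[symmetric] by blast
    next
      case False
      then have "coeff (poly_shift (k + R) (cpoly W)) (i - (k + R)) = of_int (coeff W i)"
        by (simp add: coeff_poly_shift coeff_map_poly)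
      then show ?thesis unfolding sh0 by simp
    qed
    then have "W = 0" by (intro poly_eqI) simp
    then show False using W(1) unfolding W_def by simp
  qed
  have "\<exists>i\<le>e + 1. a i * y \<noteq> b i * x"
  proof (rule ccontr)
    assume *: "\<not> ?thesis"
    have "agree (e + 1) Wt 0"
      unfolding Wt_def
      by (rule L.proportional_imp_wronskian[OF rootx x23(1,3) ab _ y]) (use * in blast)+
    then show False using Wt by simp
  qed
  then obtain i where i: "i \<le> e + 1" "a i * y \<noteq> b i * x" by blast
  have big: "1 \<le> \<bar>of_int (a i * y - b i * x) :: real\<bar>"
  proof -
    have "1 \<le> \<bar>a i * y - b i * x\<bar>" using i(2) by linarith
    then show ?thesis by (simp only: of_int_abs[symmetric] of_int_1_le_iff)
  qed
  have Ti: "1 / r ^ i \<le> T ^ (19 * (e + 1))"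
  proof -
    have "1 / r ^ i = T ^ (19 * i)" by (simp add: r_def power_divide power_mult)
    also have "\<dots> \<le> T ^ (19 * (e + 1))" using i(1) T1 by (intro power_increasing) simp_all
    finally show ?thesis .
  qed
  define J where "J = T ^ (19 * (e + 1))"
  have J0: "0 \<le> J" using T0 by (simp add: J_def)
  have v1: "\<bar>of_int (a i) - of_int (b i) * \<xi>\<bar> \<le> 4 * M * J"
  proof -
    have "norm (L.ev x1 (L.V At Bt) $ i) \<le> 2 * (2 * M) / r ^ i"
      by (rule L.V_size_special[OF T(1) r szT Tx[OF rootx] sz1]) (use szH in \<open>simp add: HF_def e1\<eta>\<close>)
    also have "\<dots> = 4 * M * (1 / r ^ i)" by simp
    also have "\<dots> \<le> 4 * M * J" unfolding J_def using Ti M0 by (intro mult_left_mono) simp_all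
    finally have "norm (of_int (a i) - of_int (b i) * x1) \<le> 4 * M * J" unfolding ab[OF rootx] .
    moreover have "of_int (a i) - of_int (b i) * x1 = of_real (of_int (a i) - of_int (b i) * \<xi>)" by (simp add: x1r)
    ultimately show ?thesis by (simp only: norm_of_real)
  qed
  have K0: "0 \<le> K" using C0 by (simp add: K_def)
  have vg: "norm (of_int (a i) - of_int (b i) * x) \<le> 6 * K * T * J" if "L.root x" for x
  proof -
    have "norm (L.ev x (L.V At Bt) $ i) \<le> 2 * K * (1 + 2 * T) / r ^ i"
      by (rule L.V_size_general[OF T(1) r szT Tx[OF that] sz1 szA szB])
    also have "\<dots> = 2 * K * (1 + 2 * T) * (1 / r ^ i)" by simp
    also have "\<dots> \<le> 2 * K * (3 * T) * J"
      unfolding J_def using Ti K0 T1 r by (intro mult_mono) simp_all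
    finally show ?thesis unfolding ab[OF that] by (simp add: mult_ac)
  qed
  \<comment> \<open>The roots are separated because the discriminant is a nonzero integer; this bounds the coefficient \<open>b i\<close> in terms
    of the values of the form at two roots.\<close>
  have sep: "1 \<le> norm (x1 - x2) * (2 * T ^ 7)"
  proof -
    have "evc x1 [:4 * p0 ^ 2, - 9 * q0, 6 * p0:] * L.m0 x1 = of_int \<Delta>" by (rule L.Qm0[OF rootx])
    then have "1 \<le> norm (evc x1 [:4 * p0 ^ 2, - 9 * q0, 6 * p0:]) * norm (L.m0 x1)"
      using D by (simp flip: norm_mult)
    also have "\<dots> \<le> T ^ 6 * norm (L.m0 x1)"
      using L.Q_size[OF T(1) r szT Tx[OF rootx] sz1] by (intro mult_right_mono) simp_all
    also have "norm (L.m0 x1) = norm (x1 - x2) * norm (x1 - x3)"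
      unfolding L.m0_def x23(6) by (rule norm_mult)
    also have "T ^ 6 * (norm (x1 - x2) * norm (x1 - x3)) \<le> T ^ 6 * (norm (x1 - x2) * (2 * T))"
      using norm_triangle_ineq4[of x1 x3] Tx[OF rootx] Tx[OF x23(2)] T0
      by (intro mult_left_mono) simp_all
    finally show ?thesis by (simp add: power_numeral_reduce mult_ac)
  qed
  have bi: "\<bar>real_of_int (b i)\<bar> \<le> K * T ^ 11 * J"
  proof -
    have "of_int (b i) * (x1 - x2) = (of_int (a i) - of_int (b i) * x2) - (of_int (a i) - of_int (b i) * x1)"
      by (simp add: algebra_simps)
    then have "norm (of_int (b i) * (x1 - x2)) \<le> 6 * K * T * J + 6 * K * T * J"
      using vg[OF rootx] vg[OF x23(1)] norm_triangle_ineq4 by (smt (verit))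
    also have "6 * K * T * J + 6 * K * T * J = 12 * K * T * J" by simp
    finally have bb: "\<bar>real_of_int (b i)\<bar> * norm (x1 - x2) \<le> 12 * K * T * J"
      unfolding norm_mult norm_of_int .
    have "\<bar>real_of_int (b i)\<bar> \<le> \<bar>real_of_int (b i)\<bar> * (norm (x1 - x2) * (2 * T ^ 7))"
      using mult_left_mono[OF sep, of "\<bar>real_of_int (b i)\<bar>"] by simp
    also have "\<dots> = (\<bar>real_of_int (b i)\<bar> * norm (x1 - x2)) * (2 * T ^ 7)" by simp
    also have "\<dots> \<le> (12 * K * T * J) * (2 * T ^ 7)" using bb T0 by (intro mult_right_mono) simp_all
    also have "\<dots> = 24 * (K * J * T ^ 8)" by (simp add: power_numeral_reduce)
    also have "\<dots> \<le> T ^ 3 * (K * J * T ^ 8)"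
      using power_mono[OF T(1), of 3] K0 J0 T0 by (intro mult_right_mono) simp_all
    finally show ?thesis by (simp add: power_numeral_reduce mult_ac)
  qed
  have "1 \<le> \<bar>of_int y * (of_int (a i) - of_int (b i) * \<xi>) - of_int (b i) * (of_int x - \<xi> * of_int y)\<bar>"
    using big by (simp add: algebra_simps)
  also have "\<dots> \<le> \<bar>of_int y\<bar> * \<bar>of_int (a i) - of_int (b i) * \<xi>\<bar> + \<bar>of_int (b i)\<bar> * \<bar>of_int x - \<xi> * of_int y\<bar>"
    unfolding abs_mult[symmetric] by (rule abs_triangle_ineq4)
  also have "\<dots> \<le> \<bar>of_int y\<bar> * (4 * M * J) + K * T ^ 11 * J * \<bar>of_int x - \<xi> * of_int y\<bar>"
    using v1 bi by (intro add_mono mult_left_mono mult_right_mono) simp_all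
  also have "4 * M * J = 8 * C * E * (4 * E / t) ^ (k + R + 1) * t ^ (k + d) * T ^ (19 * (e + 1))"
    unfolding M_def J_def by simp
  also have "K * T ^ 11 * J = C * (k + d + 1) * t ^ (k + d) * T ^ (11 + 19 * (e + 1))"
    unfolding K_def J_def power_add by (simp only: mult.assoc)
  finally show ?thesis using real_root unfolding p0_def q0_def by (intro conjI)
qed

section \<open>A unit gives a power series root\<close>

lemma ring_map_const_qt: "ring_map const_qt"
  by unfold_locales (simp_all add: const_qt_def)

lemma const_qt_eq_0: "const_qt c = 0 \<longleftrightarrow> c = 0"
  by (simp add: const_qt_def)

definition dep_p :: "int poly poly \<Rightarrow> int poly" where
  "dep_p P = 9 * coeff P 1 - 3 * coeff P 2 ^ 2"

definition dep_q :: "int poly poly \<Rightarrow> int poly" where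
  "dep_q P = 27 * coeff P 0 - 9 * coeff P 2 * coeff P 1 + 2 * coeff P 2 ^ 3"

lemma depress:
  fixes x p1 p2 p3 :: "'a :: comm_ring_1"
  shows "27 * (x ^ 3 + p1 * x ^ 2 + p2 * x + p3)
    = (3 * x + p1) ^ 3 + (9 * p2 - 3 * p1 ^ 2) * (3 * x + p1) + (27 * p3 - 9 * p1 * p2 + 2 * p1 ^ 3)"
  by (simp add: algebra_simps power2_eq_square power3_eq_cube)

lemma monic_cubic_eq:
  assumes "degree P = 3" "lead_coeff P = 1"
  shows "P = [:coeff P 0, coeff P 1, coeff P 2, 1:]"
proof (rule poly_eqI)
  fix n :: nat
  consider "n = 0" | "n = 1" | "n = 2" | "n = 3" | "n > 3" by linarith
  then show "coeff P n = coeff [:coeff P 0, coeff P 1, coeff P 2, 1:] n"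
    using assms by cases (simp_all add: coeff_pCons numeral_eq_Suc coeff_eq_0 split: nat.splits)
qed

text \<open>
  A rational root of the depressed cubic gives a linear factor of \<open>P\<close> over \<open>\<rat>(T)\<close>, and Gauss' lemma applies.
\<close>

lemma no_rational_root:
  fixes P :: "int poly poly"
  assumes irr: "Factorial_Ring.irreducible P" and P: "degree P = 3" "lead_coeff P = 1" and b: "b \<noteq> 0"
  shows "a ^ 3 + dep_p P * a * b ^ 2 + dep_q P * b ^ 3 \<noteq> 0"
proof
  assume eq: "a ^ 3 + dep_p P * a * b ^ 2 + dep_q P * b ^ 3 = 0"
  define F where "F = fract_poly P"
  interpret f: ring_map to_fract by unfold_locales simp_all
  have irrF: "Factorial_Ring.irreducible F"
    using irr P(1) nonconst_poly_irreducible_iff[of P] by (simp add: F_def)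
  define u where "u = to_fract a / to_fract b"
  have b0: "to_fract b \<noteq> 0" using b by simp
  have "to_fract (a ^ 3 + dep_p P * a * b ^ 2 + dep_q P * b ^ 3) = 0" unfolding eq by simp
  then have "to_fract a ^ 3 + to_fract (dep_p P) * to_fract a * to_fract b ^ 2 + to_fract (dep_q P) * to_fract b ^ 3 = 0"
    by (simp only: f.hom)
  moreover have "to_fract a = u * to_fract b" using b0 by (simp add: u_def)
  ultimately have "to_fract b ^ 3 * (u ^ 3 + to_fract (dep_p P) * u + to_fract (dep_q P)) = 0"
    by Groebner_Basis.algebra
  then have u: "u ^ 3 + to_fract (dep_p P) * u + to_fract (dep_q P) = 0" using b0 by simp
  define x where "x = (u - to_fract (coeff P 2)) / 3"
  have 3: "(3 :: int poly fract) \<noteq> 0" "(27 :: int poly fract) \<noteq> 0"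
    using f.numeral to_fract_eq_0_iff by (metis zero_neq_numeral)+
  have "3 * x = u - to_fract (coeff P 2)"
    unfolding x_def times_divide_eq_right by (rule nonzero_mult_div_cancel_left[OF 3(1)])
  then have ux: "u = 3 * x + to_fract (coeff P 2)" by Groebner_Basis.algebra
  have "27 * (x ^ 3 + to_fract (coeff P 2) * x ^ 2 + to_fract (coeff P 1) * x + to_fract (coeff P 0)) = 0"
    unfolding depress using u unfolding ux dep_p_def dep_q_def by (simp only: f.hom)
  then have "x ^ 3 + to_fract (coeff P 2) * x ^ 2 + to_fract (coeff P 1) * x + to_fract (coeff P 0) = 0"
    using 3 by simp
  moreover have "F = [:to_fract (coeff P 0), to_fract (coeff P 1), to_fract (coeff P 2), 1:]"
    unfolding F_def by (subst monic_cubic_eq[OF P]) (simp add: map_poly_pCons)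
  ultimately have "poly F x = 0"
    by (simp add: algebra_simps power2_eq_square power3_eq_cube)
  then obtain G where G: "F = [:- x, 1:] * G" using poly_eq_0_iff_dvd[of F x] by (auto simp: dvd_def)
  have dF: "degree F = 3" using P(1) by (simp add: F_def degree_map_poly)
  have "G \<noteq> 0" using G dF by auto
  then have "degree F = 1 + degree G" unfolding G by (subst degree_mult_eq) simp_all
  then have "degree G = 2" using dF by simp
  then have "\<not> G dvd 1" by (metis dvd_imp_degree_le degree_1 not_numeral_le_zero one_neq_zero)
  moreover have "\<not> [:- x, 1:] dvd 1"
  proof
    assume "[:- x, 1:] dvd 1"
    then have "degree [:- x, 1:] \<le> degree (1 :: int poly fract poly)" by (rule dvd_imp_degree_le) simp
    then show False by simp
  qed
  ultimately show False using irreducibleD[OF irrF G] by blast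
qed

text \<open>
  A cubic with discriminant zero has the rational double root \<open>- 3 q / (2 p)\<close>, or the root \<open>0\<close> when \<open>p = 0\<close>.
\<close>

lemma disc_nonzero:
  fixes p q :: "'a :: idom"
  assumes nr: "\<And>a b. b \<noteq> 0 \<Longrightarrow> a ^ 3 + p * a * b ^ 2 + q * b ^ 3 \<noteq> 0" and 2: "(2 :: 'a) \<noteq> 0" "(27 :: 'a) \<noteq> 0"
  shows "disc p q \<noteq> 0"
proof
  assume d: "disc p q = 0"
  show False
  proof (cases "p = 0")
    case True
    then have "q = 0" using d 2 by (simp add: disc_def)
    then show False using nr[of 1 0] True by simp
  next
    case False
    have "(- 3 * q) ^ 3 + p * (- 3 * q) * (2 * p) ^ 2 + q * (2 * p) ^ 3 = - q * disc p q"
      unfolding disc_def by Groebner_Basis.algebra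
    then show False using nr[of "2 * p" "- 3 * q"] False 2 d by simp
  qed
qed

text \<open>
  An algebraic relation of degree at most two would give a rational root, by division with remainder.
\<close>

lemma cubic_independent:
  fixes y :: qt_closure and p q \<alpha> \<beta> \<kappa> :: "int poly"
  assumes y: "y ^ 3 + const_qt p * y + const_qt q = 0"
    and nr: "\<And>a b. b \<noteq> 0 \<Longrightarrow> a ^ 3 + p * a * b ^ 2 + q * b ^ 3 \<noteq> 0"
    and z: "const_qt \<alpha> + const_qt \<beta> * y + const_qt \<kappa> * y ^ 2 = 0"
  shows "\<alpha> = 0 \<and> \<beta> = 0 \<and> \<kappa> = 0"
proof -
  interpret c: ring_map const_qt by (rule ring_map_const_qt)
  have lin: "a = 0 \<and> b = 0" if ab: "const_qt a + const_qt b * y = 0" for a b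
  proof (rule ccontr)
    assume "\<not> ?thesis"
    then have b: "b \<noteq> 0" using ab by (auto simp: const_qt_eq_0 c.zero)
    have "const_qt ((- a) ^ 3 + p * (- a) * b ^ 2 + q * b ^ 3)
        = (- const_qt a) ^ 3 + const_qt p * (- const_qt a) * const_qt b ^ 2 + const_qt q * const_qt b ^ 3"
      by (simp only: c.hom)
    also have "\<dots> = 0" using ab y by Groebner_Basis.algebra
    finally show False using nr[OF b, of "- a"] by (simp add: const_qt_eq_0)
  qed
  define r1 where "r1 = \<kappa> ^ 2 * p + \<beta> ^ 2 - \<alpha> * \<kappa>"
  define r0 where "r0 = \<kappa> ^ 2 * q + \<alpha> * \<beta>"
  have "const_qt r0 + const_qt r1 * y = 0"
    unfolding r0_def r1_def c.hom using y z by Groebner_Basis.algebra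
  then have r: "r0 = 0" "r1 = 0" using lin by blast+
  have "\<beta> ^ 3 + p * \<beta> * \<kappa> ^ 2 + q * \<kappa> ^ 3 = 0"
    using r unfolding r0_def r1_def by Groebner_Basis.algebra
  then have k: "\<kappa> = 0" using nr by blast
  then have "const_qt \<alpha> + const_qt \<beta> * y = 0" using z by (simp add: c.zero)
  with lin k show ?thesis by blast
qed

text \<open>The norm of \<open>\<alpha> + \<beta> y + \<kappa> y\<^sup>2\<close> for a root \<open>y\<close> of \<open>Y\<^sup>3 + p Y + q\<close>, and the other two coefficients of its
  characteristic polynomial.\<close>

definition nrm :: "'a :: comm_ring_1 \<Rightarrow> 'a \<Rightarrow> 'a \<Rightarrow> 'a \<Rightarrow> 'a \<Rightarrow> 'a" where
  "nrm p q \<alpha> \<beta> \<kappa> = \<alpha> ^ 3 - 2 * p * \<alpha> ^ 2 * \<kappa> + p * \<alpha> * \<beta> ^ 2 + p ^ 2 * \<alpha> * \<kappa> ^ 2 + 3 * q * \<alpha> * \<beta> * \<kappa>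
     - q * \<beta> ^ 3 - p * q * \<beta> * \<kappa> ^ 2 + q ^ 2 * \<kappa> ^ 3"

definition tr :: "'a :: comm_ring_1 \<Rightarrow> 'a \<Rightarrow> 'a \<Rightarrow> 'a" where
  "tr p \<alpha> \<kappa> = 3 * \<alpha> - 2 * p * \<kappa>"

definition tr2 :: "'a :: comm_ring_1 \<Rightarrow> 'a \<Rightarrow> 'a \<Rightarrow> 'a \<Rightarrow> 'a \<Rightarrow> 'a" where
  "tr2 p q \<alpha> \<beta> \<kappa> = 3 * \<alpha> ^ 2 - 4 * p * \<alpha> * \<kappa> + p * \<beta> ^ 2 + p ^ 2 * \<kappa> ^ 2 + 3 * q * \<beta> * \<kappa>"

lemma nrm_mult:
  fixes p q :: "'a :: idom"
  shows "nrm p q (a * a' - q * (b * c' + c * b')) (a * b' + b * a' - p * (b * c' + c * b') - q * c * c')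
      (a * c' + b * b' + c * a' - p * c * c') = nrm p q a b c * nrm p q a' b' c'"
  unfolding nrm_def by (simp add: algebra_simps power2_eq_square power3_eq_cube)

lemma char_poly_root:
  fixes y p q \<alpha> \<beta> \<kappa> :: "'a :: idom"
  assumes "y ^ 3 + p * y + q = 0"
  defines "g \<equiv> \<alpha> + \<beta> * y + \<kappa> * y ^ 2"
  shows "g ^ 3 - tr p \<alpha> \<kappa> * g ^ 2 + tr2 p q \<alpha> \<beta> \<kappa> * g - nrm p q \<alpha> \<beta> \<kappa> = 0"
  using assms(1) unfolding g_def nrm_def tr_def tr2_def by Groebner_Basis.algebra

lemma nrm_shift:
  fixes p q z :: "'a :: idom"
  shows "nrm p q (\<alpha> - z) \<beta> \<kappa> = - (z ^ 3 - tr p \<alpha> \<kappa> * z ^ 2 + tr2 p q \<alpha> \<beta> \<kappa> * z - nrm p q \<alpha> \<beta> \<kappa>)"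
  unfolding nrm_def tr_def tr2_def by Groebner_Basis.algebra

text \<open>
  A nontrivial element of norm zero is a zero divisor modulo the cubic, so over a field the cubic
  has a factor in common with it, hence a linear factor. The root is found by one division step.
\<close>

lemma root_of_norm_zero:
  fixes p q a b c :: "'a :: field"
  assumes n: "nrm p q a b c = 0" and nz: "\<not> (b = 0 \<and> c = 0)"
  shows "\<exists>y. y ^ 3 + p * y + q = 0"
proof (cases "c = 0")
  case True
  then have b: "b \<noteq> 0" using nz by simp
  define y where "y = - a / b"
  have "b * y = - a" using b by (simp add: y_def)
  then have "b ^ 3 * (y ^ 3 + p * y + q) = 0"
    using n True unfolding nrm_def by Groebner_Basis.algebra
  then show ?thesis using b by auto
next
  case False
  define r1 where "r1 = c ^ 2 * p + b ^ 2 - a * c"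
  define r0 where "r0 = c ^ 2 * q + a * b"
  have res: "c * r0 ^ 2 - b * r0 * r1 + a * r1 ^ 2 = 0"
  proof -
    have "c * r0 ^ 2 - b * r0 * r1 + a * r1 ^ 2 = c ^ 2 * nrm p q a b c"
      unfolding r0_def r1_def nrm_def by Groebner_Basis.algebra
    then show ?thesis using n by simp
  qed
  show ?thesis
  proof (cases "r1 = 0")
    case True
    then have r0: "r0 = 0" using res False by simp
    define y where "y = b / c"
    have "c * y = b" using False by (simp add: y_def)
    moreover have "c ^ 2 * p = a * c - b ^ 2" "c ^ 2 * q = - (a * b)"
      using r0 True unfolding r0_def r1_def by Groebner_Basis.algebra+
    moreover have "c ^ 3 * (y ^ 3 + p * y + q) = (c * y) ^ 3 + (c ^ 2 * p) * (c * y) + c * (c ^ 2 * q)"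
      by Groebner_Basis.algebra
    ultimately have "c ^ 3 * (y ^ 3 + p * y + q) = b ^ 3 + (a * c - b ^ 2) * b + c * (- (a * b))"
      by (simp only:)
    also have "\<dots> = 0" by Groebner_Basis.algebra
    finally show ?thesis using False by auto
  next
    case r1: False
    define y where "y = - r0 / r1"
    have y: "r1 * y = - r0" using r1 by (simp add: y_def)
    then have "r1 ^ 2 * (c * y ^ 2 + b * y + a) = 0" using res by Groebner_Basis.algebra
    then have "c * y ^ 2 + b * y + a = 0" using r1 by simp
    then have "c ^ 2 * (y ^ 3 + p * y + q) = 0"
      using y unfolding r0_def r1_def by Groebner_Basis.algebra
    then show ?thesis using False by auto
  qed
qed

text \<open>
  The factor \<open>9\<close> clears the denominators that come from \<open>\<xi> = (y - P\<^sub>2) / 3\<close> in \<open>\<xi>\<^sup>2\<close>.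
\<close>

lemma Z_adjoin_reduce:
  fixes \<xi> :: qt_closure
  assumes P: "degree P = 3" "lead_coeff P = 1" and \<xi>: "eval_at P \<xi> = 0"
  defines "y \<equiv> 3 * \<xi> + const_qt (coeff P 2)"
  shows "y ^ 3 + const_qt (dep_p P) * y + const_qt (dep_q P) = 0"
    and "g \<in> Z_adjoin \<xi> \<Longrightarrow> \<exists>\<alpha> \<beta> \<kappa>. 9 * g = const_qt \<alpha> + const_qt \<beta> * y + const_qt \<kappa> * y ^ 2"
proof -
  interpret c: ring_map const_qt by (rule ring_map_const_qt)
  have "eval_at P \<xi> = \<xi> ^ 3 + const_qt (coeff P 2) * \<xi> ^ 2 + const_qt (coeff P 1) * \<xi> + const_qt (coeff P 0)"
    unfolding eval_at_def
    by (subst monic_cubic_eq[OF P]) (simp add: map_poly_pCons c.zero c.one algebra_simps power2_eq_square power3_eq_cube)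
  then have e: "\<xi> ^ 3 + const_qt (coeff P 2) * \<xi> ^ 2 + const_qt (coeff P 1) * \<xi> + const_qt (coeff P 0) = 0"
    using \<xi> by simp
  have "27 * (\<xi> ^ 3 + const_qt (coeff P 2) * \<xi> ^ 2 + const_qt (coeff P 1) * \<xi> + const_qt (coeff P 0)) = 0"
    unfolding e by simp
  then show "y ^ 3 + const_qt (dep_p P) * y + const_qt (dep_q P) = 0"
    unfolding depress y_def dep_p_def dep_q_def by (simp only: c.hom)
  assume "g \<in> Z_adjoin \<xi>"
  then obtain Q where Q: "g = eval_at Q \<xi>" by (auto simp: Z_adjoin_def)
  have "\<exists>a b d. eval_at Q \<xi> = const_qt a + const_qt b * \<xi> + const_qt d * \<xi> ^ 2"
  proof (induction Q)
    case 0
    show ?case by (intro exI[of _ 0]) (simp add: eval_at_def c.zero)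
  next
    case (pCons r Q)
    then obtain a b d where abd: "eval_at Q \<xi> = const_qt a + const_qt b * \<xi> + const_qt d * \<xi> ^ 2" by blast
    have "eval_at (pCons r Q) \<xi> = const_qt r + \<xi> * eval_at Q \<xi>"
      by (simp add: eval_at_def map_poly_pCons c.zero)
    also have "\<dots> = const_qt (r - d * coeff P 0) + const_qt (a - d * coeff P 1) * \<xi> + const_qt (b - d * coeff P 2) * \<xi> ^ 2"
      unfolding abd c.hom using e by Groebner_Basis.algebra
    finally show ?case by blast
  qed
  then obtain a b d where "g = const_qt a + const_qt b * \<xi> + const_qt d * \<xi> ^ 2" unfolding Q by blast
  then have "9 * g = const_qt (9 * a - 3 * b * coeff P 2 + d * coeff P 2 ^ 2)
      + const_qt (3 * b - 2 * d * coeff P 2) * y + const_qt d * y ^ 2"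
    unfolding c.hom y_def by Groebner_Basis.algebra
  then show "\<exists>\<alpha> \<beta> \<kappa>. 9 * g = const_qt \<alpha> + const_qt \<beta> * y + const_qt \<kappa> * y ^ 2" by blast
qed

text \<open>
  The norm is multiplicative, so the norm of the first factor divides that of \<open>81\<close>, a nonzero constant.
\<close>

lemma unit_norm_constant:
  fixes y :: qt_closure
  assumes y: "y ^ 3 + const_qt p * y + const_qt q = 0"
    and nr: "\<And>a b. b \<noteq> 0 \<Longrightarrow> a ^ 3 + p * a * b ^ 2 + q * b ^ 3 \<noteq> 0"
    and g: "(const_qt a + const_qt b * y + const_qt c * y ^ 2) * (const_qt a' + const_qt b' * y + const_qt c' * y ^ 2) = 81"
  shows "\<exists>n. n \<noteq> 0 \<and> nrm p q a b c = [:n:]"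
proof -
  interpret c: ring_map const_qt by (rule ring_map_const_qt)
  define A where "A = a * a' - q * (b * c' + c * b')"
  define B where "B = a * b' + b * a' - p * (b * c' + c * b') - q * c * c'"
  define C where "C = a * c' + b * b' + c * a' - p * c * c'"
  have "const_qt (A - 81) + const_qt B * y + const_qt C * y ^ 2 = 0"
    unfolding A_def B_def C_def c.hom using y g by Groebner_Basis.algebra
  from cubic_independent[OF y nr this] have "A = 81" "B = 0" "C = 0" by simp_all
  then have "nrm p q a b c * nrm p q a' b' c' = nrm p q 81 0 0"
    unfolding nrm_mult[symmetric] A_def B_def C_def by simp
  also have "nrm p q 81 0 0 = 81 ^ 3" by (simp add: nrm_def)
  finally have eq: "nrm p q a b c * nrm p q a' b' c' = 81 ^ 3" .
  have "(81 :: int poly) ^ 3 \<noteq> 0" by simp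
  then have n0: "nrm p q a b c \<noteq> 0" "nrm p q a' b' c' \<noteq> 0" using eq by auto
  have "(81 :: int poly) ^ 3 = [:81 ^ 3:]" by (simp add: numeral_poly poly_const_pow)
  then have "degree (nrm p q a b c) + degree (nrm p q a' b' c') = 0"
    using degree_mult_eq[OF n0] unfolding eq by simp
  then obtain n where "nrm p q a b c = [:n:]" by (auto elim: degree_eq_zeroE)
  then show ?thesis using n0 by auto
qed

subsection \<open>Expansion at infinity\<close>

text \<open>
  Expansion of a polynomial in \<open>T\<close> at \<open>T = \<infinity>\<close>, with the uniformizer \<open>u = 1 / T\<close>.
\<close>

definition iota :: "int poly \<Rightarrow> rat fls" where
  "iota p = poly (map_poly of_int p) fls_X_inv"

lemma ring_map_iota: "ring_map iota"
  unfolding iota_def by (rule ring_map_eval)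

definition rev_poly :: "nat \<Rightarrow> int poly \<Rightarrow> int poly" where
  "rev_poly m p = (\<Sum>i\<le>m. monom (coeff p (m - i)) i)"

lemma coeff_rev_poly: "coeff (rev_poly m p) i = (if i \<le> m then coeff p (m - i) else 0)"
  by (simp add: rev_poly_def coeff_sum)

lemma degree_rev_poly: "degree (rev_poly m p) \<le> m"
  by (rule degree_le) (simp add: coeff_rev_poly)

lemma rev_rev_poly: "degree p \<le> m \<Longrightarrow> rev_poly m (rev_poly m p) = p"
  by (rule poly_eqI) (auto simp: coeff_rev_poly coeff_eq_0)

abbreviation qfls :: "int poly \<Rightarrow> rat fls" where
  "qfls p \<equiv> fps_to_fls (fps_of_poly (map_poly of_int p))"

lemma ring_map_fps_to_fls: "ring_map (fps_to_fls :: rat fps \<Rightarrow> rat fls)"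
  by unfold_locales (simp_all add: fls_times_fps_to_fls)

lemma ring_map_qfls: "ring_map qfls"
  by (rule ring_map_compose[OF ring_map_fps_to_fls ring_map_compose[OF ring_map_fps_of_poly ring_map_map_poly[OF ring_map_of_int]]])

lemma X_inv_X: "fls_X_inv * fls_X = (1 :: rat fls)"
  by (simp add: fls_X_inv_times_conv_shift)

lemma iota_rev:
  assumes "degree p \<le> m"
  shows "iota p = fls_X_inv ^ m * qfls (rev_poly m p)"
proof -
  interpret q: ring_map qfls by (rule ring_map_qfls)
  have mon: "qfls (monom c i) = of_int c * fls_X ^ i" for c i
  proof -
    interpret f: ring_map "fps_to_fls :: rat fps \<Rightarrow> rat fls" by (rule ring_map_fps_to_fls)
    have "fps_of_poly (map_poly of_int (monom c i)) = (of_int c * fps_X ^ i :: rat fps)"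
      unfolding fps_of_int[symmetric] by (rule fps_ext) (simp add: coeff_map_poly fps_X_power_nth)
    then have "qfls (monom c i) = of_int c * fps_to_fls fps_X ^ i" by (simp only: f.hom)
    then show ?thesis by simp
  qed
  have "degree (map_poly (of_int :: int \<Rightarrow> rat fls) p) = degree p" by (rule degree_map_poly) simp
  then have "iota p = (\<Sum>i\<le>m. of_int (coeff p i) * fls_X_inv ^ i)"
    unfolding iota_def poly_altdef
    by (intro sum.mono_neutral_cong_left) (use assms in \<open>auto simp: coeff_map_poly coeff_eq_0\<close>)
  also have "\<dots> = (\<Sum>i\<le>m. of_int (coeff p (m - i)) * fls_X_inv ^ (m - i))"
    by (rule sum.reindex_bij_witness[of _ "\<lambda>i. m - i" "\<lambda>i. m - i"]) auto
  also have "\<dots> = (\<Sum>i\<le>m. fls_X_inv ^ m * (of_int (coeff p (m - i)) * fls_X ^ i))"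
  proof (rule sum.cong)
    fix i assume "i \<in> {..m}"
    then have "(fls_X_inv :: rat fls) ^ m = fls_X_inv ^ (m - i) * fls_X_inv ^ i"
      by (simp add: power_add[symmetric])
    then have "(fls_X_inv :: rat fls) ^ m * fls_X ^ i = fls_X_inv ^ (m - i) * (fls_X_inv * fls_X) ^ i"
      by (simp only: power_mult_distrib mult.assoc)
    then have "(fls_X_inv :: rat fls) ^ m * fls_X ^ i = fls_X_inv ^ (m - i)" unfolding X_inv_X by simp
    then show "of_int (coeff p (m - i)) * fls_X_inv ^ (m - i)
        = (fls_X_inv ^ m * (of_int (coeff p (m - i)) * fls_X ^ i) :: rat fls)"
      by (metis mult.left_commute)
  qed simp
  also have "\<dots> = fls_X_inv ^ m * qfls (rev_poly m p)"
    unfolding rev_poly_def q.sum mon sum_distrib_left ..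
  finally show ?thesis .
qed

lemma iota_subdegree:
  assumes "p \<noteq> 0"
  shows "iota p \<noteq> 0" "fls_subdegree (iota p) = - int (degree p)"
proof -
  define F where "F = (fps_of_poly (map_poly of_int (rev_poly (degree p) p)) :: rat fps)"
  have F0: "F $ 0 \<noteq> 0" using assms by (simp add: F_def coeff_map_poly coeff_rev_poly)
  then have nz: "fps_to_fls F \<noteq> 0" by auto
  have eq: "iota p = fls_X_inv ^ degree p * fps_to_fls F"
    unfolding F_def by (rule iota_rev) simp
  show "iota p \<noteq> 0" unfolding eq using nz by simp
  have "subdegree F = 0" using F0 by simp
  then show "fls_subdegree (iota p) = - int (degree p)"
    unfolding eq using nz by (simp add: fls_subdegree_fls_to_fps fls_subdegree_pow)
qed

lemma iota_eq_0: "iota p = 0 \<longleftrightarrow> p = 0"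
  using iota_subdegree(1)[of p] ring_map.zero[OF ring_map_iota] by auto

lemma positive_subdegree_fps:
  fixes f :: "rat fls"
  assumes "f = 0 \<or> fls_subdegree f > 0"
  shows "\<exists>F. fps_to_fls F = f \<and> F $ 0 = 0"
proof (intro exI conjI)
  show "fps_to_fls (fls_regpart f) = f"
    using assms by (intro fls_regpart_to_fls_trivial) auto
  show "fls_regpart f $ 0 = 0" using assms by auto
qed

text \<open>
  If \<open>\<mu>\<close> and \<open>\<nu>\<close> vanish at \<open>u = 0\<close>, then \<open>1\<close> is a simple root of the reduction \<open>W\<^sup>3 - W\<^sup>2\<close> and lifts.
\<close>

lemma hensel_unit_root:
  fixes \<mu> \<nu> :: "rat fls"
  assumes "\<mu> = 0 \<or> fls_subdegree \<mu> > 0" "\<nu> = 0 \<or> fls_subdegree \<nu> > 0"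
  shows "\<exists>w. w \<noteq> 0 \<and> w ^ 3 - w ^ 2 + \<mu> * w - \<nu> = 0"
proof -
  obtain M N where MN: "fps_to_fls M = \<mu>" "M $ 0 = 0" "fps_to_fls N = \<nu>" "N $ 0 = 0"
    using positive_subdegree_fps[OF assms(1)] positive_subdegree_fps[OF assms(2)] by blast
  obtain z where z: "z $ 0 = 0" "z = (N - M) + (- M) * z + (- 2) * z ^ 2 + (- 1) * z ^ 3"
    using cubic_fps_exists[of "N - M" "- M" "- 2" "- 1"] MN by auto
  define w where "w = 1 + z"
  have "w ^ 3 - w ^ 2 + M * w - N = z - ((N - M) + (- M) * z + (- 2) * z ^ 2 + (- 1) * z ^ 3)"
    unfolding w_def by Groebner_Basis.algebra
  also have "\<dots> = 0" using z(2) by (metis right_minus_eq)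
  finally have w: "w ^ 3 - w ^ 2 + M * w - N = 0" .
  interpret f: ring_map "fps_to_fls :: rat fps \<Rightarrow> rat fls" by (rule ring_map_fps_to_fls)
  have "fps_to_fls (w ^ 3 - w ^ 2 + M * w - N) = 0" unfolding w by simp
  then have "fps_to_fls w ^ 3 - fps_to_fls w ^ 2 + \<mu> * fps_to_fls w - \<nu> = 0"
    unfolding f.hom MN .
  moreover have "w $ 0 = 1" by (simp add: w_def z(1))
  then have "fps_to_fls w \<noteq> 0" by auto
  ultimately show ?thesis by blast
qed

text \<open>
  The Newton polygon of \<open>Z\<^sup>3 - e\<^sub>1 Z\<^sup>2 + e\<^sub>2 Z - n\<close> at infinity has a side of horizontal length one as soon
  as \<open>e\<^sub>1\<close> or \<open>e\<^sub>2\<close> is not constant: its largest or its smallest root is isolated.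
\<close>

lemma char_poly_laurent_root:
  fixes e1 e2 :: "int poly" and n :: int
  assumes n: "n \<noteq> 0" and nc: "degree e1 > 0 \<or> degree e2 > 0"
  shows "\<exists>z. z ^ 3 - iota e1 * z ^ 2 + iota e2 * z - of_int n = 0"
proof -
  have n0: "(of_int n :: rat fls) \<noteq> 0" using n by simp
  have io: "iota [:n:] = of_int n" using ring_map.of_int[OF ring_map_iota, of n] by (simp add: of_int_poly)
  have nsub: "fls_subdegree (of_int n :: rat fls) = 0"
    using iota_subdegree(2)[of "[:n:]"] n unfolding io by simp
  show ?thesis
  proof (cases "degree e2 \<le> degree e1")
    case True
    then have d1: "degree e1 > 0" using nc by linarith
    then have e10: "e1 \<noteq> 0" by auto
    define a where "a = iota e1"
    have a: "a \<noteq> 0" "fls_subdegree a = - int (degree e1)" unfolding a_def by (rule iota_subdegree[OF e10])+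
    have \<mu>: "iota e2 / a ^ 2 = 0 \<or> fls_subdegree (iota e2 / a ^ 2) > 0"
    proof (cases "e2 = 0")
      case False
      then show ?thesis
        using iota_subdegree[OF False] a True d1 by (simp add: fls_divide_subdegree fls_subdegree_pow)
    qed (simp add: iota_eq_0[THEN iffD2])
    have \<nu>: "of_int n / a ^ 3 = 0 \<or> fls_subdegree (of_int n / a ^ 3) > 0"
      using a d1 n0 nsub by (simp add: fls_divide_subdegree fls_subdegree_pow)
    obtain w where w: "w ^ 3 - w ^ 2 + iota e2 / a ^ 2 * w - of_int n / a ^ 3 = 0"
      using hensel_unit_root[OF \<mu> \<nu>] by metis
    define \<mu> where "\<mu> = iota e2 / a ^ 2"
    define \<nu> where "\<nu> = of_int n / a ^ 3"
    have "\<mu> * a ^ 2 = iota e2" "\<nu> * a ^ 3 = of_int n" using a by (simp_all add: \<mu>_def \<nu>_def)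
    moreover have "(a * w) ^ 3 - a * (a * w) ^ 2 + (\<mu> * a ^ 2) * (a * w) - \<nu> * a ^ 3 = a ^ 3 * (w ^ 3 - w ^ 2 + \<mu> * w - \<nu>)"
      by Groebner_Basis.algebra
    ultimately have "(a * w) ^ 3 - a * (a * w) ^ 2 + iota e2 * (a * w) - of_int n = 0"
      using w[folded \<mu>_def \<nu>_def] by simp
    then show ?thesis unfolding a_def by blast
  next
    case False
    then have d2: "degree e2 > degree e1" by simp
    then have e20: "e2 \<noteq> 0" by auto
    define a where "a = iota e2"
    define N where "N = (of_int n :: rat fls)"
    have a: "a \<noteq> 0" "fls_subdegree a = - int (degree e2)" unfolding a_def by (rule iota_subdegree[OF e20])+
    have \<mu>: "iota e1 * N / a ^ 2 = 0 \<or> fls_subdegree (iota e1 * N / a ^ 2) > 0"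
    proof (cases "e1 = 0")
      case False
      then show ?thesis
        using iota_subdegree[OF False] a d2 n0 nsub unfolding N_def
        by (simp add: fls_divide_subdegree fls_subdegree_pow)
    qed (simp add: iota_eq_0[THEN iffD2])
    have \<nu>: "N ^ 2 / a ^ 3 = 0 \<or> fls_subdegree (N ^ 2 / a ^ 3) > 0"
      using a d2 n0 nsub unfolding N_def by (simp add: fls_divide_subdegree fls_subdegree_pow)
    obtain w where w: "w \<noteq> 0" "w ^ 3 - w ^ 2 + iota e1 * N / a ^ 2 * w - N ^ 2 / a ^ 3 = 0"
      using hensel_unit_root[OF \<mu> \<nu>] by metis
    define \<mu> where "\<mu> = iota e1 * N / a ^ 2"
    define \<nu> where "\<nu> = N ^ 2 / a ^ 3"
    have mn: "\<mu> * a ^ 2 = iota e1 * N" "\<nu> * a ^ 3 = N ^ 2" using a by (simp_all add: \<mu>_def \<nu>_def)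
    define z where "z = N / (a * w)"
    have z: "z * (a * w) = N" using a w(1) by (simp add: z_def)
    have "(a * w) ^ 3 * (z ^ 3 - iota e1 * z ^ 2 + a * z - N)
        = (z * (a * w)) ^ 3 - iota e1 * (z * (a * w)) ^ 2 * (a * w) + a * (z * (a * w)) * (a * w) ^ 2 - N * (a * w) ^ 3"
      by Groebner_Basis.algebra
    also have "\<dots> = N * (N ^ 2 - (iota e1 * N) * (a * w) + a ^ 3 * w ^ 2 - a ^ 3 * w ^ 3)"
      unfolding z by Groebner_Basis.algebra
    also have "\<dots> = - (N * (a ^ 3 * (w ^ 3 - w ^ 2 + \<mu> * w - \<nu>)))"
      unfolding mn[symmetric] by Groebner_Basis.algebra
    also have "\<dots> = 0" using w(2)[folded \<mu>_def \<nu>_def] by simp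
    finally have "z ^ 3 - iota e1 * z ^ 2 + a * z - N = 0" using a(1) w(1) by simp
    then show ?thesis unfolding a_def N_def by blast
  qed
qed

text \<open>
  Multiplication by \<open>u\<^sup>d\<close> makes the cubic integral over \<open>\<rat>[[u]]\<close>, so the root has no pole.
\<close>

lemma laurent_root_imp_power_series:
  fixes y :: "rat fls" and p q :: "int poly"
  assumes y: "y ^ 3 + iota p * y + iota q = 0" and d: "degree p \<le> 2 * d" "degree q \<le> 3 * d"
  shows "\<exists>\<eta> :: rat fps. \<eta> ^ 3 + fps_of_poly (map_poly of_int (rev_poly (2 * d) p)) * \<eta>
    + fps_of_poly (map_poly of_int (rev_poly (3 * d) q)) = 0"
proof -
  define a where "a = (fps_of_poly (map_poly of_int (rev_poly (2 * d) p)) :: rat fps)"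
  define b where "b = (fps_of_poly (map_poly of_int (rev_poly (3 * d) q)) :: rat fps)"
  define x where "x = (fls_X ^ d :: rat fls)"
  define x' where "x' = (fls_X_inv ^ d :: rat fls)"
  have xx: "x' * x = 1" unfolding x_def x'_def power_mult_distrib[symmetric] X_inv_X by simp
  have ip: "iota p = x' ^ 2 * fps_to_fls a"
    unfolding iota_rev[OF d(1)] x'_def a_def by (simp add: power_mult[symmetric] mult.commute)
  have iq: "iota q = x' ^ 3 * fps_to_fls b"
    unfolding iota_rev[OF d(2)] x'_def b_def by (simp add: power_mult[symmetric] mult.commute)
  define h where "h = y * x"
  have h: "h ^ 3 + fps_to_fls a * h + fps_to_fls b = 0"
    using y xx unfolding ip iq h_def by Groebner_Basis.algebra
  have sub: "fls_subdegree h \<ge> 0"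
  proof (rule ccontr)
    assume neg: "\<not> ?thesis"
    then have h0: "h \<noteq> 0" by auto
    have ge: "n \<le> fls_subdegree (f + g)" if "f = 0 \<or> n \<le> fls_subdegree f" "g = 0 \<or> n \<le> fls_subdegree g" "f + g \<noteq> 0"
      for f g :: "rat fls" and n
      using fls_plus_subdegree[of f g] that by auto
    have a: "fps_to_fls a * h = 0 \<or> fls_subdegree h \<le> fls_subdegree (fps_to_fls a * h)"
      using h0 by (cases "a = 0") (simp_all add: fls_subdegree_fls_to_fps)
    have b: "fps_to_fls b = 0 \<or> fls_subdegree h \<le> fls_subdegree (fps_to_fls b)"
      using neg by (simp add: fls_subdegree_fls_to_fps)
    define s where "s = fps_to_fls a * h + fps_to_fls b"
    have h3: "h ^ 3 = - s" using h unfolding s_def by Groebner_Basis.algebra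
    have h30: "h ^ 3 \<noteq> 0" using h0 by simp
    then have "s \<noteq> 0" unfolding h3 by simp
    then have "fls_subdegree h \<le> fls_subdegree s" using ge[OF a b] unfolding s_def by blast
    also have "\<dots> = fls_subdegree (h ^ 3)" unfolding h3 by simp
    finally have "fls_subdegree h \<le> fls_subdegree (h ^ 3)" .
    then show False using neg h0 by (simp add: fls_subdegree_pow)
  qed
  define \<eta> where "\<eta> = fls_regpart h"
  have \<eta>: "fps_to_fls \<eta> = h" unfolding \<eta>_def by (rule fls_regpart_to_fls_trivial[OF sub])
  interpret f: ring_map "fps_to_fls :: rat fps \<Rightarrow> rat fls" by (rule ring_map_fps_to_fls)
  have "fps_to_fls (\<eta> ^ 3 + a * \<eta> + b) = fps_to_fls 0" using h unfolding f.hom \<eta> .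
  then have "\<eta> ^ 3 + a * \<eta> + b = 0" by (simp only: fps_to_fls_eq_iff)
  then show ?thesis unfolding a_def b_def by blast
qed

text \<open>
  The norm of the unit is constant. If the other two coefficients of its characteristic polynomial
  were constant as well, the unit would be an algebraic number. So the characteristic polynomial has
  a root in \<open>\<rat>((1/T))\<close>, and with it the cubic, whose field is generated by the unit.
\<close>

theorem power_series_root:
  fixes P :: "int poly poly" and \<xi> \<gamma> :: qt_closure
  assumes irr: "Factorial_Ring.irreducible P" and P: "degree P = 3" "lead_coeff P = 1"
    and \<xi>: "eval_at P \<xi> = 0" and \<gamma>: "unit_in (Z_adjoin \<xi>) \<gamma>" "\<not> algebraic \<gamma>"
    and d: "degree (dep_p P) \<le> 2 * d" "degree (dep_q P) \<le> 3 * d"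
  shows "\<exists>\<eta> :: rat fps. \<eta> ^ 3 + fps_of_poly (map_poly of_int (rev_poly (2 * d) (dep_p P))) * \<eta>
    + fps_of_poly (map_poly of_int (rev_poly (3 * d) (dep_q P))) = 0"
proof -
  interpret c: ring_map const_qt by (rule ring_map_const_qt)
  interpret i: ring_map iota by (rule ring_map_iota)
  define p where "p = dep_p P"
  define q where "q = dep_q P"
  define y where "y = 3 * \<xi> + const_qt (coeff P 2)"
  note red = Z_adjoin_reduce[OF P \<xi>, folded y_def p_def q_def]
  have nr: "a ^ 3 + p * a * b ^ 2 + q * b ^ 3 \<noteq> 0" if "b \<noteq> 0" for a b
    unfolding p_def q_def by (rule no_rational_root[OF irr P that])
  obtain \<gamma>' where \<gamma>': "\<gamma>' \<in> Z_adjoin \<xi>" "\<gamma> * \<gamma>' = 1" and \<gamma>Z: "\<gamma> \<in> Z_adjoin \<xi>"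
    using \<gamma>(1) unfolding unit_in_def by blast
  obtain a b k where g: "9 * \<gamma> = const_qt a + const_qt b * y + const_qt k * y ^ 2"
    using red(2)[OF \<gamma>Z] by blast
  obtain a' b' k' where g': "9 * \<gamma>' = const_qt a' + const_qt b' * y + const_qt k' * y ^ 2"
    using red(2)[OF \<gamma>'(1)] by blast
  have "(9 * \<gamma>) * (9 * \<gamma>') = 81 * (\<gamma> * \<gamma>')" by simp
  then have "(9 * \<gamma>) * (9 * \<gamma>') = 81" unfolding \<gamma>'(2) by simp
  then obtain n where n: "n \<noteq> 0" "nrm p q a b k = [:n:]"
    using unit_norm_constant[OF red(1) nr, of a b k a' b' k'] unfolding g g' by blast
  define e1 where "e1 = tr p a k"
  define e2 where "e2 = tr2 p q a b k"
  have chi: "(9 * \<gamma>) ^ 3 - const_qt e1 * (9 * \<gamma>) ^ 2 + const_qt e2 * (9 * \<gamma>) - const_qt [:n:] = 0"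
  proof -
    have "const_qt e1 = tr (const_qt p) (const_qt a) (const_qt k)"
      "const_qt e2 = tr2 (const_qt p) (const_qt q) (const_qt a) (const_qt b) (const_qt k)"
      "const_qt [:n:] = nrm (const_qt p) (const_qt q) (const_qt a) (const_qt b) (const_qt k)"
      unfolding e1_def e2_def n(2)[symmetric] by (simp_all only: tr_def tr2_def nrm_def c.hom)
    then show ?thesis unfolding g using char_poly_root[OF red(1)] by simp
  qed
  have nc: "degree e1 > 0 \<or> degree e2 > 0"
  proof (rule ccontr)
    assume "\<not> ?thesis"
    then obtain c1 c2 where c12: "e1 = [:c1:]" "e2 = [:c2:]" by (auto elim!: degree_eq_zeroE)
    have ci: "const_qt [:z:] = of_int z" for z
      using c.of_int[of z] by (simp add: of_int_poly)
    define R where "R = [:of_int (- n), of_int (9 * c2), of_int (- 81 * c1), of_int 729 :: qt_closure:]"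
    have "algebraic \<gamma>"
    proof (rule algebraicI)
      show "coeff R j \<in> \<int>" for j unfolding R_def by (auto simp: coeff_pCons split: nat.splits)
      show "R \<noteq> 0" unfolding R_def by simp
      show "poly R \<gamma> = 0"
        using chi unfolding c12 ci R_def
        by (simp add: algebra_simps power2_eq_square power3_eq_cube)
    qed
    then show False using \<gamma>(2) by blast
  qed
  obtain z where z: "z ^ 3 - iota e1 * z ^ 2 + iota e2 * z - of_int n = 0"
    using char_poly_laurent_root[OF n(1) nc] by blast
  have "nrm (iota p) (iota q) (iota a - z) (iota b) (iota k) = 0"
  proof -
    have "tr (iota p) (iota a) (iota k) = iota e1" "tr2 (iota p) (iota q) (iota a) (iota b) (iota k) = iota e2"
      "nrm (iota p) (iota q) (iota a) (iota b) (iota k) = iota [:n:]"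
      unfolding e1_def e2_def n(2)[symmetric] by (simp_all only: tr_def tr2_def nrm_def i.hom)
    moreover have "iota [:n:] = of_int n" using i.of_int[of n] by (simp add: of_int_poly)
    ultimately show ?thesis unfolding nrm_shift using z by simp
  qed
  moreover have "\<not> (iota b = 0 \<and> iota k = 0)"
  proof
    assume "iota b = 0 \<and> iota k = 0"
    then have bk: "b = 0" "k = 0" by (simp_all add: iota_eq_0)
    then have an: "a ^ 3 = [:n:]" using n(2) by (simp add: nrm_def)
    then have "a \<noteq> 0" using n(1) by auto
    then have "3 * degree a = 0" using degree_power_eq[of a 3] unfolding an by simp
    then obtain a0 where "a = [:a0:]" by (auto elim: degree_eq_zeroE)
    then have "degree e1 = 0" "degree e2 = 0"
      unfolding e1_def e2_def bk by (simp_all add: tr_def tr2_def numeral_poly poly_const_pow)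
    then show False using nc by simp
  qed
  ultimately obtain Y where "Y ^ 3 + iota p * Y + iota q = 0"
    using root_of_norm_zero by blast
  from laurent_root_imp_power_series[OF this] d show ?thesis unfolding p_def q_def by blast
qed

section \<open>The Wronskian of the approximants\<close>

lemma ring_map_rps: "ring_map rps"
  by (rule ring_map_compose[OF ring_map_fps_of_poly ring_map_map_poly[OF ring_map_of_int]])

lemma rps_eq_0: "rps p = 0 \<longleftrightarrow> p = 0"
  by (simp add: fps_eq_iff poly_eq_iff coeff_map_poly)

lemma rps_pderiv: "rps (pderiv p) = fps_deriv (rps p)"
  by (rule fps_ext) (simp add: coeff_map_poly coeff_pderiv)

lemma subdegree_rps_le: "p \<noteq> 0 \<Longrightarrow> subdegree (rps p) \<le> degree p"
  by (rule subdegree_leI) (simp add: coeff_map_poly)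

lemma qfls_eq_0: "qfls p = 0 \<longleftrightarrow> p = 0"
proof -
  have "qfls p = 0 \<longleftrightarrow> fps_of_poly (map_poly of_int p :: rat poly) = 0" by simp
  also have "\<dots> \<longleftrightarrow> p = 0" unfolding fps_eq_iff poly_eq_iff by (simp add: coeff_map_poly)
  finally show ?thesis .
qed

lemma coeff_recenter_rev: 
  assumes "degree p \<le> m"
  shows "coeff (recenter t m (rev_poly m p)) 0 = poly p (int t)"
proof -
  have c: "coeff ([:1, 1:] ^ i) 0 = (1 :: int)" for i :: nat
    by (induction i) simp_all
  have "coeff (recenter t m (rev_poly m p)) 0 = (\<Sum>i\<le>m. coeff p (m - i) * int t ^ (m - i))"
    unfolding recenter_def by (simp add: coeff_sum c coeff_rev_poly)
  also have "\<dots> = (\<Sum>i\<le>m. coeff p i * int t ^ i)"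
    by (rule sum.reindex_bij_witness[of _ "\<lambda>i. m - i" "\<lambda>i. m - i"]) auto
  also have "\<dots> = poly p (int t)"
    unfolding poly_altdef using assms
    by (intro sum.mono_neutral_right) (auto simp: coeff_eq_0)
  finally show ?thesis .
qed

text \<open>Substituting \<open>1/T\<close> for \<open>T\<close> turns a rational root of the reversed cubic into one of the original cubic.\<close>

lemma no_rational_root_rev:
  fixes p q :: "int poly"
  assumes nr: "\<And>a b. b \<noteq> 0 \<Longrightarrow> a ^ 3 + p * a * b ^ 2 + q * b ^ 3 \<noteq> 0"
    and d: "degree p \<le> 2 * d" "degree q \<le> 3 * d" and b: "b \<noteq> 0"
  shows "a ^ 3 + rev_poly (2 * d) p * a * b ^ 2 + rev_poly (3 * d) q * b ^ 3 \<noteq> 0"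
proof
  assume eq: "a ^ 3 + rev_poly (2 * d) p * a * b ^ 2 + rev_poly (3 * d) q * b ^ 3 = 0"
  interpret i: ring_map iota by (rule ring_map_iota)
  interpret q: ring_map qfls by (rule ring_map_qfls)
  define m where "m = max (degree a) (degree b)"
  define a1 where "a1 = rev_poly m a"
  define b1 where "b1 = rev_poly m b"
  have ab: "iota a = fls_X_inv ^ m * qfls a1" "iota b = fls_X_inv ^ m * qfls b1"
    unfolding a1_def b1_def by (rule iota_rev, simp add: m_def)+
  have pq: "iota (rev_poly (2 * d) p) = (fls_X_inv ^ d) ^ 2 * qfls p"
      "iota (rev_poly (3 * d) q) = (fls_X_inv ^ d) ^ 3 * qfls q"
    using iota_rev[OF degree_rev_poly, of "2 * d" p] iota_rev[OF degree_rev_poly, of "3 * d" q]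
    by (simp_all only: rev_rev_poly d power_mult[symmetric] mult.commute[of d])
  have "b1 \<noteq> 0"
  proof
    assume "b1 = 0"
    then have "iota b = 0" using ab(2) q.zero by simp
    then show False using b iota_eq_0 by simp
  qed
  define x where "x = (fls_X ^ d :: rat fls)"
  define x' where "x' = (fls_X_inv ^ d :: rat fls)"
  define v where "v = (fls_X_inv ^ m :: rat fls)"
  have xx: "x' * x = 1" unfolding x_def x'_def power_mult_distrib[symmetric] X_inv_X by simp
  have v0: "v \<noteq> 0" by (simp add: v_def)
  have x: "x = qfls (monom 1 d)"
  proof -
    interpret f: ring_map "fps_to_fls :: rat fps \<Rightarrow> rat fls" by (rule ring_map_fps_to_fls)
    have "qfls (monom 1 d) = fps_to_fls (fps_X ^ d)" by (simp add: map_poly_monom fps_of_poly_monom)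
    also have "\<dots> = x" unfolding x_def f.power by simp
    finally show ?thesis ..
  qed
  have "iota (a ^ 3 + rev_poly (2 * d) p * a * b ^ 2 + rev_poly (3 * d) q * b ^ 3) = 0"
    unfolding eq by (rule i.zero)
  then have "(v * qfls a1) ^ 3 + x' ^ 2 * qfls p * (v * qfls a1) * (v * qfls b1) ^ 2 + x' ^ 3 * qfls q * (v * qfls b1) ^ 3 = 0"
    unfolding i.hom pq ab x'_def v_def .
  then have "v ^ 3 * ((x * qfls a1) ^ 3 + qfls p * (x * qfls a1) * qfls b1 ^ 2 + qfls q * qfls b1 ^ 3) = 0"
    using xx by Groebner_Basis.algebra
  then have "(x * qfls a1) ^ 3 + qfls p * (x * qfls a1) * qfls b1 ^ 2 + qfls q * qfls b1 ^ 3 = 0"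
    using v0 by simp
  then have "qfls ((monom 1 d * a1) ^ 3 + p * (monom 1 d * a1) * b1 ^ 2 + q * b1 ^ 3) = 0"
    unfolding x q.hom .
  then have "(monom 1 d * a1) ^ 3 + p * (monom 1 d * a1) * b1 ^ 2 + q * b1 ^ 3 = 0"
    unfolding qfls_eq_0 .
  then show False using nr[OF \<open>b1 \<noteq> 0\<close>] by blast
qed

lemma degree_mult_le': "degree p \<le> m \<Longrightarrow> degree q \<le> n \<Longrightarrow> m + n \<le> k \<Longrightarrow> degree (p * q :: int poly) \<le> k"
  using degree_mult_le[of p q] by linarith

lemma degree_numeral_mult: "degree p \<le> n \<Longrightarrow> degree (numeral c * p :: int poly) \<le> n"
  by (rule degree_mult_le'[of _ 0]) simp_all

lemma degree_power_le': "degree p \<le> n \<Longrightarrow> n * m \<le> k \<Longrightarrow> degree (p ^ m :: int poly) \<le> k"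
  using degree_power_le[of p m] mult_le_mono1[of "degree p" n m] by linarith

lemma degree_disc_le:
  fixes p q :: "int poly"
  assumes "degree p \<le> 2 * d" "degree q \<le> 3 * d"
  shows "degree (disc p q) \<le> 6 * d"
  unfolding disc_def
  by (intro degree_add_le degree_numeral_mult degree_power_le'[OF assms(1)] degree_power_le'[OF assms(2)]) simp_all

lemma degree_wronskian_le:
  fixes p q A B :: "int poly"
  assumes pq: "degree p \<le> 2 * d" "degree q \<le> 3 * d" and AB: "degree A \<le> k" "degree B \<le> k"
  shows "degree (wronskian p q (pderiv p) (pderiv q) A B (pderiv A) (pderiv B)) \<le> 2 * k + 7 * d"
proof -
  have d: "degree (pderiv f) \<le> n" if "degree f \<le> n" for f :: "int poly" and n
    using that by (simp add: degree_pderiv)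
  note p' = d[OF pq(1)] and q' = d[OF pq(2)] and A' = d[OF AB(1)] and B' = d[OF AB(2)]
  have 1: "degree (disc p q) \<le> 6 * d" by (rule degree_disc_le[OF pq])
  have 2: "degree (disc' p q (pderiv p) (pderiv q)) \<le> 6 * d"
    unfolding disc'_def mult.assoc
    by (intro degree_add_le degree_numeral_mult degree_mult_le'[OF degree_power_le'[OF pq(1) order_refl] p']
        degree_mult_le'[OF pq(2) q']) simp_all
  have 3: "degree (ric_w p q (pderiv p) (pderiv q)) \<le> 5 * d"
    unfolding ric_w_def mult.assoc
    by (intro degree_diff_le degree_numeral_mult degree_mult_le'[OF pq(1) q'] degree_mult_le'[OF pq(2) p']) simp_all
  have 4: "degree (con_A p q (pderiv p) (pderiv q) A B (pderiv A)) \<le> k + 7 * d"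
    unfolding con_A_def mult.assoc
    by (intro degree_diff_le degree_add_le degree_numeral_mult degree_mult_le'[OF 1 A'] degree_mult_le'[OF 2 AB(1)]
        degree_mult_le'[OF pq(1) degree_mult_le'[OF 3 AB(2) order_refl]]) simp_all
  have 5: "degree (con_B p q (pderiv p) (pderiv q) A B (pderiv B)) \<le> k + 7 * d"
    unfolding con_B_def mult.assoc
    by (intro degree_diff_le degree_add_le degree_numeral_mult degree_mult_le'[OF 1 B'] degree_mult_le'[OF 2 AB(2)]
        degree_mult_le'[OF 3 AB(1)]) simp_all
  show ?thesis
    unfolding wronskian_def
    by (intro degree_diff_le degree_mult_le'[OF AB(1) 5] degree_mult_le'[OF AB(2) 4]) simp_all
qed

text \<open>
  Modulo the equation for \<open>\<eta>\<close>, the Wronskian is a combination of the form \<open>A - B \<eta>\<close> and of its derivative,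
  so it vanishes to almost the same order.
\<close>

lemma wronskian_vanishes:
  fixes f2 f3 A B :: "int poly" and \<eta> :: "real fps"
  assumes root: "\<eta> ^ 3 + rps f2 * \<eta> + rps f3 = 0" and D: "disc f2 f3 \<noteq> 0"
    and h0: "\<And>n. n \<le> m \<Longrightarrow> (rps A - rps B * \<eta>) $ n = 0" and i: "i < m"
  shows "coeff (wronskian f2 f3 (pderiv f2) (pderiv f3) A B (pderiv A) (pderiv B)) i = 0"
proof -
  interpret r: ring_map rps by (rule ring_map_rps)
  define p where "p = rps f2"
  define q where "q = rps f3"
  define a where "a = rps A"
  define b where "b = rps B"
  define h where "h = a - b * \<eta>"
  note root = root[folded p_def q_def]
  have "fps_deriv (\<eta> ^ 3 + p * \<eta> + q) = 0" unfolding root by simp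
  then have der: "(3 * \<eta> ^ 2 + p) * fps_deriv \<eta> = - (fps_deriv p * \<eta> + fps_deriv q)"
    by (simp add: fps_deriv_power' algebra_simps add_eq_0_iff)
  note con = con_linear_form[OF riccati[OF root der], of a b "fps_deriv a" "fps_deriv b"]
  have h': "fps_deriv h = fps_deriv a - fps_deriv b * \<eta> - b * fps_deriv \<eta>"
    by (simp add: h_def)
  note con = con[folded h', folded h_def]
  have W: "wronskian p q (fps_deriv p) (fps_deriv q) a b (fps_deriv a) (fps_deriv b)
    = h * con_B p q (fps_deriv p) (fps_deriv q) a b (fps_deriv b)
      - b * (6 * disc p q * fps_deriv h + 18 * ric_w p q (fps_deriv p) (fps_deriv q) * \<eta> * h
      - 2 * disc' p q (fps_deriv p) (fps_deriv q) * h)"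
    unfolding wronskian_def using con h_def by Groebner_Basis.algebra
  have hn: "h $ n = 0" if "n \<le> m" for n using h0[OF that] unfolding h_def a_def b_def .
  have ag: "agree m h 0" using hn by (simp add: agree_def)
  have ag': "agree m (fps_deriv h) 0" using hn by (simp add: agree_def)
  have l: "agree m (f * g) 0" if "agree m g 0" for f g :: "real fps"
    using agree_mult[of m f f g 0] that by (simp add: agree_def)
  have "agree m (wronskian p q (fps_deriv p) (fps_deriv q) a b (fps_deriv a) (fps_deriv b)) 0"
  proof -
    have "(h * c - b * (c1 * fps_deriv h + c2 * h - c3 * h)) $ n = 0" if "n < m" for n c c1 c2 c3
      using l[OF ag, of c] l[OF ag', of "b * c1"] l[OF ag, of "b * c2"] l[OF ag, of "b * c3"] that
      unfolding agree_def by (simp add: algebra_simps)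
    then show ?thesis unfolding agree_def W by simp
  qed
  then have "agree m (rps (wronskian f2 f3 (pderiv f2) (pderiv f3) A B (pderiv A) (pderiv B))) 0"
    unfolding r.hom_wronskian rps_pderiv p_def q_def a_def b_def .
  then have "rps (wronskian f2 f3 (pderiv f2) (pderiv f3) A B (pderiv A) (pderiv B)) $ i = 0"
    using i unfolding agree_def by (metis fps_zero_nth)
  then show ?thesis unfolding rps_nth by (simp only: of_int_eq_0_iff)
qed

text \<open>
  The required order of vanishing follows from \<open>12 d \<le> R\<close>, because the degree of the discriminant is at most \<open>6 d\<close>. The
  form \<open>A - B \<eta>\<close> is not zero because \<open>\<eta>\<close> is not rational.
\<close>

lemma wronskian_rps_nonzero:
  fixes f2 f3 A B :: "int poly" and \<eta> :: "real fps"
  assumes root: "\<eta> ^ 3 + rps f2 * \<eta> + rps f3 = 0"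
    and nr: "\<And>a b. b \<noteq> 0 \<Longrightarrow> a ^ 3 + f2 * a * b ^ 2 + f3 * b ^ 3 \<noteq> 0"
    and deg: "degree f2 \<le> 2 * d" "degree f3 \<le> 3 * d"
    and B: "B \<noteq> 0" "degree B \<le> k" and R: "12 * d \<le> R"
    and h0: "\<And>n. n \<le> k + R \<Longrightarrow> (rps A - rps B * \<eta>) $ n = 0"
  shows "wronskian f2 f3 (pderiv f2) (pderiv f3) A B (pderiv A) (pderiv B) \<noteq> 0"
proof -
  interpret r: ring_map rps by (rule ring_map_rps)
  have D: "disc f2 f3 \<noteq> 0" by (rule disc_nonzero[OF nr]) simp_all
  then have D': "disc (rps f2) (rps f3) \<noteq> 0"
    unfolding r.hom_disc[symmetric] rps_eq_0 .
  have h: "rps A - rps B * \<eta> \<noteq> 0"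
  proof
    assume "rps A - rps B * \<eta> = 0"
    then have "rps A ^ 3 + rps f2 * rps A * rps B ^ 2 + rps f3 * rps B ^ 3 = 0"
      using root by Groebner_Basis.algebra
    then have "rps (A ^ 3 + f2 * A * B ^ 2 + f3 * B ^ 3) = 0"
      unfolding r.hom .
    then show False using nr[OF B(1)] unfolding rps_eq_0 by blast
  qed
  have "subdegree (rps B) \<le> k" using subdegree_rps_le[OF B(1)] B(2) by linarith
  moreover have "subdegree (disc (rps f2) (rps f3)) \<le> 6 * d"
    unfolding r.hom_disc[symmetric] using subdegree_rps_le[OF D] degree_disc_le[OF deg] by linarith
  moreover have "k + R < subdegree (rps A - rps B * \<eta>)"
    using subdegree_greaterI[OF h, of "k + R"] h0 by simp
  ultimately have "subdegree (rps B) + 2 * subdegree (disc (rps f2) (rps f3)) < subdegree (rps A - rps B * \<eta>)"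
    using R by linarith
  moreover have "rps B \<noteq> 0" using B(1) by (simp only: rps_eq_0 not_False_eq_True)
  ultimately have "wronskian (rps f2) (rps f3) (fps_deriv (rps f2)) (fps_deriv (rps f3)) (rps A) (rps B)
      (fps_deriv (rps A)) (fps_deriv (rps B)) \<noteq> 0"
    using wronskian_nonzero[OF root D' _ h] by blast
  then show ?thesis
    unfolding rps_pderiv[symmetric] r.hom_wronskian[symmetric] rps_eq_0 .
qed


section \<open>Size of the depressed cubic\<close>

lemma wsum_numeral_mult: "wsum N 1 (numeral c * F :: real fps) = numeral c * wsum N 1 F"
  using wsum_const_mult[of N 1 "numeral c" F] by (simp add: numeral_fps_const)

text \<open>
  The three series are those of \<^const>\<open>dep_p\<close>, \<^const>\<open>dep_q\<close> and \<^const>\<open>disc\<close>; the constant \<open>38 = 27 + 9 + 2\<close> is the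
  sum of the absolute values of the coefficients of the second one, which dominates the first.
\<close>

lemma wsum_cube_bounds:
  fixes f g h :: "real fps"
  assumes L: "1 \<le> L" and f: "\<And>N. wsum N 1 f \<le> L" "\<And>N. wsum N 1 g \<le> L" "\<And>N. wsum N 1 h \<le> L"
  shows "wsum N 1 (9 * g - 3 * f ^ 2) \<le> 38 * L ^ 3"
    and "wsum N 1 (27 * h - 9 * f * g + 2 * f ^ 3) \<le> 38 * L ^ 3"
    and "wsum N 1 (4 * f ^ 3 + 27 * g ^ 2) \<le> 31 * L ^ 3"
proof -
  have n: "0 \<le> wsum N 1 F" for F :: "real fps" by (rule wsum_nonneg) simp
  have p2: "wsum N 1 (F ^ k) \<le> L ^ k" if "wsum N 1 F \<le> L" for F :: "real fps" and k
    using wsum_power[of 1 N F k] power_mono[OF that n, of k] by simp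
  have m: "wsum N 1 (f * g) \<le> L ^ 2"
    using wsum_mult[of 1 N f g] mult_mono[OF f(1)[of N] f(2)[of N]] n L by (simp add: power2_eq_square)
  have L1: "L \<le> L ^ 3" using self_le_power[OF L, of 3] by simp
  have L2: "L ^ 2 \<le> L ^ 3" by (rule power_increasing[OF _ L]) simp
  have "wsum N 1 (9 * g - 3 * f ^ 2) \<le> 9 * wsum N 1 g + 3 * wsum N 1 (f ^ 2)"
    using wsum_diff[of 1 N "9 * g" "3 * f ^ 2"] by (simp add: wsum_numeral_mult)
  then show "wsum N 1 (9 * g - 3 * f ^ 2) \<le> 38 * L ^ 3"
    using f(2)[of N] p2[OF f(1), of 2] L1 L2 L by linarith
  have "wsum N 1 (27 * h - 9 * (f * g) + 2 * f ^ 3) \<le> 27 * wsum N 1 h + 9 * wsum N 1 (f * g) + 2 * wsum N 1 (f ^ 3)"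
    using wsum_add[of 1 N "27 * h - 9 * (f * g)" "2 * f ^ 3"] wsum_diff[of 1 N "27 * h" "9 * (f * g)"]
    by (simp add: wsum_numeral_mult)
  then show "wsum N 1 (27 * h - 9 * f * g + 2 * f ^ 3) \<le> 38 * L ^ 3"
    unfolding mult.assoc using f(3)[of N] m p2[OF f(1), of 3] L1 L2 L by linarith
  have "wsum N 1 (4 * f ^ 3 + 27 * g ^ 2) \<le> 4 * wsum N 1 (f ^ 3) + 27 * wsum N 1 (g ^ 2)"
    using wsum_add[of 1 N "4 * f ^ 3" "27 * g ^ 2"] by (simp only: wsum_numeral_mult)
  then show "wsum N 1 (4 * f ^ 3 + 27 * g ^ 2) \<le> 31 * L ^ 3"
    using p2[OF f(1), of 3] p2[OF f(2), of 2] L2 by linarith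
qed

lemma wsum_rps_le:
  assumes d: "degree p \<le> m" and c: "\<And>i. real_of_int \<bar>coeff p i\<bar> \<le> c"
  shows "wsum N 1 (rps p) \<le> real (m + 1) * c"
proof -
  have "wsum N 1 (rps p) = (\<Sum>i\<le>N. real_of_int \<bar>coeff p i\<bar>)"
    by (simp add: wsum_def coeff_map_poly)
  also have "\<dots> \<le> (\<Sum>i\<le>m + N. real_of_int \<bar>coeff p i\<bar>)" by (rule sum_mono2) auto
  also have "\<dots> = (\<Sum>i\<le>m. real_of_int \<bar>coeff p i\<bar>)"
    using d by (intro sum.mono_neutral_right) (auto simp: coeff_eq_0)
  also have "\<dots> \<le> real (m + 1) * c" using sum_bounded_above[of "{..m}" "\<lambda>i. real_of_int \<bar>coeff p i\<bar>" c] c by simp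
  finally show ?thesis .
qed

lemma poly_le_wsum:
  assumes d: "degree p \<le> m" and c: "\<And>N. wsum N 1 (rps p) \<le> c" and t: "t \<ge> 1"
  shows "\<bar>real_of_int (poly p (int t))\<bar> \<le> c * real t ^ m"
proof -
  have "\<bar>real_of_int (poly p (int t))\<bar> = \<bar>\<Sum>i\<le>degree p. real_of_int (coeff p i) * real t ^ i\<bar>"
    by (simp add: poly_altdef)
  also have "\<dots> \<le> (\<Sum>i\<le>degree p. \<bar>real_of_int (coeff p i)\<bar> * real t ^ i)"
    by (rule order_trans[OF sum_abs]) (simp add: abs_mult)
  also have "\<dots> \<le> (\<Sum>i\<le>degree p. \<bar>real_of_int (coeff p i)\<bar> * real t ^ m)"
    using d t by (intro sum_mono mult_left_mono power_increasing) auto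
  also have "\<dots> = wsum (degree p) 1 (rps p) * real t ^ m"
    by (simp add: wsum_def coeff_map_poly sum_distrib_right)
  also have "\<dots> \<le> c * real t ^ m" using c by (intro mult_right_mono) auto
  finally show ?thesis .
qed

text \<open>Beyond the sum of its absolute coefficients a nonzero integer polynomial has the sign of its leading coefficient.\<close>

lemma poly_sign_large:
  fixes p :: "int poly"
  assumes p: "p \<noteq> 0" and c: "\<And>N. wsum N 1 (rps p) \<le> c" and t: "c < real t"
  shows "0 < poly p (int t) * lead_coeff p"
proof -
  define n where "n = degree p"
  define r where "r = p - monom (lead_coeff p) n"
  have c0: "0 \<le> c" using c[of 0] wsum_nonneg[of 1 0 "rps p"] by simp
  then have t1: "1 \<le> t" using t by simp
  have l: "\<bar>real_of_int (lead_coeff p)\<bar> \<ge> 1"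
  proof -
    have "lead_coeff p \<noteq> 0" using p by simp
    then have "1 \<le> \<bar>lead_coeff p\<bar>" by linarith
    then show ?thesis by linarith
  qed
  have e: "poly p (int t) = poly r (int t) + lead_coeff p * int t ^ n"
    by (simp add: r_def poly_monom)
  have lt: "\<bar>real_of_int (poly r (int t))\<bar> < real t ^ n"
  proof (cases "n = 0")
    case True
    then obtain a where "p = [:a:]" unfolding n_def by (rule degree_eq_zeroE)
    then have "r = 0" by (simp add: r_def n_def monom_0)
    then show ?thesis using t1 by simp
  next
    case False
    have "degree r \<le> n - 1"
      by (rule degree_le) (auto simp: r_def n_def coeff_eq_0)
    moreover have "wsum N 1 (rps r) \<le> c" for N
    proof -
      have "wsum N 1 (rps r) \<le> wsum N 1 (rps p)"
        unfolding wsum_def by (intro sum_mono) (auto simp: r_def n_def coeff_map_poly)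
      then show ?thesis using c[of N] by linarith
    qed
    ultimately have "\<bar>real_of_int (poly r (int t))\<bar> \<le> c * real t ^ (n - 1)" using t1 by (rule poly_le_wsum)
    also have "\<dots> < real t * real t ^ (n - 1)" using t t1 by (intro mult_strict_right_mono) simp_all
    also have "\<dots> = real t ^ n" using False by (simp add: power_eq_if)
    finally show ?thesis .
  qed
  define L where "L = real_of_int (lead_coeff p)"
  define v where "v = real t ^ n"
  define w where "w = real_of_int (poly r (int t))"
  have "real_of_int (poly p (int t) * lead_coeff p) = (w + L * v) * L" unfolding e by (simp add: w_def L_def v_def)
  also have "\<dots> = w * L + L\<^sup>2 * v" by (simp add: algebra_simps power2_eq_square)
  also have "\<dots> > 0"
  proof -
    have v0: "0 < v" using t1 by (simp add: v_def)
    have "\<bar>w * L\<bar> = \<bar>w\<bar> * \<bar>L\<bar>" by (rule abs_mult)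
    also have "\<dots> < v * \<bar>L\<bar>" using lt l unfolding w_def[symmetric] v_def[symmetric] L_def[symmetric] by (intro mult_strict_right_mono) linarith+
    also have "\<dots> \<le> v * (\<bar>L\<bar> * \<bar>L\<bar>)" 
    proof (rule mult_left_mono)
      show "\<bar>L\<bar> \<le> \<bar>L\<bar> * \<bar>L\<bar>" using mult_left_mono[of 1 "\<bar>L\<bar>" "\<bar>L\<bar>"] l unfolding L_def[symmetric] by simp
    qed (use v0 in simp)
    also have "\<dots> = L\<^sup>2 * v" by (simp add: power2_eq_square abs_mult_self_eq mult.commute)
    finally show ?thesis by linarith
  qed
  finally show ?thesis by (simp only: of_int_0_less_iff)
qed

section \<open>Approximation of the root at an integer\<close>

text \<open>
  All constants of the basic inequality are absorbed into powers of \<open>t\<close>; this needs \<open>t\<close> large only in terms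
  of \<open>E\<close> and \<open>s\<close>, not of \<open>l\<close>, because the constants grow geometrically with \<open>l\<close>.
\<close>

lemma absorb_constants:
  fixes E t Y Z :: real and s l d n k R e :: nat
  defines "k \<equiv> s * l" and "R \<equiv> (s - 1) * l" and "e \<equiv> l + 7 * d" and "K \<equiv> 2 + 2 * d + n * (49 + 133 * d)"
  assumes E: "1 \<le> E" and t: "(4 * E) ^ (14 * s ^ 2) \<le> t" and s: "1 \<le> s" and l: "1 \<le> l"
    and Y: "0 \<le> Y" and Z: "0 \<le> Z"
    and ineq: "1 \<le> Y * (8 * E ^ (12 * k * s) * E * (4 * E / t) ^ (k + R + 1) * t ^ (k + d) * (t ^ n) ^ (19 * (e + 1)))
      + E ^ (12 * k * s) * (k + d + 1) * t ^ (k + d) * (t ^ n) ^ (11 + 19 * (e + 1)) * Z"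
  shows "t ^ (s * l) \<le> Y * t ^ (K * l) + t ^ ((2 * s + K) * l) * Z"
proof -
  define F where "F = 4 * E"
  have F: "4 \<le> F" "1 \<le> F" "E \<le> F" using E by (simp_all add: F_def)
  have s2: "1 \<le> s ^ 2" "s \<le> s ^ 2" using s by (simp_all add: power2_eq_square)
  have Ft: "F ^ m \<le> t" if "m \<le> 14 * s ^ 2" for m
    using power_increasing[OF that F(2)] t by (simp add: F_def)
  have t1: "1 \<le> t" using Ft[of 0] by simp
  have Ftl: "F ^ m \<le> t ^ l" if "m \<le> 14 * s ^ 2 * l" for m
  proof -
    have "F ^ m \<le> (F ^ (14 * s ^ 2)) ^ l" unfolding power_mult[symmetric] by (rule power_increasing[OF that F(2)])
    also have "\<dots> \<le> t ^ l" using Ft[OF order_refl] F by (intro power_mono) auto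
    finally show ?thesis .
  qed
  have sl: "s * l \<le> s ^ 2 * l" using s2(2) by (rule mult_le_mono1)
  have kR: "k = R + l" using s by (cases s) (simp_all add: k_def R_def)
  have 1: "E ^ (12 * k * s) * F ^ (k + R) \<le> t ^ l"
  proof -
    have "E ^ (12 * k * s) * F ^ (k + R) \<le> F ^ (12 * k * s) * F ^ (k + R)"
      using F E by (intro mult_right_mono power_mono) auto
    also have "\<dots> = F ^ (12 * k * s + (k + R))" by (rule power_add[symmetric])
    also have "\<dots> \<le> t ^ l"
    proof (rule Ftl)
      have "12 * k * s = 12 * (s ^ 2 * l)" by (simp add: k_def power2_eq_square)
      then show "12 * k * s + (k + R) \<le> 14 * s ^ 2 * l" using sl kR unfolding k_def[symmetric] by linarith
    qed
    finally show ?thesis .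
  qed
  have 2: "8 * E * F \<le> t"
  proof -
    have "8 * E * F \<le> F * (F * F)"
      using mult_mono[of "8 * E" "F * F" F F] mult_left_mono[OF F(1), of F] F E by (simp add: F_def)
    also have "\<dots> = F ^ 3" by (simp add: power3_eq_cube)
    also have "\<dots> \<le> t" using s2(1) by (intro Ft) linarith
    finally show ?thesis .
  qed
  have 3: "E ^ (12 * k * s) * (k + d + 1) \<le> t ^ (l + d)"
  proof -
    have "real (k + d + 1) \<le> 2 ^ (k + d)"
      using of_nat_mono[OF Suc_leI[OF less_exp[of "k + d"]]] by simp
    also have "\<dots> \<le> F ^ k * F ^ d" unfolding power_add[symmetric] using F by (intro power_mono) auto
    also have "\<dots> \<le> F ^ k * t ^ d" using F Ft[of 1] s2(1) by (intro mult_left_mono power_mono) auto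
    finally have *: "real (k + d + 1) \<le> F ^ k * t ^ d" .
    have "E ^ (12 * k * s) * (k + d + 1) \<le> E ^ (12 * k * s) * (F ^ k * t ^ d)"
      using * E by (intro mult_left_mono) auto
    also have "\<dots> \<le> E ^ (12 * k * s) * (F ^ (k + R) * t ^ d)"
      using E t1 F by (intro mult_left_mono mult_right_mono power_increasing) auto
    also have "\<dots> = (E ^ (12 * k * s) * F ^ (k + R)) * t ^ d" by simp
    also have "\<dots> \<le> t ^ l * t ^ d" using 1 t1 by (intro mult_right_mono) auto
    finally show ?thesis unfolding power_add .
  qed
  have tT: "(t ^ n) ^ m = t ^ (n * m)" for m by (rule power_mult[symmetric])
  define P where "P = t ^ (k + d + n * (19 * (e + 1)))"
  have P0: "0 \<le> P" using t1 by (simp add: P_def)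
  define Q where "Q = 8 * E ^ (12 * k * s) * E * (4 * E / t) ^ (k + R + 1) * t ^ (k + d) * (t ^ n) ^ (19 * (e + 1))"
  obtain l' where l': "l = Suc l'" using l by (cases l) auto
  have a: "Q * t ^ (k + R + 1) = (8 * E * F) * (E ^ (12 * k * s) * F ^ (k + R)) * P"
  proof -
    have "(4 * E / t) ^ (k + R + 1) * t ^ (k + R + 1) = (4 * E / t * t) ^ (k + R + 1)"
      by (rule power_mult_distrib[symmetric])
    also have "4 * E / t * t = F" using t1 by (simp add: F_def)
    finally have f: "(4 * E / t) ^ (k + R + 1) * t ^ (k + R + 1) = F ^ (k + R) * F" by simp
    have "8 * e1 * E * u * v * w * tt = (8 * E * F) * (e1 * f) * (v * w)" if "u * tt = f * F" for e1 u v w tt f :: real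
      using that by Groebner_Basis.algebra
    from this[OF f] show ?thesis unfolding Q_def tT P_def power_add[of t "k + d"] .
  qed
  have A: "Q * t ^ k \<le> t ^ (K * l)"
  proof -
    have "Q * t ^ k * t ^ (R + 1) = Q * t ^ (k + R + 1)" by (simp only: power_add mult.assoc)
    also have "\<dots> \<le> t * t ^ l * P"
      unfolding a using 1 2 E F t1 P0 by (intro mult_right_mono mult_mono) auto
    also have "\<dots> = t ^ (1 + l + (k + d + n * (19 * (e + 1))))" unfolding P_def power_add by simp
    also have "\<dots> \<le> t ^ (K * l + (R + 1))"
    proof (rule power_increasing[OF _ t1])
      show "1 + l + (k + d + n * (19 * (e + 1))) \<le> K * l + (R + 1)"
        unfolding kR K_def e_def l' by (simp add: algebra_simps)
    qed
    also have "\<dots> = t ^ (K * l) * t ^ (R + 1)" by (rule power_add)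
    finally show ?thesis by (rule mult_right_le_imp_le) (use t1 in simp)
  qed
  have B: "E ^ (12 * k * s) * (k + d + 1) * t ^ (k + d) * (t ^ n) ^ (11 + 19 * (e + 1)) * t ^ k \<le> t ^ ((2 * s + K) * l)"
  proof -
    have "E ^ (12 * k * s) * (k + d + 1) * t ^ (k + d) * (t ^ n) ^ (11 + 19 * (e + 1)) * t ^ k
        \<le> t ^ (l + d) * t ^ (k + d) * (t ^ n) ^ (11 + 19 * (e + 1)) * t ^ k"
      using 3 t1 by (intro mult_right_mono) auto
    also have "\<dots> = t ^ (l + d + (k + d) + n * (11 + 19 * (e + 1)) + k)" unfolding tT by (simp only: power_add[symmetric])
    also have "\<dots> \<le> t ^ ((2 * s + K) * l)"
    proof (rule power_increasing[OF _ t1])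
      show "l + d + (k + d) + n * (11 + 19 * (e + 1)) + k \<le> (2 * s + K) * l"
        unfolding k_def K_def e_def l' by (simp add: algebra_simps)
    qed
    finally show ?thesis .
  qed
  have "t ^ k * 1 \<le> t ^ k * (Y * Q + E ^ (12 * k * s) * (k + d + 1) * t ^ (k + d) * (t ^ n) ^ (11 + 19 * (e + 1)) * Z)"
    using ineq[folded Q_def] t1 by (intro mult_left_mono) auto
  also have "\<dots> = Y * (Q * t ^ k) + (E ^ (12 * k * s) * (k + d + 1) * t ^ (k + d) * (t ^ n) ^ (11 + 19 * (e + 1)) * t ^ k) * Z"
    by (simp only: distrib_left mult_ac)
  also have "\<dots> \<le> Y * t ^ (K * l) + t ^ ((2 * s + K) * l) * Z"
    by (intro add_mono mult_left_mono[OF A Y] mult_right_mono[OF B Z])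
  finally show ?thesis unfolding k_def by simp
qed


text \<open>
  The constant of Eisenstein's theorem: \<open>x\<close> dominates the coefficients of the reversed cubic, of length at most
  \<open>3 d + 1\<close>, and the order of vanishing of its derivative at the root, which is at most \<open>6 d\<close>.
\<close>

definition root_size :: "nat \<Rightarrow> nat \<Rightarrow> nat" where
  "root_size d c = (let x = (3 * d + 1) * c + 6 * d + 4 in (x ^ (12 ^ x)) ^ 30)"

text \<open>
  The exponent of \<open>t\<close> per unit of \<open>l\<close> that is spent on all constants, when \<open>t\<^sup>9\<^sup>d\<^sup>+\<^sup>1\<close> bounds the specialized cubic and its
  discriminant.
\<close>

definition loss :: "nat \<Rightarrow> nat" where
  "loss d = 2 + 2 * d + (9 * d + 1) * (49 + 133 * d)"

text \<open>
  The derivative at the root vanishes at most to the order of the discriminant, hence at most to order \<open>6 d\<close>, so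
  Eisenstein's theorem applies with constants that depend on \<open>d\<close> and \<open>c\<close> only.
\<close>

lemma depressed_cubic_root_bounds:
  fixes p q :: "int poly" and \<eta> :: "rat fps"
  assumes root: "\<eta> ^ 3 + fps_of_poly (map_poly of_int (rev_poly (2 * d) p)) * \<eta>
      + fps_of_poly (map_poly of_int (rev_poly (3 * d) q)) = 0"
    and nr: "\<And>a b. b \<noteq> 0 \<Longrightarrow> a ^ 3 + p * a * b ^ 2 + q * b ^ 3 \<noteq> 0"
    and d: "degree p \<le> 2 * d" "degree q \<le> 3 * d"
    and c: "\<And>N. wsum N 1 (rps p) \<le> real c" "\<And>N. wsum N 1 (rps q) \<le> real c"
  defines "\<zeta> \<equiv> map_fps of_rat \<eta> :: real fps" and "E \<equiv> root_size d c"
  shows "\<zeta> ^ 3 + rps (rev_poly (2 * d) p) * \<zeta> + rps (rev_poly (3 * d) q) = 0"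
    and "4 \<le> E" and "\<exists>D. 1 \<le> D \<and> D \<le> E \<and> (\<forall>i. real D ^ (i + 1) * \<zeta> $ i \<in> \<int> \<and> \<bar>\<zeta> $ i\<bar> \<le> real E ^ (i + 1))"
proof -
  interpret r: ring_map "map_fps of_rat :: rat fps \<Rightarrow> real fps"
    by (rule ring_map_map_fps[OF ring_map_of_rat])
  define f2 where "f2 = rev_poly (2 * d) p"
  define f3 where "f3 = rev_poly (3 * d) q"
  have m: "map_fps of_rat (fps_of_poly (map_poly of_int f)) = rps f" for f
    by (rule fps_ext) (simp add: coeff_map_poly)
  have "map_fps of_rat (\<eta> ^ 3 + fps_of_poly (map_poly of_int f2) * \<eta> + fps_of_poly (map_poly of_int f3)) = (0 :: real fps)"
    unfolding f2_def f3_def root by (rule r.zero)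
  then have r: "\<zeta> ^ 3 + rps f2 * \<zeta> + rps f3 = 0"
    unfolding r.hom m \<zeta>_def .
  then show "\<zeta> ^ 3 + rps (rev_poly (2 * d) p) * \<zeta> + rps (rev_poly (3 * d) q) = 0"
    unfolding f2_def f3_def .
  have w: "wsum N 1 (rps (rev_poly m f)) \<le> real ((3 * d + 1) * c)"
    if "m \<le> 3 * d" "\<And>N. wsum N 1 (rps f) \<le> real c" for N m f
  proof -
    have "real_of_int \<bar>coeff (rev_poly m f) i\<bar> \<le> real c" for i
    proof (cases "i \<le> m")
      case True
      then show ?thesis
        using coeff_le_wsum[of "rps f" "m - i"] that(2)[of "m - i"] unfolding rps_nth coeff_rev_poly by simp
    qed (simp add: coeff_rev_poly)
    then have "wsum N 1 (rps (rev_poly m f)) \<le> real (m + 1) * real c"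
      by (rule wsum_rps_le[OF degree_rev_poly])
    also have "\<dots> \<le> real (3 * d + 1) * real c" using that(1) by (intro mult_right_mono) auto
    finally show ?thesis by (simp only: of_nat_mult)
  qed
  define X0 where "X0 = (3 * d + 1) * c + 6 * d + 4"
  have E: "E = (X0 ^ (12 ^ X0)) ^ 30" by (simp add: E_def root_size_def Let_def X0_def)
  have nr': "a ^ 3 + f2 * a * b ^ 2 + f3 * b ^ 3 \<noteq> 0" if "b \<noteq> 0" for a b
    unfolding f2_def f3_def by (rule no_rational_root_rev[OF nr d that])
  interpret rp: ring_map rps by (rule ring_map_rps)
  have D0: "disc f2 f3 \<noteq> 0" by (rule disc_nonzero[OF nr']) simp_all
  then have D1: "disc (rps f2) (rps f3) \<noteq> 0" unfolding rp.hom_disc[symmetric] rps_eq_0 .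
  have sd: "subdegree (disc (rps f2) (rps f3)) \<le> 6 * d"
    using subdegree_rps_le[OF D0] degree_disc_le[of f2 d f3] degree_rev_poly unfolding rp.hom_disc f2_def f3_def
    by (meson order_trans)
  interpret dr: depressed_root "rps f2" "rps f3" \<zeta> X0
  proof
    show "\<zeta> ^ 3 + rps f2 * \<zeta> + rps f3 = 0" by (rule r)
    show "\<zeta> $ n \<in> \<rat>" for n by (simp add: \<zeta>_def)
    show "int_fps (rps f2)" "int_fps (rps f3)" by (simp_all add: int_fps_def coeff_map_poly)
    show "wsum N 1 (rps f2) \<le> X0" for N
      using w[OF _ c(1), of "2 * d" N] by (simp add: f2_def X0_def)
    show "wsum N 1 (rps f3) \<le> X0" for N
      using w[OF _ c(2), of "3 * d" N] by (simp add: f3_def X0_def)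
    show "4 \<le> X0" by (simp add: X0_def)
  qed
  show "\<exists>D. 1 \<le> D \<and> D \<le> E \<and> (\<forall>i. real D ^ (i + 1) * \<zeta> $ i \<in> \<int> \<and> \<bar>\<zeta> $ i\<bar> \<le> real E ^ (i + 1))"
    unfolding E
  proof (rule dr.eisenstein)
    show "3 * \<zeta> ^ 2 + rps f2 \<noteq> 0" by (rule subdegree_derivative_le(1)[OF r D1])
    show "subdegree (3 * \<zeta> ^ 2 + rps f2) < X0"
      using subdegree_derivative_le(2)[OF r D1] sd by (simp add: X0_def)
  qed
  have "4 \<le> X0" by (simp add: X0_def)
  also have "X0 \<le> X0 ^ (12 ^ X0)" by (rule self_le_power) (simp_all add: X0_def)
  also have "\<dots> \<le> E" unfolding E by (rule self_le_power) (simp_all add: X0_def)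
  finally show "4 \<le> E" .
qed

text \<open>
  The two parameters play different roles: \<open>s\<close> fixes how much the approximation order exceeds the degree and
  will be chosen from \<open>\<epsilon>\<close>, whereas \<open>l\<close> runs to infinity with \<open>y\<close>.
\<close>

theorem linear_form_inequality:
  fixes p q :: "int poly" and \<eta> :: "rat fps" and t :: nat
  assumes root: "\<eta> ^ 3 + fps_of_poly (map_poly of_int (rev_poly (2 * d) p)) * \<eta>
      + fps_of_poly (map_poly of_int (rev_poly (3 * d) q)) = 0"
    and nr: "\<And>a b. b \<noteq> 0 \<Longrightarrow> a ^ 3 + p * a * b ^ 2 + q * b ^ 3 \<noteq> 0"
    and d: "degree p \<le> 2 * d" "degree q \<le> 3 * d"
    and c: "\<And>N. wsum N 1 (rps p) \<le> real c" "\<And>N. wsum N 1 (rps q) \<le> real c"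
    and T: "4 \<le> real t ^ (9 * d + 1)"
      "1 + \<bar>real_of_int (poly p (int t))\<bar> + \<bar>real_of_int (poly q (int t))\<bar> \<le> real t ^ (9 * d + 1)"
      "\<bar>real_of_int (disc (poly p (int t)) (poly q (int t)))\<bar> \<le> real t ^ (9 * d + 1)"
      "real c * (3 * d + 1) * t ^ (3 * d) \<le> real t ^ (9 * d + 1)"
    and D: "disc (poly p (int t)) (poly q (int t)) \<noteq> 0"
    and s: "2 \<le> s" and t: "(4 * root_size d c) ^ (14 * s ^ 2) \<le> t"
  shows "\<exists>\<xi>::real. \<forall>y. y \<noteq> 0 \<longrightarrow> \<xi> ^ 3 + of_int (poly p (int t)) * \<xi> + of_int (poly q (int t)) = 0 \<and>
    (\<forall>l x. 12 * d + 1 \<le> l \<longrightarrow> real t ^ (s * l) \<le> \<bar>of_int y\<bar> * real t ^ (loss d * l)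
      + real t ^ ((2 * s + loss d) * l) * \<bar>of_int x - \<xi> * of_int y\<bar>)"
proof -
  define \<zeta> where "\<zeta> = (map_fps of_rat \<eta> :: real fps)"
  define E where "E = root_size d c"
  define f2 where "f2 = rev_poly (2 * d) p"
  define f3 where "f3 = rev_poly (3 * d) q"
  note \<zeta> = depressed_cubic_root_bounds[OF root nr d c, folded \<zeta>_def E_def f2_def f3_def]
  obtain Dn where Dn: "1 \<le> Dn" "Dn \<le> E" "\<And>i. real Dn ^ (i + 1) * \<zeta> $ i \<in> \<int>" "\<And>i. \<bar>\<zeta> $ i\<bar> \<le> real E ^ (i + 1)"
    using \<zeta>(3) by blast
  have nr': "a ^ 3 + f2 * a * b ^ 2 + f3 * b ^ 3 \<noteq> 0" if "b \<noteq> 0" for a b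
    unfolding f2_def f3_def by (rule no_rational_root_rev[OF nr d that])
  have D0: "disc f2 f3 \<noteq> 0" by (rule disc_nonzero[OF nr']) simp_all
  have deg: "degree f2 \<le> 2 * d" "degree f3 \<le> 3 * d" unfolding f2_def f3_def by (rule degree_rev_poly)+
  have rec: "coeff (recenter t (2 * d) f2) 0 = poly p (int t)" "coeff (recenter t (3 * d) f3) 0 = poly q (int t)"
    unfolding f2_def f3_def by (rule coeff_recenter_rev[OF d(1)], rule coeff_recenter_rev[OF d(2)])
  have H: "\<bar>real_of_int (coeff (rev_poly m f) i)\<bar> \<le> real c" if "\<And>N. wsum N 1 (rps f) \<le> real c" for m f i
    using coeff_le_wsum[of "rps f" "m - i"] that[of "m - i"] unfolding rps_nth coeff_rev_poly by simp
  have Et: "(4 * real E) ^ (14 * s ^ 2) \<le> real t"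
    using of_nat_mono[OF t] by (simp add: E_def)
  have E1: "1 \<le> real E" using \<zeta>(2) by simp
  have "4 * real E \<le> (4 * real E) ^ (14 * s ^ 2)" using E1 s by (intro self_le_power) auto
  then have Et1: "4 * real E \<le> real t" using Et by linarith
  define \<xi> where "\<xi> = real t ^ d * (\<Sum>n. \<zeta> $ n * (1 / real t) ^ n)"
  have main: "\<xi> ^ 3 + of_int (poly p (int t)) * \<xi> + of_int (poly q (int t)) = 0 \<and>
      real t ^ (s * l) \<le> \<bar>of_int y\<bar> * real t ^ (loss d * l)
      + real t ^ ((2 * s + loss d) * l) * \<bar>of_int x - \<xi> * of_int y\<bar>"
    if y: "y \<noteq> 0" and l: "12 * d + 1 \<le> l" for x y :: int and l
  proof -
    define k where "k = s * l"
    define R where "R = (s - 1) * l"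
    define e where "e = l + 7 * d"
    have s1: "1 \<le> s" and l1: "1 \<le> l" using s l by linarith+
    have E2: "2 \<le> E" using \<zeta>(2) by linarith
    obtain A B where AB: "degree A \<le> k" "degree B \<le> k" "B \<noteq> 0"
        "\<And>i. \<bar>real_of_int (coeff A i)\<bar> \<le> real E ^ (12 * k * s)" "\<And>i. \<bar>real_of_int (coeff B i)\<bar> \<le> real E ^ (12 * k * s)"
        "\<And>n. n \<le> k + R \<Longrightarrow> (rps A - rps B * \<zeta>) $ n = 0"
        "\<And>n. \<bar>(rps A - rps B * \<zeta>) $ n\<bar> \<le> real E ^ (12 * k * s) * real E ^ (n + 1)"
      using pade_approximation[OF Dn(1,2) E2 Dn(3,4) s1 l1] unfolding k_def R_def by metis
    have R: "12 * d \<le> R"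
    proof -
      have "12 * d \<le> 1 * l" using l by simp
      also have "\<dots> \<le> R" unfolding R_def using s by (intro mult_le_mono1) simp
      finally show ?thesis .
    qed
    have kR: "k = R + l" using s1 by (cases s) (simp_all add: k_def R_def)
    have W: "wronskian f2 f3 (pderiv f2) (pderiv f3) A B (pderiv A) (pderiv B) \<noteq> 0"
      by (rule wronskian_rps_nonzero[OF \<zeta>(1) nr' deg AB(3,2) R AB(6)])
    have W2: "degree (wronskian f2 f3 (pderiv f2) (pderiv f3) A B (pderiv A) (pderiv B)) \<le> k + R + e"
      using degree_wronskian_le[OF deg AB(1,2)] kR unfolding e_def by linarith
    have W3: "coeff (wronskian f2 f3 (pderiv f2) (pderiv f3) A B (pderiv A) (pderiv B)) i = 0" if "i < k + R" for i
      by (rule wronskian_vanishes[OF \<zeta>(1) D0 AB(6) that])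
    note bi = basic_inequality[OF \<zeta>(1) deg H[OF c(1), of "2 * d", folded f2_def] H[OF c(2), of "3 * d", folded f3_def] E1 Dn(4) AB(1,2,4,5,6,7)
        W W2 W3 Et1 D[folded rec] T(1) T(2)[folded rec] T(3)[folded rec] T(4) y, folded \<xi>_def, unfolded rec, of x]
    have "real t ^ (s * l) \<le> \<bar>of_int y\<bar> * real t ^ (loss d * l)
      + real t ^ ((2 * s + loss d) * l) * \<bar>of_int x - \<xi> * of_int y\<bar>"
      unfolding loss_def
      by (rule absorb_constants[OF E1 Et s1 l1 _ _ conjunct2[OF bi, unfolded k_def R_def e_def of_nat_power]]) simp_all
    with conjunct1[OF bi] show ?thesis by blast
  qed
  show ?thesis
  proof (intro exI allI impI)
    fix y :: int assume y: "y \<noteq> 0"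
    show "\<xi> ^ 3 + of_int (poly p (int t)) * \<xi> + of_int (poly q (int t)) = 0 \<and>
      (\<forall>l x. 12 * d + 1 \<le> l \<longrightarrow> real t ^ (s * l) \<le> \<bar>of_int y\<bar> * real t ^ (loss d * l)
      + real t ^ ((2 * s + loss d) * l) * \<bar>of_int x - \<xi> * of_int y\<bar>)"
      using main[OF y] by blast
  qed
qed

section \<open>From linear forms to solutions\<close>

text \<open>
  The cubic splits into \<open>x - \<xi> y\<close> and a quadratic form of discriminant \<open>-(3 \<xi>\<^sup>2 + 4 p)\<close>. If the discriminant of the
  cubic is positive, this quadratic form is definite, with a lower bound in terms of the height.
\<close>

lemma linear_factor_upper:
  fixes \<xi> p q x y N T :: real
  assumes root: "\<xi> ^ 3 + p * \<xi> + q = 0" and D: "1 \<le> disc p q"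
    and T: "4 \<le> T" "\<bar>\<xi>\<bar> \<le> T" "\<bar>p\<bar> \<le> T"
    and N: "x ^ 3 + p * x * y ^ 2 + q * y ^ 3 = 27 * N"
  shows "\<bar>x - \<xi> * y\<bar> * y ^ 2 \<le> T ^ 10 * \<bar>N\<bar>"
proof -
  have fac: "disc p q = (3 * \<xi> ^ 2 + p) ^ 2 * (3 * \<xi> ^ 2 + 4 * p)"
    using root unfolding disc_def by Groebner_Basis.algebra
  have spl: "27 * N = (x - \<xi> * y) * (x ^ 2 + \<xi> * x * y + (\<xi> ^ 2 + p) * y ^ 2)"
    using root N by Groebner_Basis.algebra
  have T2: "T * 4 \<le> T ^ 2" using T(1) by (simp add: power2_eq_square)
  have "\<xi> ^ 2 \<le> T ^ 2" using T(1,2) by (intro power2_le_iff_abs_le[THEN iffD2]) auto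
  then have m: "\<bar>3 * \<xi> ^ 2 + p\<bar> \<le> 4 * T ^ 2"
    using T(1,3) T2 zero_le_power2[of \<xi>] by linarith
  have m2: "(3 * \<xi> ^ 2 + p) ^ 2 \<le> (4 * T ^ 2) ^ 2"
    by (rule power2_le_iff_abs_le[THEN iffD2]) (use m in auto)
  have pos: "0 < 3 * \<xi> ^ 2 + 4 * p"
  proof (rule ccontr)
    assume "\<not> ?thesis"
    then have "(3 * \<xi> ^ 2 + p) ^ 2 * (3 * \<xi> ^ 2 + 4 * p) \<le> 0" by (intro mult_nonneg_nonpos) auto
    then show False using D fac by linarith
  qed
  have "1 \<le> (4 * T ^ 2) ^ 2 * (3 * \<xi> ^ 2 + 4 * p)"
    using D mult_right_mono[OF m2, of "3 * \<xi> ^ 2 + 4 * p"] pos unfolding fac by linarith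
  then have low: "1 \<le> 16 * T ^ 4 * (3 * \<xi> ^ 2 + 4 * p)"
    by (simp add: power_mult_distrib)
  define W where "W = x ^ 2 + \<xi> * x * y + (\<xi> ^ 2 + p) * y ^ 2"
  have W: "4 * W = (2 * x + \<xi> * y) ^ 2 + (3 * \<xi> ^ 2 + 4 * p) * y ^ 2"
    unfolding W_def by Groebner_Basis.algebra
  have "0 \<le> (2 * x + \<xi> * y) ^ 2" by simp
  then have cW: "(3 * \<xi> ^ 2 + 4 * p) * y ^ 2 \<le> 4 * W" using W by linarith
  moreover have "0 \<le> (3 * \<xi> ^ 2 + 4 * p) * y ^ 2" using pos by simp
  ultimately have W0: "0 \<le> W" by linarith
  have T3: "64 \<le> T ^ 3" using power_mono[OF T(1), of 3] by simp
  have yW: "y ^ 2 \<le> T ^ 7 * W"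
  proof -
    have "1 * y ^ 2 \<le> 16 * T ^ 4 * (3 * \<xi> ^ 2 + 4 * p) * y ^ 2" using low by (rule mult_right_mono) simp
    also have "\<dots> = 16 * T ^ 4 * ((3 * \<xi> ^ 2 + 4 * p) * y ^ 2)" by (rule mult.assoc)
    also have "\<dots> \<le> 16 * T ^ 4 * (4 * W)" using cW T(1) by (intro mult_left_mono) auto
    also have "\<dots> = 64 * (T ^ 4 * W)" by simp
    also have "\<dots> \<le> T ^ 3 * (T ^ 4 * W)" using T3 T(1) W0 by (intro mult_right_mono) auto
    also have "\<dots> = T ^ 7 * W" by (simp only: mult.assoc[symmetric] power_add[symmetric]) simp
    finally show ?thesis by simp
  qed
  have "\<bar>x - \<xi> * y\<bar> * y ^ 2 \<le> \<bar>x - \<xi> * y\<bar> * (T ^ 7 * W)" using yW by (intro mult_left_mono) auto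
  also have "\<dots> = T ^ 7 * \<bar>27 * N\<bar>" unfolding spl W_def[symmetric] using W0 by (simp add: abs_mult)
  also have "\<dots> = 27 * (T ^ 7 * \<bar>N\<bar>)" by (simp add: abs_mult)
  also have "\<dots> \<le> T ^ 3 * (T ^ 7 * \<bar>N\<bar>)" using T3 T(1) by (intro mult_right_mono) auto
  also have "\<dots> = T ^ 10 * \<bar>N\<bar>" by (simp add: mult.assoc[symmetric] power_add[symmetric])
  finally show ?thesis .
qed

text \<open>
  The parameter \<open>l\<close> is chosen minimal such that the first term on the right of the inequality drops below half of the
  left-hand side. Then \<open>x - \<xi> y\<close> is bounded below, and minimality bounds the loss in terms of \<open>y\<close>. With
  \<open>s = K + 2 K (b + 1)\<close> the resulting exponents lead to \<open>Y\<^sup>b \<le> (t\<^sup>M Q)\<^sup>b\<^sup>+\<^sup>1\<close>.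
\<close>

lemma gap_argument:
  fixes t Y Q Z :: real and s K l0 b :: nat
  assumes t: "2 \<le> t" and Y: "1 \<le> Y" and Q: "1 \<le> Q" and K: "1 \<le> K" and b: "1 \<le> b"
    and s: "s = K + 2 * K * (b + 1)"
    and ineq: "\<And>l. l0 \<le> l \<Longrightarrow> t ^ (s * l) \<le> Y * t ^ (K * l) + t ^ ((2 * s + K) * l) * Z"
    and Z: "0 \<le> Z" "Z * Y ^ 2 \<le> Q * t ^ K"
  shows "Y \<le> Q powr (1 + 1 / b) * t ^ ((s + K) * l0 + K + 1 + 2 * (s + 2 * K + 3))"
proof -
  define m where "m = 2 * K * (b + 1)"
  have sm: "s = K + m" by (simp add: s m_def)
  have t0: "0 < t" and t1: "1 \<le> t" using t by simp_all
  have tp: "1 \<le> t ^ i" for i using t1 by simp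
  have m1: "1 \<le> m" using K by (simp add: m_def)
  have Qp: "Q \<le> Q powr (1 + 1 / b)"
    using powr_mono[of 1 "1 + 1 / b" Q] Q by simp
  define good where "good l \<longleftrightarrow> l0 \<le> l \<and> 2 * Y < t ^ (m * l)" for l
  have ex: "\<exists>l. good l"
  proof -
    obtain j where j: "2 * Y < 2 ^ j" using real_arch_pow[of 2 "2 * Y"] by auto
    have "(2::real) ^ j \<le> t ^ (m * (l0 + j))"
    proof -
      have "(2::real) ^ j \<le> t ^ j" using t by (intro power_mono) auto
      also have "\<dots> \<le> t ^ (m * (l0 + j))"
      proof (rule power_increasing[OF _ t1])
        have "1 * j \<le> m * (l0 + j)" using m1 by (intro mult_le_mono) auto
        then show "j \<le> m * (l0 + j)" by simp
      qed
      finally show ?thesis .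
    qed
    then show ?thesis using j unfolding good_def by (intro exI[of _ "l0 + j"]) auto
  qed
  define l where "l = (LEAST l. good l)"
  have l: "l0 \<le> l" "2 * Y < t ^ (m * l)"
    using LeastI_ex[OF ex] unfolding l_def good_def by auto
  have Y2: "Y ^ 2 \<le> 2 * t ^ ((s + K) * l) * (Q * t ^ K)"
  proof -
    have e: "t ^ (s * l) = t ^ (K * l) * t ^ (m * l)" unfolding sm by (simp add: power_add distrib_right)
    have "2 * (Y * t ^ (K * l)) \<le> t ^ (s * l)"
      unfolding e using mult_left_mono[OF less_imp_le[OF l(2)], of "t ^ (K * l)"] t0 by (simp add: mult_ac)
    then have "t ^ (s * l) \<le> 2 * (t ^ ((2 * s + K) * l) * Z)" using ineq[OF l(1)] by linarith
    also have "t ^ ((2 * s + K) * l) = t ^ (s * l) * t ^ ((s + K) * l)"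
      by (simp only: power_add[symmetric] distrib_right mult_2 add.assoc)
    finally have "t ^ (s * l) * 1 \<le> t ^ (s * l) * (2 * t ^ ((s + K) * l) * Z)" by (simp add: mult_ac)
    then have 1: "1 \<le> 2 * t ^ ((s + K) * l) * Z" by (rule mult_left_le_imp_le) (use t0 in simp)
    have "1 * Y ^ 2 \<le> 2 * t ^ ((s + K) * l) * Z * Y ^ 2" using 1 by (rule mult_right_mono) simp
    also have "\<dots> = 2 * t ^ ((s + K) * l) * (Z * Y ^ 2)" by simp
    also have "\<dots> \<le> 2 * t ^ ((s + K) * l) * (Q * t ^ K)" using Z(2) t0 by (intro mult_left_mono) auto
    finally show ?thesis by simp
  qed
  define M where "M = (s + K) * l0 + K + 1 + 2 * (s + 2 * K + 3)"
  have "Y \<le> Q powr (1 + 1 / b) * t ^ M"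
  proof (cases "l = l0")
    case True
    have "Y \<le> Y ^ 2" using Y by (simp add: power2_eq_square)
    also have "\<dots> \<le> 2 * t ^ ((s + K) * l0) * (Q * t ^ K)" using Y2 True by simp
    also have "\<dots> \<le> t * t ^ ((s + K) * l0) * (Q * t ^ K)" using t Q by (intro mult_right_mono) auto
    also have "\<dots> = Q * t ^ ((s + K) * l0 + K + 1)" by (simp add: power_add)
    also have "\<dots> \<le> Q powr (1 + 1 / b) * t ^ M"
      using Qp Q t1 by (intro mult_mono power_increasing) (auto simp: M_def)
    finally show ?thesis .
  next
    case False
    then obtain l' where l': "l = Suc l'" "l0 \<le> l'" using l(1) by (cases l) auto
    have "\<not> good l'" using not_less_Least[of l' good] l'(1) unfolding l_def by simp
    then have nv: "t ^ (m * l') \<le> 2 * Y" using l'(2) by (simp add: good_def)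
    define v where "v = t ^ (2 * K * l')"
    have v0: "0 \<le> v" using t0 by (simp add: v_def)
    have "m * l' = 2 * K * l' * (b + 1)" unfolding m_def by (simp only: mult_ac)
    then have vm: "v ^ (b + 1) \<le> 2 * Y" using nv unfolding v_def by (simp only: power_mult)
    define w where "w = t ^ (s + 2 * K) * Q"
    have w0: "0 \<le> w" using t0 Q by (simp add: w_def)
    have Y2': "Y ^ 2 \<le> 2 * w * v ^ (b + 2)"
    proof -
      have "(s + K) * l = s + K + 2 * K * l' * (b + 2)" unfolding l'(1) s by (simp add: algebra_simps)
      then have "t ^ ((s + K) * l) = t ^ (s + K) * v ^ (b + 2)"
        unfolding v_def by (simp only: power_add power_mult)
      moreover have "t ^ (s + 2 * K) = t ^ (s + K) * t ^ K" by (simp only: mult_2[of K] power_add mult.assoc)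
      ultimately have "2 * t ^ ((s + K) * l) * (Q * t ^ K) = 2 * w * v ^ (b + 2)"
        unfolding w_def by (simp only: mult_ac)
      then show ?thesis using Y2 by simp
    qed
    have "(Y ^ b) * Y ^ (b + 2) = (Y ^ 2) ^ (b + 1)"
      unfolding power_mult[symmetric] power_add[symmetric] by (simp add: mult_2)
    also have "\<dots> \<le> (2 * w * v ^ (b + 2)) ^ (b + 1)" using Y2' by (intro power_mono) auto
    also have "\<dots> = (2 * w) ^ (b + 1) * (v ^ (b + 1)) ^ (b + 2)"
      unfolding power_mult_distrib[of "2 * w"] power_mult[symmetric] by (simp only: mult.commute)
    also have "\<dots> \<le> (2 * w) ^ (b + 1) * (2 * Y) ^ (b + 2)"
      using vm v0 w0 by (intro mult_left_mono power_mono) auto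
    also have "\<dots> = ((2 * w) ^ (b + 1) * 2 ^ (b + 2)) * Y ^ (b + 2)" by (simp only: power_mult_distrib mult.assoc)
    finally have "Y ^ b \<le> (2 * w) ^ (b + 1) * 2 ^ (b + 2)"
      by (rule mult_right_le_imp_le) (use Y in simp)
    also have "\<dots> \<le> (2 * w) ^ (b + 1) * (2 ^ 2) ^ (b + 1)"
      unfolding power_mult[symmetric] using w0 by (intro mult_left_mono power_increasing) auto
    also have "\<dots> = (2 * 2 ^ 2 * w) ^ (b + 1)" by (simp only: power_mult_distrib mult_ac)
    also have "\<dots> \<le> (t ^ 3 * w) ^ (b + 1)"
      using w0 power_mono[OF t, of 3] by (intro power_mono mult_right_mono) auto
    also have "t ^ 3 * w = t ^ (s + 2 * K + 3) * Q" unfolding w_def by (simp add: power_add)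
    finally have Yb: "Y ^ b \<le> (t ^ (s + 2 * K + 3) * Q) ^ (b + 1)" .
    define u where "u = t ^ (s + 2 * K + 3)"
    have u1: "1 \<le> u" unfolding u_def by (rule tp)
    have "Y = (Y ^ b) powr (1 / b)"
    proof -
      have "0 < Y" using Y by simp
      then have "(Y ^ b) powr (1 / b) = Y powr (real b * (1 / b))" by (simp only: powr_realpow[symmetric] powr_powr)
      then show ?thesis using Y b by simp
    qed
    also have "\<dots> \<le> ((u * Q) ^ (b + 1)) powr (1 / b)"
      using Yb Y unfolding u_def by (intro powr_mono2) auto
    also have "\<dots> = (u * Q) powr (1 + 1 / b)"
    proof -
      have p: "0 < u * Q" using u1 Q by simp
      have "((u * Q) ^ (b + 1)) powr (1 / b) = (u * Q) powr (real (b + 1) * (1 / b))"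
        unfolding powr_realpow[OF p, symmetric] powr_powr ..
      also have "real (b + 1) * (1 / b) = 1 + 1 / b" using b by (simp add: field_simps)
      finally show ?thesis .
    qed
    also have "\<dots> = u powr (1 + 1 / b) * Q powr (1 + 1 / b)" by (rule powr_mult)
    also have "\<dots> \<le> u powr 2 * Q powr (1 + 1 / b)"
      using u1 b by (intro mult_right_mono powr_mono) (auto simp: field_simps)
    also have "u powr 2 = u ^ 2" using u1 by (simp add: powr_numeral)
    also have "u ^ 2 = t ^ (2 * (s + 2 * K + 3))" unfolding u_def power_mult[symmetric] by (simp only: mult.commute)
    also have "\<dots> * Q powr (1 + 1 / b) \<le> t ^ M * Q powr (1 + 1 / b)"
      using t1 by (intro mult_right_mono power_increasing) (auto simp: M_def)
    finally show ?thesis by (simp only: mult.commute)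
  qed
  then show ?thesis unfolding M_def .
qed

text \<open>
  The values of \<open>3 x + P\<^sub>2 y - \<xi> y\<close> and \<open>y\<close> determine \<open>x\<close>; all coefficients are powers of \<open>t\<close>.
\<close>

lemma recover_solution:
  fixes t Q \<xi> p1 x y :: real and n M b :: nat
  assumes t: "2 \<le> t" and Q: "1 \<le> Q" and y: "1 \<le> \<bar>y\<bar>" "\<bar>y\<bar> \<le> Q powr (1 + 1 / b) * t ^ M"
    and \<xi>: "\<bar>\<xi>\<bar> \<le> t ^ n" and p1: "\<bar>p1\<bar> \<le> t ^ n"
    and lin: "\<bar>(3 * x + p1 * y) - \<xi> * y\<bar> * y ^ 2 \<le> (t ^ n) ^ 10 * Q"
  shows "max \<bar>x\<bar> \<bar>y\<bar> \<le> t ^ (10 * n + M + 2) * Q powr (1 + 1 / b)"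
proof -
  define Q' where "Q' = Q powr (1 + 1 / b)"
  have QQ: "Q \<le> Q'" using powr_mono[of 1 "1 + 1 / b" Q] Q by (simp add: Q'_def)
  have Q0: "0 \<le> Q'" using QQ Q by simp
  have t1: "1 \<le> t" using t by simp
  define U where "U = 3 * x + p1 * y"
  have "\<bar>U - \<xi> * y\<bar> * 1 \<le> \<bar>U - \<xi> * y\<bar> * y ^ 2"
    using power_mono[OF y(1), of 2] by (intro mult_left_mono) auto
  then have a: "\<bar>U - \<xi> * y\<bar> \<le> (t ^ n) ^ 10 * Q" 
    using lin[folded U_def] by (metis mult.right_neutral order_trans)
  have A: "\<bar>U - \<xi> * y\<bar> \<le> t ^ (10 * n + M) * Q'"
  proof -
    have "(t ^ n) ^ 10 * Q \<le> t ^ (10 * n + M) * Q'"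
      unfolding power_mult[symmetric] using t1 QQ Q by (intro mult_mono power_increasing) auto
    then show ?thesis using a by linarith
  qed
  have B: "\<bar>z * y\<bar> \<le> t ^ (10 * n + M) * Q'" if "\<bar>z\<bar> \<le> t ^ n" for z
  proof -
    have "\<bar>z * y\<bar> \<le> t ^ n * (Q' * t ^ M)"
      unfolding abs_mult by (rule mult_mono[OF that y(2)[folded Q'_def]]) (use t1 in simp_all)
    also have "\<dots> = t ^ (n + M) * Q'" by (simp add: power_add mult_ac)
    also have "\<dots> \<le> t ^ (10 * n + M) * Q'" using t1 Q0 by (intro mult_right_mono power_increasing) auto
    finally show ?thesis .
  qed
  have "\<bar>y\<bar> \<le> t ^ (10 * n + M) * Q'" using B[of 1] t1 by simp
  moreover have "3 * \<bar>x\<bar> \<le> 3 * (t ^ (10 * n + M) * Q')"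
  proof -
    have "3 * x = (U - \<xi> * y) + \<xi> * y - p1 * y" by (simp add: U_def)
    then have "3 * \<bar>x\<bar> \<le> \<bar>U - \<xi> * y\<bar> + \<bar>\<xi> * y\<bar> + \<bar>p1 * y\<bar>" by linarith
    then show ?thesis using A B[OF \<xi>] B[OF p1] by linarith
  qed
  ultimately have "max \<bar>x\<bar> \<bar>y\<bar> \<le> t ^ (10 * n + M) * Q'" by linarith
  also have "\<dots> \<le> t ^ (10 * n + M + 2) * Q'" using t1 Q0 by (intro mult_right_mono power_increasing) auto
  finally show ?thesis unfolding Q'_def .
qed

section \<open>The norm form and the sign of the discriminant\<close>

lemma specialize_cubic:
  assumes P: "degree P = 3" "lead_coeff P = 1"
  shows "specialize P t = [:poly (coeff P 0) t, poly (coeff P 1) t, poly (coeff P 2) t, 1:]"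
  unfolding specialize_def by (subst monic_cubic_eq[OF P]) (simp add: map_poly_pCons)

lemma norm_form_cubic:
  assumes P: "degree P = 3" "lead_coeff P = 1"
  shows "norm_form P t x y = of_int (x ^ 3 + poly (coeff P 2) t * x ^ 2 * y + poly (coeff P 1) t * x * y ^ 2
    + poly (coeff P 0) t * y ^ 3)"
proof -
  define f where "f = (map_poly of_int (specialize P t) :: complex poly)"
  define c0 where "c0 = (of_int (poly (coeff P 0) t) :: complex)"
  define c1 where "c1 = (of_int (poly (coeff P 1) t) :: complex)"
  define c2 where "c2 = (of_int (poly (coeff P 2) t) :: complex)"
  have f: "f = [:c0, c1, c2, 1:]"
    unfolding f_def specialize_cubic[OF P] c0_def c1_def c2_def by (simp add: map_poly_pCons)
  obtain rs where rs: "mset rs = proots f" using ex_mset by blast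
  have "degree f = Suc (Suc (Suc 0))" unfolding f by simp
  then have "length rs = Suc (Suc (Suc 0))" using size_proots_complex[of f] unfolding rs[symmetric] size_mset by simp
  then obtain a b c where "rs = [a, b, c]" by (auto simp: length_Suc_conv)
  then have r: "proots f = {#a, b, c#}" using rs by simp
  have "smult (lead_coeff f) (\<Prod>x\<in>#proots f. [:-x, 1:]) = f" by (rule complex_poly_decompose_multiset)
  then have "[:-a, 1:] * ([:-b, 1:] * [:-c, 1:]) = f" unfolding r by (simp add: f)
  then have e: "c0 = - (a * b * c)" "c1 = a * b + a * c + b * c" "c2 = - (a + b + c)"
    unfolding f by (simp_all add: algebra_simps)
  have "norm_form P t x y = (of_int x - a * of_int y) * ((of_int x - b * of_int y) * (of_int x - c * of_int y))"
    unfolding norm_form_def f_def[symmetric] r by simp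
  also have "\<dots> = of_int x ^ 3 + c2 * of_int x ^ 2 * of_int y + c1 * of_int x * of_int y ^ 2 + c0 * of_int y ^ 3"
    unfolding e by Groebner_Basis.algebra
  also have "\<dots> = of_int (x ^ 3 + poly (coeff P 2) t * x ^ 2 * y + poly (coeff P 1) t * x * y ^ 2
    + poly (coeff P 0) t * y ^ 3)"
    unfolding c0_def c1_def c2_def by simp
  finally show ?thesis .
qed

lemma ring_map_poly_at: "ring_map (\<lambda>f :: int poly. poly f t)"
  by unfold_locales simp_all

lemma depressed_norm_form:
  fixes x y q :: int
  assumes P: "degree P = 3" "lead_coeff P = 1" and q: "norm_form P t x y = of_int q"
  defines "z \<equiv> 3 * x + poly (coeff P 2) t * y"
  shows "z ^ 3 + poly (dep_p P) t * z * y ^ 2 + poly (dep_q P) t * y ^ 3 = 27 * q"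
proof -
  interpret e: ring_map "\<lambda>f :: int poly. poly f t" by (rule ring_map_poly_at)
  have "q = x ^ 3 + poly (coeff P 2) t * x ^ 2 * y + poly (coeff P 1) t * x * y ^ 2 + poly (coeff P 0) t * y ^ 3"
    using q unfolding norm_form_cubic[OF P] by (simp only: of_int_eq_iff)
  then show ?thesis
    unfolding z_def dep_p_def dep_q_def e.hom by Groebner_Basis.algebra
qed

text \<open>
  A negative discriminant makes the complementary quadratic factor of a real zero split over the reals.
\<close>

lemma disc_nonneg_of_unique_zero:
  fixes c0 c1 c2 :: real
  assumes "\<exists>!z. z ^ 3 + c2 * z ^ 2 + c1 * z + c0 = 0"
  shows "0 \<le> disc (9 * c1 - 3 * c2 ^ 2) (27 * c0 - 9 * c2 * c1 + 2 * c2 ^ 3)"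
proof (rule ccontr)
  define p where "p = 9 * c1 - 3 * c2 ^ 2"
  define q where "q = 27 * c0 - 9 * c2 * c1 + 2 * c2 ^ 3"
  assume "\<not> ?thesis"
  then have neg: "disc p q < 0" by (simp add: p_def q_def)
  from assms obtain z where z: "z ^ 3 + c2 * z ^ 2 + c1 * z + c0 = 0"
    and u: "\<And>w. w ^ 3 + c2 * w ^ 2 + c1 * w + c0 = 0 \<Longrightarrow> w = z" by blast
  define w where "w = 3 * z + c2"
  have w: "w ^ 3 + p * w + q = 0"
    using depress[of z c2 c1 c0] z unfolding w_def p_def q_def by simp
  have fac: "disc p q = (3 * w ^ 2 + p) ^ 2 * (3 * w ^ 2 + 4 * p)"
    using w unfolding disc_def by Groebner_Basis.algebra
  have "3 * w ^ 2 + 4 * p < 0"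
  proof (rule ccontr)
    assume "\<not> ?thesis"
    then have "0 \<le> (3 * w ^ 2 + p) ^ 2 * (3 * w ^ 2 + 4 * p)" by simp
    then show False using neg fac by linarith
  qed
  define r where "r = sqrt (- (3 * w ^ 2 + 4 * p))"
  have r: "r ^ 2 = - (3 * w ^ 2 + 4 * p)" unfolding r_def using \<open>3 * w ^ 2 + 4 * p < 0\<close> by simp
  have m: "3 * w ^ 2 + p \<noteq> 0" using neg fac by auto
  have same: "w' = w" if "w' ^ 3 + p * w' + q = 0" for w'
  proof -
    define z' where "z' = (w' - c2) / 3"
    have w': "w' = 3 * z' + c2" by (simp add: z'_def)
    have "27 * (z' ^ 3 + c2 * z' ^ 2 + c1 * z' + c0) = 0"
      using depress[of z' c2 c1 c0] that unfolding w' p_def q_def by simp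
    then have "z' = z" by (intro u) simp
    then show ?thesis unfolding w' w_def by simp
  qed
  define w2 where "w2 = (r - w) / 2"
  define w3 where "w3 = (- r - w) / 2"
  have e2: "2 * w2 = r - w" and e3: "2 * w3 = - r - w" by (simp_all add: w2_def w3_def)
  have "8 * (w2 ^ 3 + p * w2 + q) = 0" using e2 r w by Groebner_Basis.algebra
  then have a: "w2 = w" by (intro same) simp
  have "8 * (w3 ^ 3 + p * w3 + q) = 0" using e3 r w by Groebner_Basis.algebra
  then have b: "w3 = w" by (intro same) simp
  have "4 * (3 * w ^ 2 + p) = 0" using e2 e3 r unfolding a b by Groebner_Basis.algebra
  then show False using m by simp
qed

text \<open>
  The discriminant is a nonzero polynomial, so it has constant sign beyond an explicit point; the hypothesis
  determines this sign at some large argument.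
\<close>

lemma disc_positive:
  fixes P :: "int poly poly"
  assumes irr: "Factorial_Ring.irreducible P" and P: "degree P = 3" "lead_coeff P = 1"
    and one: "\<forall>\<^sub>F t :: nat in sequentially. \<exists>!z :: real. poly (map_poly of_int (specialize P (int t))) z = 0"
    and c: "\<And>N. wsum N 1 (rps (disc (dep_p P) (dep_q P))) \<le> c" and t: "c < real t"
  shows "0 < disc (poly (dep_p P) (int t)) (poly (dep_q P) (int t))"
proof -
  define \<Delta> where "\<Delta> = disc (dep_p P) (dep_q P)"
  have \<Delta>0: "\<Delta> \<noteq> 0"
    unfolding \<Delta>_def by (rule disc_nonzero[OF no_rational_root[OF irr P]]) simp_all
  have at: "poly \<Delta> n = disc (poly (dep_p P) n) (poly (dep_q P) n)" for n
    unfolding \<Delta>_def by (rule ring_map.hom_disc[OF ring_map_poly_at])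
  obtain N where N: "\<And>t. N \<le> t \<Longrightarrow> \<exists>!z :: real. poly (map_poly of_int (specialize P (int t))) z = 0"
    using one unfolding eventually_sequentially by blast
  define t' where "t' = max N t"
  have t': "c < real t'" using t by (simp add: t'_def)
  define c0 where "c0 = poly (coeff P 0) (int t')"
  define c1 where "c1 = poly (coeff P 1) (int t')"
  define c2 where "c2 = poly (coeff P 2) (int t')"
  have "poly (map_poly of_int (specialize P (int t'))) z = z ^ 3 + of_int c2 * z ^ 2 + of_int c1 * z + of_int c0" for z :: real
    unfolding specialize_cubic[OF P] c0_def c1_def c2_def
    by (simp add: map_poly_pCons algebra_simps power2_eq_square power3_eq_cube)
  then have "\<exists>!z :: real. z ^ 3 + of_int c2 * z ^ 2 + of_int c1 * z + of_int c0 = 0"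
    using N[of t'] by (simp add: t'_def)
  from disc_nonneg_of_unique_zero[OF this]
  have "0 \<le> real_of_int (disc (9 * c1 - 3 * c2 ^ 2) (27 * c0 - 9 * c2 * c1 + 2 * c2 ^ 3))"
    by (simp add: disc_def)
  moreover have "poly \<Delta> (int t') = disc (9 * c1 - 3 * c2 ^ 2) (27 * c0 - 9 * c2 * c1 + 2 * c2 ^ 3)"
    unfolding at dep_p_def dep_q_def c0_def c1_def c2_def by simp
  ultimately have n: "0 \<le> poly \<Delta> (int t')" by (simp only: of_int_0_le_iff)
  have s: "0 < poly \<Delta> (int t') * lead_coeff \<Delta>" "0 < poly \<Delta> (int t) * lead_coeff \<Delta>"
    using poly_sign_large[OF \<Delta>0 c[folded \<Delta>_def] t'] poly_sign_large[OF \<Delta>0 c[folded \<Delta>_def] t] by simp_all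
  have "0 < lead_coeff \<Delta>" using s(1) n by (simp add: zero_less_mult_iff)
  then have "0 < poly \<Delta> (int t)" using s(2) by (simp add: zero_less_mult_iff)
  then show ?thesis unfolding at .
qed

section \<open>An explicit bound\<close>

definition coeff_size :: "nat \<Rightarrow> nat" where
  "coeff_size d = 38 * ((d + 1) * d) ^ 3"

text \<open>
  The ratio \<open>s\<close> of the degree of the approximants to \<open>l\<close>, as required by \<open>gap_argument\<close> for the exponent \<open>1 + 1 / b\<close>.
\<close>

definition order_ratio :: "nat \<Rightarrow> nat \<Rightarrow> nat" where
  "order_ratio d b = loss d + 2 * loss d * (b + 1)"

text \<open>
  The sum of the exponents in \<open>gap_argument\<close>, for \<open>l \<ge> 12 d + 1\<close>, and in \<open>recover_solution\<close>.
\<close>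

definition exponent :: "nat \<Rightarrow> nat \<Rightarrow> nat" where
  "exponent d b = 10 * (9 * d + 1) + ((order_ratio d b + loss d) * (12 * d + 1) + loss d + 1
     + 2 * (order_ratio d b + 2 * loss d + 3)) + 2"

text \<open>
  The first summand makes \<open>t\<^sup>9\<^sup>d\<^sup>+\<^sup>1\<close> a bound for the specialized data and fixes the sign of the discriminant; the second one
  lets the constants of the approximants be absorbed.
\<close>

definition threshold :: "nat \<Rightarrow> nat \<Rightarrow> nat" where
  "threshold d b = 31 * (coeff_size d * (3 * d + 1)) ^ 3
     + (4 * root_size d (coeff_size d)) ^ (14 * order_ratio d b ^ 2) + 2"

lemma dep_bounds:
  assumes deg: "\<And>i. degree (coeff P i) \<le> d" and co: "\<And>i j. \<bar>coeff (coeff P i) j\<bar> \<le> int d" and d: "1 \<le> d"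
  shows "degree (dep_p P) \<le> 2 * d" "degree (dep_q P) \<le> 3 * d"
    and "\<And>N. wsum N 1 (rps (dep_p P)) \<le> real (coeff_size d)" "\<And>N. wsum N 1 (rps (dep_q P)) \<le> real (coeff_size d)"
    and "\<And>i N. wsum N 1 (rps (coeff P i)) \<le> real ((d + 1) * d)"
proof -
  interpret r: ring_map rps by (rule ring_map_rps)
  show "degree (dep_p P) \<le> 2 * d"
    unfolding dep_p_def
    by (intro degree_diff_le degree_numeral_mult degree_power_le'[OF deg] order_trans[OF deg]) simp_all
  show "degree (dep_q P) \<le> 3 * d"
    unfolding dep_q_def mult.assoc
    by (intro degree_add_le degree_diff_le degree_numeral_mult degree_power_le'[OF deg] degree_mult_le'[OF deg deg]
        order_trans[OF deg]) simp_all
  have co': "real_of_int \<bar>coeff (coeff P i) j\<bar> \<le> real d" for i j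
    using co[of i j] by linarith
  have w: "wsum N 1 (rps (coeff P i)) \<le> real ((d + 1) * d)" for i N
    using wsum_rps_le[OF deg[of i] co'[of i], of N] by (simp only: of_nat_mult)
  show "wsum N 1 (rps (coeff P i)) \<le> real ((d + 1) * d)" for i N by (rule w)
  have "1 * 1 \<le> (d + 1) * d" using d by (intro mult_le_mono) auto
  from of_nat_mono[OF this] have L: "1 \<le> real ((d + 1) * d)" unfolding mult_1 of_nat_1 .
  have cs: "real (coeff_size d) = 38 * real ((d + 1) * d) ^ 3" by (simp add: coeff_size_def)
  note wb = wsum_cube_bounds[OF L w[of _ 2] w[of _ 1] w[of _ 0]]
  show "wsum N 1 (rps (dep_p P)) \<le> real (coeff_size d)" for N
    unfolding cs dep_p_def r.hom by (rule wb(1))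
  show "wsum N 1 (rps (dep_q P)) \<le> real (coeff_size d)" for N
    unfolding cs dep_q_def r.hom by (rule wb(2))
qed


text \<open>
  The inequality for the linear forms bounds \<open>x - \<xi> y\<close> from below, the factorization of the norm form bounds it from above. If
  \<open>y = 0\<close>, the equation reads \<open>x\<^sup>3 = q\<close>.
\<close>

theorem explicit_bound:
  fixes P :: "int poly poly" and \<xi> \<gamma> :: qt_closure and t d b :: nat and x y q :: int
  assumes irr: "Factorial_Ring.irreducible P" and P: "degree P = 3" "lead_coeff P = 1"
    and one: "\<forall>\<^sub>F t :: nat in sequentially. \<exists>!z :: real. poly (map_poly of_int (specialize P (int t))) z = 0"
    and \<xi>: "eval_at P \<xi> = 0" and \<gamma>: "unit_in (Z_adjoin \<xi>) \<gamma>" "\<not> algebraic \<gamma>"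
    and deg: "\<And>i. degree (coeff P i) \<le> d" and co: "\<And>i j. \<bar>coeff (coeff P i) j\<bar> \<le> int d" and d: "1 \<le> d"
    and b: "1 \<le> b" and t: "threshold d b \<le> t" and q: "q \<noteq> 0" "norm_form P (int t) x y = of_int q"
  shows "real_of_int (max \<bar>x\<bar> \<bar>y\<bar>) \<le> real t ^ exponent d b * real_of_int \<bar>q\<bar> powr (1 + 1 / b)"
proof -
  define c where "c = coeff_size d"
  define K where "K = loss d"
  define s where "s = order_ratio d b"
  define n where "n = 9 * d + 1"
  define Q where "Q = real_of_int \<bar>q\<bar>"
  have sK: "s = K + 2 * K * (b + 1)" by (simp add: s_def K_def order_ratio_def)
  have K2: "2 \<le> K" by (simp add: K_def loss_def)
  then have s2: "2 \<le> s" using sK by linarith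
  have K1: "1 \<le> K" using K2 by linarith
  have Q1: "1 \<le> Q" using q(1) unfolding Q_def by linarith
  note dep = dep_bounds[OF deg co d, folded c_def]
  have tc: "31 * (c * (3 * d + 1)) ^ 3 + (4 * root_size d c) ^ (14 * s ^ 2) + 2 \<le> t"
    using t unfolding threshold_def c_def s_def .
  have t2: "2 \<le> real t" and t1: "1 \<le> t" and tE: "(4 * root_size d c) ^ (14 * s ^ 2) \<le> t" using tc by linarith+
  have tr1: "1 \<le> real t" using t2 by linarith
  define \<mu> where "\<mu> = real c * real (3 * d + 1)"
  have c1: "1 \<le> c"
  proof -
    have "1 \<le> ((d + 1) * d) ^ 3" using d by (intro one_le_power) simp
    then show ?thesis unfolding c_def coeff_size_def by linarith
  qed
  have c\<mu>: "real c \<le> \<mu>" using mult_left_mono[of 1 "real (3 * d + 1)" "real c"] by (simp add: \<mu>_def)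
  have \<mu>1: "1 \<le> \<mu>" using c\<mu> c1 by simp
  have \<mu>t: "31 * \<mu> ^ 3 \<le> real t"
  proof -
    have "real (31 * (c * (3 * d + 1)) ^ 3) \<le> real t" using tc by (intro of_nat_mono) linarith
    then show ?thesis by (simp only: \<mu>_def of_nat_mult of_nat_power of_nat_numeral)
  qed
  \<comment> \<open>\<open>M\<close> bounds \<open>p(t)\<close> and \<open>q(t)\<close>, and \<open>31 M\<^sup>3\<close> bounds the discriminant.\<close>
  define M where "M = \<mu> * real t ^ (3 * d)"
  have M1: "1 \<le> M" using mult_mono[OF \<mu>1 one_le_power[OF tr1, of "3 * d"]] \<mu>1 by (simp add: M_def)
  have MT: "31 * M ^ 3 \<le> real t ^ n"
  proof -
    have "31 * M ^ 3 = (31 * \<mu> ^ 3) * real t ^ (9 * d)"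
      unfolding M_def power_mult_distrib power_mult[symmetric] by (simp add: mult.commute)
    also have "\<dots> \<le> real t * real t ^ (9 * d)" using \<mu>t by (intro mult_right_mono) auto
    finally show ?thesis by (simp add: n_def)
  qed
  have M3: "M \<le> M ^ 3" by (rule self_le_power[OF M1]) simp
  have bound: "\<bar>real_of_int (poly f (int t))\<bar> \<le> M" if "degree f \<le> m" "m \<le> 3 * d" "\<And>N. wsum N 1 (rps f) \<le> real c" for f m
  proof -
    have "\<bar>real_of_int (poly f (int t))\<bar> \<le> real c * real t ^ m" by (rule poly_le_wsum[OF that(1,3) t1])
    also have "\<dots> \<le> \<mu> * real t ^ (3 * d)"
      using that(2) c\<mu> tr1 \<mu>1 by (intro mult_mono power_increasing) auto
    finally show ?thesis unfolding M_def .
  qed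
  define p0 where "p0 = poly (dep_p P) (int t)"
  define q0 where "q0 = poly (dep_q P) (int t)"
  have pM: "\<bar>real_of_int p0\<bar> \<le> M" unfolding p0_def by (rule bound[OF dep(1) _ dep(3)]) simp
  have qM: "\<bar>real_of_int q0\<bar> \<le> M" unfolding q0_def by (rule bound[OF dep(2) _ dep(4)]) simp
  have pT: "1 + \<bar>real_of_int p0\<bar> + \<bar>real_of_int q0\<bar> \<le> real t ^ n" using pM qM M1 M3 MT by linarith
  have T4: "4 \<le> real t ^ n" using M1 M3 MT by linarith
  have DT: "\<bar>real_of_int (disc p0 q0)\<bar> \<le> real t ^ n"
  proof -
    have "\<bar>real_of_int p0\<bar> ^ 3 \<le> M ^ 3" "\<bar>real_of_int q0\<bar> ^ 2 \<le> M ^ 2" using pM qM by (intro power_mono; simp)+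
    moreover have "M ^ 2 \<le> M ^ 3" by (rule power_increasing[OF _ M1]) simp
    moreover have "\<bar>real_of_int (disc p0 q0)\<bar> \<le> 4 * \<bar>real_of_int p0\<bar> ^ 3 + 27 * \<bar>real_of_int q0\<bar> ^ 2"
      unfolding disc_def using abs_triangle_ineq[of "4 * real_of_int p0 ^ 3" "27 * real_of_int q0 ^ 2"]
      by (simp add: abs_mult power_abs)
    ultimately show ?thesis using MT by linarith
  qed
  have cT: "real c * (3 * d + 1) * t ^ (3 * d) \<le> real t ^ n"
  proof -
    have "real c * (3 * d + 1) * t ^ (3 * d) = M" by (simp add: M_def \<mu>_def)
    then show ?thesis using M1 M3 MT by linarith
  qed
  have wD: "wsum N 1 (rps (disc (dep_p P) (dep_q P))) \<le> 31 * real c ^ 3" for N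
    unfolding ring_map.hom_disc[OF ring_map_rps] unfolding disc_def
    by (rule wsum_cube_bounds(3)[OF _ dep(3) dep(4) dep(4)]) (use c1 in simp)
  have "31 * real c ^ 3 \<le> 31 * \<mu> ^ 3" using c\<mu> by (intro mult_left_mono power_mono) auto
  moreover have "31 * \<mu> ^ 3 < real t"
  proof -
    have "real (31 * (c * (3 * d + 1)) ^ 3) < real t" using tc by (intro iffD2[OF of_nat_less_iff]) linarith
    then show ?thesis by (simp only: \<mu>_def of_nat_mult of_nat_power of_nat_numeral)
  qed
  ultimately have Dpos: "0 < disc p0 q0"
    unfolding p0_def q0_def by (intro disc_positive[OF irr P one wD]) linarith
  obtain \<eta> :: "rat fps" where \<eta>: "\<eta> ^ 3 + fps_of_poly (map_poly of_int (rev_poly (2 * d) (dep_p P))) * \<eta>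
    + fps_of_poly (map_poly of_int (rev_poly (3 * d) (dep_q P))) = 0"
    using power_series_root[OF irr P \<xi> \<gamma> dep(1,2)] by blast
  have "disc (poly (dep_p P) (int t)) (poly (dep_q P) (int t)) \<noteq> 0"
    using Dpos unfolding p0_def q0_def by simp
  note lfi = linear_form_inequality[OF \<eta> no_rational_root[OF irr P] dep(1,2,3,4) T4[unfolded n_def]
      pT[unfolded p0_def q0_def n_def] DT[unfolded p0_def q0_def n_def] cT[unfolded n_def] this s2 tE,
      folded p0_def q0_def K_def]
  obtain \<zeta> :: real where \<zeta>: "\<And>y :: int. y \<noteq> 0 \<Longrightarrow> \<zeta> ^ 3 + of_int p0 * \<zeta> + of_int q0 = 0"
    "\<And>y l x. y \<noteq> 0 \<Longrightarrow> 12 * d + 1 \<le> l \<Longrightarrow> real t ^ (s * l) \<le> \<bar>of_int y\<bar> * real t ^ (K * l)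
      + real t ^ ((2 * s + K) * l) * \<bar>of_int x - \<zeta> * of_int y\<bar>"
    using lfi by blast
  have \<zeta>1: "\<zeta> ^ 3 + of_int p0 * \<zeta> + of_int q0 = 0" by (rule \<zeta>(1)[of 1]) simp
  show ?thesis
  proof (cases "y = 0")
    case True
    have "q = x ^ 3" using q(2) unfolding norm_form_cubic[OF P] True by simp
    then have "\<bar>q\<bar> = \<bar>x\<bar> ^ 3" by (simp add: power_abs)
    moreover have "1 \<le> \<bar>x\<bar>" using q(1) \<open>q = x ^ 3\<close> by (cases "x = 0") auto
    ultimately have "\<bar>x\<bar> \<le> \<bar>q\<bar>" using self_le_power[of "\<bar>x\<bar>" 3] by simp
    then have "real_of_int (max \<bar>x\<bar> \<bar>y\<bar>) \<le> 1 * Q" by (simp add: True Q_def)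
    also have "\<dots> \<le> real t ^ exponent d b * Q powr (1 + 1 / b)"
      using powr_mono[of 1 "1 + 1 / b" Q] Q1 tr1 by (intro mult_mono one_le_power) auto
    finally show ?thesis unfolding Q_def .
  next
    case False
    define z where "z = 3 * x + poly (coeff P 2) (int t) * y"
    have N: "z ^ 3 + p0 * z * y ^ 2 + q0 * y ^ 3 = 27 * q"
      unfolding z_def p0_def q0_def by (rule depressed_norm_form[OF P q(2)])
    have "real_of_int (z ^ 3 + p0 * z * y ^ 2 + q0 * y ^ 3) = real_of_int (27 * q)" unfolding N ..
    then have N': "real_of_int z ^ 3 + real_of_int p0 * real_of_int z * real_of_int y ^ 2 + real_of_int q0 * real_of_int y ^ 3
        = 27 * real_of_int q" by simp
    have Tz: "\<bar>\<zeta>\<bar> \<le> real t ^ n"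
    proof -
      have "complex_of_real (\<zeta> ^ 3 + of_int p0 * \<zeta> + of_int q0) = 0" unfolding \<zeta>1 by simp
      then have "complex_of_real \<zeta> ^ 3 + of_int p0 * complex_of_real \<zeta> + of_int q0 = 0" by simp
      from cubic_root_bound[OF this] show ?thesis using pT by simp
    qed
    have "1 \<le> disc p0 q0" using Dpos by linarith
    then have "1 \<le> real_of_int (disc p0 q0)" by (simp only: of_int_1_le_iff)
    then have D1: "1 \<le> disc (real_of_int p0) (real_of_int q0)" by (simp add: disc_def)
    have pT': "\<bar>real_of_int p0\<bar> \<le> real t ^ n" using pT by linarith
    have lin: "\<bar>real_of_int z - \<zeta> * real_of_int y\<bar> * real_of_int y ^ 2 \<le> (real t ^ n) ^ 10 * Q"
      using linear_factor_upper[OF \<zeta>1 D1 T4 Tz pT' N'] by (simp add: Q_def)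
    have nK: "10 * n \<le> K" unfolding n_def K_def loss_def by simp
    have lin': "\<bar>real_of_int z - \<zeta> * real_of_int y\<bar> * \<bar>real_of_int y\<bar> ^ 2 \<le> Q * real t ^ K"
    proof -
      have "(real t ^ n) ^ 10 * Q = Q * real t ^ (10 * n)" by (simp add: power_mult[symmetric] mult.commute)
      also have "\<dots> \<le> Q * real t ^ K" using nK tr1 Q1 by (intro mult_left_mono power_increasing) auto
      finally show ?thesis using lin by simp
    qed
    have y1: "1 \<le> \<bar>real_of_int y\<bar>" using False by linarith
    have Y: "\<bar>real_of_int y\<bar> \<le> Q powr (1 + 1 / b)
        * real t ^ ((s + K) * (12 * d + 1) + K + 1 + 2 * (s + 2 * K + 3))"
      by (rule gap_argument[OF t2 y1 Q1 K1 b sK \<zeta>(2)[OF False] _ lin']) simp_all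
    have p1: "\<bar>real_of_int (poly (coeff P 2) (int t))\<bar> \<le> real t ^ n"
    proof -
      have "wsum N 1 (rps (coeff P 2)) \<le> real c" for N
      proof -
        have "(d + 1) * d \<le> ((d + 1) * d) ^ 3" using d by (intro self_le_power) simp_all
        then have "(d + 1) * d \<le> c" unfolding c_def coeff_size_def by linarith
        then show ?thesis using dep(5)[of N 2] by (meson of_nat_mono order_trans)
      qed
      from bound[OF deg _ this] have "\<bar>real_of_int (poly (coeff P 2) (int t))\<bar> \<le> M" by simp
      then show ?thesis using M1 M3 MT by linarith
    qed
    have zz: "real_of_int z = 3 * real_of_int x + real_of_int (poly (coeff P 2) (int t)) * real_of_int y"
      by (simp add: z_def)
    have "max \<bar>real_of_int x\<bar> \<bar>real_of_int y\<bar> \<le> real t ^ exponent d b * Q powr (1 + 1 / b)"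
      unfolding exponent_def s_def[symmetric] K_def[symmetric] n_def[symmetric]
      by (rule recover_solution[OF t2 Q1 y1 Y Tz p1 lin[unfolded zz]])
    moreover have "real_of_int (max \<bar>x\<bar> \<bar>y\<bar>) = max \<bar>real_of_int x\<bar> \<bar>real_of_int y\<bar>"
      by (simp only: max_def of_int_abs[symmetric] of_int_le_iff if_distrib[of real_of_int])
    ultimately show ?thesis unfolding Q_def by simp
  qed
qed

section \<open>Effectivity\<close>

text \<open>
  The bounds depend on the code of \<open>P\<close> and on \<open>b\<close> through sums, products and powers, so closure under these three
  operations is all that is needed of the theory of recursive functions.
\<close>

definition computable :: "(nat \<Rightarrow> nat \<Rightarrow> nat \<Rightarrow> nat) \<Rightarrow> bool" where
  "computable f \<longleftrightarrow> (\<exists>r. \<forall>n a b. rec_eval r [n, a, b] (f n a b))"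

lemma rec_eval_proj: "i < length xs \<Longrightarrow> y = xs ! i \<Longrightarrow> rec_eval (Proj i) xs y"
  using rec_eval.proj by simp

lemma rec_eval_comp1: "rec_eval g xs y \<Longrightarrow> rec_eval f [y] z \<Longrightarrow> rec_eval (Comp f [g]) xs z"
  by (rule rec_eval.comp[of xs _ "[y]"]) simp_all

lemma rec_eval_comp2:
  "rec_eval g xs y \<Longrightarrow> rec_eval h xs y' \<Longrightarrow> rec_eval f [y, y'] z \<Longrightarrow> rec_eval (Comp f [g, h]) xs z"
  by (rule rec_eval.comp[of xs _ "[y, y']"]) simp_all

definition rec_add :: recf where
  "rec_add = PrimRec (Proj 0) (Comp Succ [Proj 1])"

definition rec_mult :: recf where
  "rec_mult = PrimRec Zero (Comp rec_add [Proj 1, Proj 2])"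

definition rec_power :: recf where
  "rec_power = PrimRec (Comp Succ [Zero]) (Comp rec_mult [Proj 1, Proj 2])"

lemma rec_eval_add: "rec_eval rec_add [n, m] (n + m)"
  unfolding rec_add_def
proof (induction n)
  case 0
  show ?case by (rule rec_eval.prim_0) (simp add: rec_eval_proj)
next
  case (Suc n)
  show ?case
    by (rule rec_eval.prim_Suc[OF Suc.IH])
      (auto intro!: rec_eval_comp1[of _ _ "n + m"] rec_eval_proj rec_eval.succ)
qed

lemma rec_eval_mult: "rec_eval rec_mult [n, m] (n * m)"
  unfolding rec_mult_def
proof (induction n)
  case 0
  show ?case by (rule rec_eval.prim_0) (simp add: rec_eval.zero)
next
  case (Suc n)
  have "rec_eval (Comp rec_add [Proj 1, Proj 2]) [n, n * m, m] (n * m + m)"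
    by (rule rec_eval_comp2[OF _ _ rec_eval_add]) (simp_all add: rec_eval_proj)
  from rec_eval.prim_Suc[OF Suc.IH this] show ?case by (simp add: add.commute)
qed

lemma rec_eval_power: "rec_eval rec_power [n, m] (m ^ n)"
  unfolding rec_power_def
proof (induction n)
  case 0
  have "rec_eval (Comp Succ [Zero]) [m] 1"
    using rec_eval_comp1[OF rec_eval.zero rec_eval.succ] by simp
  from rec_eval.prim_0[OF this] show ?case by simp
next
  case (Suc n)
  have "rec_eval (Comp rec_mult [Proj 1, Proj 2]) [n, m ^ n, m] (m ^ n * m)"
    by (rule rec_eval_comp2[OF _ _ rec_eval_mult]) (simp_all add: rec_eval_proj)
  from rec_eval.prim_Suc[OF Suc.IH this] show ?case by (simp add: mult.commute)
qed

lemma computable_code: "computable (\<lambda>n a b. n)"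
  unfolding computable_def by (intro exI[of _ "Proj 0"] allI rec_eval_proj) simp_all

lemma computable_denominator: "computable (\<lambda>n a b. b)"
  unfolding computable_def by (intro exI[of _ "Proj 2"] allI rec_eval_proj) simp_all

lemma computable_const: "computable (\<lambda>n a b. c)"
proof (induction c)
  case 0
  show ?case unfolding computable_def by (intro exI[of _ Zero] allI rec_eval.zero)
next
  case (Suc c)
  then obtain r where r: "\<And>n a b. rec_eval r [n, a, b] c" unfolding computable_def by blast
  show ?case unfolding computable_def
    by (intro exI[of _ "Comp Succ [r]"] allI rec_eval_comp1[OF r rec_eval.succ])
qed

lemma computable_comp2:
  assumes "computable f" "computable g" and op: "\<And>m n. rec_eval r [m, n] (h m n)"
  shows "computable (\<lambda>n a b. h (f n a b) (g n a b))"
proof -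
  obtain rf rg where "\<And>n a b. rec_eval rf [n, a, b] (f n a b)" "\<And>n a b. rec_eval rg [n, a, b] (g n a b)"
    using assms(1,2) unfolding computable_def by blast
  then show ?thesis unfolding computable_def
    by (intro exI[of _ "Comp r [rf, rg]"] allI rec_eval_comp2[OF _ _ op])
qed

lemma computable_add: "computable f \<Longrightarrow> computable g \<Longrightarrow> computable (\<lambda>n a b. f n a b + g n a b)"
  by (rule computable_comp2[OF _ _ rec_eval_add])

lemma computable_mult: "computable f \<Longrightarrow> computable g \<Longrightarrow> computable (\<lambda>n a b. f n a b * g n a b)"
  by (rule computable_comp2[OF _ _ rec_eval_mult])

lemma computable_power: "computable f \<Longrightarrow> computable g \<Longrightarrow> computable (\<lambda>n a b. f n a b ^ g n a b)"
  by (rule computable_comp2[OF _ _ rec_eval_power])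

lemmas computable_intros = computable_add computable_mult computable_power computable_code computable_denominator
  computable_const

lemma computable_exponent: "computable (\<lambda>n a b. exponent (n + 1) b)"
  unfolding exponent_def order_ratio_def loss_def by (intro computable_intros)

lemma computable_threshold: "computable (\<lambda>n a b. threshold (n + 1) b)"
  unfolding threshold_def order_ratio_def loss_def root_size_def coeff_size_def Let_def by (intro computable_intros)

text \<open>The code of \<open>P\<close> is at least as large as everything that it encodes, so it serves as a bound for degrees and coefficients.\<close>

lemma mem_le_list_encode: "x \<in> set xs \<Longrightarrow> x \<le> list_encode xs"
proof (induction xs)
  case (Cons y ys)
  then show ?case
    using le_prod_encode_1[of y "list_encode ys"] le_prod_encode_2[of "list_encode ys" y] by auto
qed simp

lemma length_le_list_encode: "length xs \<le> list_encode xs"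
proof (induction xs)
  case (Cons y ys)
  then show ?case using le_prod_encode_2[of "list_encode ys" y] by simp
qed simp

lemma abs_le_int_encode: "\<bar>z\<bar> \<le> int (int_encode z)"
  by (simp add: int_encode_def sum_encode_def)

lemma coeff_le_poly_code:
  shows "degree (coeff P i) \<le> poly_code P + 1" and "\<bar>coeff (coeff P i) j\<bar> \<le> int (poly_code P + 1)"
proof -
  define code where "code c = list_encode (map int_encode (coeffs c))" for c
  have pc: "poly_code P = list_encode (map code (coeffs P))"
    by (simp add: poly_code_def code_def[abs_def])
  have mem: "f = 0 \<or> f \<in> set (coeffs Q)" if "f = coeff Q n" for f :: "'a :: zero" and Q n
    using that coeff_in_coeffs[of Q n] by (cases "n \<le> degree Q"; cases "Q = 0") (auto simp: coeff_eq_0)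
  have c: "coeff P i = 0 \<or> code (coeff P i) \<le> poly_code P"
    using mem[OF refl, of P i] mem_le_list_encode[of "code (coeff P i)" "map code (coeffs P)"] unfolding pc by auto
  have "degree f \<le> code f" for f
    using length_le_list_encode[of "map int_encode (coeffs f)"] by (simp add: code_def length_coeffs_degree coeffs_def split: if_splits)
  then show "degree (coeff P i) \<le> poly_code P + 1" using c by (metis degree_0 le_add1 le_add2 le_trans zero_le)
  have "\<bar>coeff f j\<bar> \<le> int (code f)" for f
  proof -
    have "coeff f j = 0 \<or> int_encode (coeff f j) \<le> code f"
      using mem[OF refl, of f j] mem_le_list_encode[of "int_encode (coeff f j)" "map int_encode (coeffs f)"]
      unfolding code_def by auto
    then show ?thesis using abs_le_int_encode[of "coeff f j"] by auto
  qed
  from this[of "coeff P i"] show "\<bar>coeff (coeff P i) j\<bar> \<le> int (poly_code P + 1)" using c by auto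
qed

theorem theorem1p4:
  shows "\<exists>F G :: recf. \<forall>(P :: int poly poly) (\<xi> :: qt_closure).
    Factorial_Ring.irreducible P \<longrightarrow>
    Polynomial.degree P = 3 \<longrightarrow>
    Polynomial.lead_coeff P = 1 \<longrightarrow>
    (\<forall>\<^sub>F t :: nat in sequentially.
       \<exists>!z :: real. poly (map_poly of_int (specialize P (int t))) z = 0) \<longrightarrow>
    eval_at P \<xi> = 0 \<longrightarrow>
    (\<exists>\<gamma>. unit_in (Z_adjoin \<xi>) \<gamma> \<and> \<not> algebraic \<gamma>) \<longrightarrow>
    (\<forall>\<epsilon> :: real. 0 < \<epsilon> \<longrightarrow>
      (\<forall>a b :: nat. 0 < a \<longrightarrow> 0 < b \<longrightarrow> real a / real b \<le> \<epsilon> \<longrightarrow>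
        (\<exists>C t0 :: nat.
          rec_eval F [poly_code P, a, b] C \<and>
          rec_eval G [poly_code P, a, b] t0 \<and>
          (\<forall>t :: nat. 0 < t \<longrightarrow> t0 \<le> t \<longrightarrow>
            (\<forall>q x y :: int. q \<noteq> 0 \<longrightarrow> norm_form P (int t) x y = of_int q \<longrightarrow>
              real_of_int (max \<bar>x\<bar> \<bar>y\<bar>) \<le> real t ^ C * real_of_int \<bar>q\<bar> powr (1 + \<epsilon>))))))"
proof -
  obtain F where F: "\<And>n a b. rec_eval F [n, a, b] (exponent (n + 1) b)"
    using computable_exponent unfolding computable_def by blast
  obtain G where G: "\<And>n a b. rec_eval G [n, a, b] (threshold (n + 1) b)"
    using computable_threshold unfolding computable_def by blast
  have bound: "real_of_int (max \<bar>x\<bar> \<bar>y\<bar>) \<le> real t ^ exponent (poly_code P + 1) b * real_of_int \<bar>q\<bar> powr (1 + \<epsilon>)"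
    if irr: "Factorial_Ring.irreducible P" and P: "degree P = 3" "lead_coeff P = 1"
      and one: "\<forall>\<^sub>F t :: nat in sequentially. \<exists>!z :: real. poly (map_poly of_int (specialize P (int t))) z = 0"
      and \<xi>: "eval_at P \<xi> = 0" and unit: "\<exists>\<gamma>. unit_in (Z_adjoin \<xi>) \<gamma> \<and> \<not> algebraic \<gamma>"
      and ab: "0 < a" "0 < b" "real a / real b \<le> \<epsilon>" and t: "threshold (poly_code P + 1) b \<le> t"
      and q: "q \<noteq> 0" "norm_form P (int t) x y = of_int q"
    for P \<xi> \<epsilon> and a b t :: nat and q x y :: int
  proof -
    obtain \<gamma> where \<gamma>: "unit_in (Z_adjoin \<xi>) \<gamma>" "\<not> algebraic \<gamma>" using unit by blast
    have b1: "1 \<le> b" using ab(2) by simp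
    have "1 / real b \<le> real a / real b" using ab(1) by (intro divide_right_mono) auto
    then have e: "1 + 1 / real b \<le> 1 + \<epsilon>" using ab(3) by linarith
    have q1: "1 \<le> real_of_int \<bar>q\<bar>" using q(1) by linarith
    have "real_of_int (max \<bar>x\<bar> \<bar>y\<bar>)
        \<le> real t ^ exponent (poly_code P + 1) b * real_of_int \<bar>q\<bar> powr (1 + 1 / real b)"
      by (rule explicit_bound[OF irr P one \<xi> \<gamma> coeff_le_poly_code _ b1 t q]) simp
    also have "\<dots> \<le> real t ^ exponent (poly_code P + 1) b * real_of_int \<bar>q\<bar> powr (1 + \<epsilon>)"
      by (rule mult_left_mono[OF powr_mono[OF e q1]]) simp
    finally show ?thesis .
  qed
  show ?thesis
  proof (rule exI[of _ F], rule exI[of _ G], intro allI impI)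
    fix P :: "int poly poly" and \<xi> :: qt_closure and \<epsilon> :: real and a b :: nat
    assume h: "Factorial_Ring.irreducible P" "degree P = 3" "lead_coeff P = 1"
      "\<forall>\<^sub>F t :: nat in sequentially. \<exists>!z :: real. poly (map_poly of_int (specialize P (int t))) z = 0"
      "eval_at P \<xi> = 0" "\<exists>\<gamma>. unit_in (Z_adjoin \<xi>) \<gamma> \<and> \<not> algebraic \<gamma>"
      and ab: "0 < a" "0 < b" "real a / real b \<le> \<epsilon>"
    show "\<exists>C t0 :: nat. rec_eval F [poly_code P, a, b] C \<and> rec_eval G [poly_code P, a, b] t0 \<and>
          (\<forall>t :: nat. 0 < t \<longrightarrow> t0 \<le> t \<longrightarrow>
            (\<forall>q x y :: int. q \<noteq> 0 \<longrightarrow> norm_form P (int t) x y = of_int q \<longrightarrow>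
              real_of_int (max \<bar>x\<bar> \<bar>y\<bar>) \<le> real t ^ C * real_of_int \<bar>q\<bar> powr (1 + \<epsilon>)))"
    proof (intro exI conjI allI impI)
      show "rec_eval F [poly_code P, a, b] (exponent (poly_code P + 1) b)" by (rule F)
      show "rec_eval G [poly_code P, a, b] (threshold (poly_code P + 1) b)" by (rule G)
      fix t :: nat and q x y :: int
      assume "threshold (poly_code P + 1) b \<le> t" "q \<noteq> 0" "norm_form P (int t) x y = of_int q"
      then show "real_of_int (max \<bar>x\<bar> \<bar>y\<bar>) \<le> real t ^ exponent (poly_code P + 1) b * real_of_int \<bar>q\<bar> powr (1 + \<epsilon>)"
        by (rule bound[OF h ab])
    qed
  qed
qed

end
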